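(* Let $d\ge1$. Let $K:(\mathbb{R}_*^d)^2\to\mathbb{R}$ be continuous with $K(x,y)=K(y,x)\ge 0$, and suppose that there are constants $0<c_1\le c_2<\infty$ and $\gamma,p\in\mathbb{R}$ with $\gamma+2p\ge 0$, $\gamma<1$, $\gamma+p<1$ such that $$c_1(|x|+|y|)^\gamma\Phi_p\Big(\frac{|x|}{|x|+|y|}\Big)\le K(x,y)\le c_2(|x|+|y|)^\gamma\Phi_p\Big(\frac{|x|}{|x|+|y|}\Big),\qquad x,y\in\mathbb{R}_*^d,$$ where $\Phi_p(s)=s^{-p}(1-s)^{-p}$ for $0<s<1$. Suppose that $f\in C([0,\infty);\mathcal{M}_+(\mathbb{R}_*^d))$ is a weak solution of the coagulation equation with kernel $K$, with initial value $f_0=f(\cdot,0)$, such that $0<\int_{\mathbb{R}_*^d}|x|f(dx,t)=m_0<\infty$. Assume that there are $a>1$ and $C_0>0$ such that, for all $k\in[1/a,a]$, $$\int_{\mathbb{R}_*^d}|x|^kf(dx,t)\le C_0\,t^{\frac{k-1}{1-\gamma}},\qquad t\ge1.$$ Then there exist a function $\delta\in C([0,\infty))$ with $\delta(t)>0$ for $t\in[1,\infty)$ and $\lim_{t\to\infty}\delta(t)=0$, and a Borel set $I\subset[0,\infty)$ with $\lim_{T\to\infty}\frac{|I\cap[T,2T]|}{T}=0$, such that $$\lim_{T\to\infty}\left(\sup_{t\in[T,2T]\setminus I}\left|\int_{\{\delta(t)t^{\frac1{1-\gamma}}\le|x|\le(\delta(t))^{-1}t^{\frac1{1-\gamma}}\}\cap\{|\frac{x}{|x|}-\theta_0|\le\delta(t)\}}|x|\,f(dx,t)-m_0\right|\right)=0,$$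 where $\theta_0=\frac{1}{m_0}\int_{\mathbb{R}_*^d}x f_0(dx)\in\Delta^{d-1}$.
   Context: Notation: $\mathbb{R}_*^d=[0,\infty)^d\setminus\{O\}$ with $O=(0,\dots,0)$; $|x|=\sum_{j=1}^d|x_j|$ for $x\in\mathbb{R}^d$; for a Borel set $J\subset\mathbb{R}$, $|J|$ is its Lebesgue measure; $\Delta^{d-1}=\{\theta\in\mathbb{R}_*^d:|\theta|=1\}$; $\mathcal{M}_+(\mathbb{R}_*^d)$ is the set of nonnegative Radon measures on $\mathbb{R}_*^d$, endowed with the weak-$*$ topology (duality with $C_c(\mathbb{R}_*^d)$). The coagulation equation with kernel $K$ is $$\partial_t f(x,t)=\frac12\int_{\{0<\xi<x\}}K(x-\xi,\xi)f(x-\xi,t)f(\xi,t)\,d\xi-\int_{\mathbb{R}_*^d}K(x,\xi)f(x,t)f(\xi,t)\,d\xi,$$ where $\xi<x$ means $\xi\le x$ componentwise and $\xi\ne x$. Definition (weak solution). Let $K$ be continuous, symmetric, nonnegative and satisfy the upper bound $K(x,y)\le c_2(|x|+|y|)^\gamma\Phi_p(|x|/(|x|+|y|))$ with $\gamma+2p\ge0$, and let $f_0\in\mathcal{M}_+(\mathbb{R}_*^d)$ satisfy $\int|x|f_0(dx)<\infty$. A function $f\in C([0,\infty);\mathcal{M}_+(\mathbb{R}_*^d))$ (weak-$*$ topology) is a weak solution of the coagulation equation with initial value $f_0$ if $f(\cdot,0)=f_0$; for each $1<T<\infty$, $$\sup_{t\in[1/T,T]}\Big[\int_{\{|x|\ge1\}}|x|^{\gamma+p}f(dx,t)+\int_{\{|x|\le1\}}|x|^{1-p}f(dx,t)\Big]<\infty;$$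 $\int_{\mathbb{R}_*^d}xf(dx,t)=\int_{\mathbb{R}_*^d}xf_0(dx)$ for all $t>0$; and for all $\varphi\in C_c^1(\mathbb{R}_*^d\times(0,\infty))$, $$0=\int_0^\infty\!\!\int_{\mathbb{R}_*^d}f(dx,t)\partial_t\varphi(x,t)\,dt+\frac12\int_0^\infty\!\!\int_{\mathbb{R}_*^d}\int_{\mathbb{R}_*^d}K(x,y)f(dx,t)f(dy,t)[\varphi(x+y,t)-\varphi(x,t)-\varphi(y,t)]\,dt.$$ *)

theory Defs
  imports "HOL-Analysis.Analysis"
begin

definition l1norm :: "real ^ 'n \<Rightarrow> real" where
  "l1norm x = (\<Sum>i\<in>UNIV. \<bar>x $ i\<bar>)"

definition Rstar :: "(real ^ 'n) set" where
  "Rstar = {x. (\<forall>i. 0 \<le> x $ i)} - {0}"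

definition Simplex :: "(real ^ 'n) set" where
  "Simplex = {\<theta> \<in> Rstar. l1norm \<theta> = 1}"

definition Phi :: "real \<Rightarrow> real \<Rightarrow> real" where
  "Phi p s = s powr (- p) * (1 - s) powr (- p)"


section \<open>Test functions\<close>

text \<open>Only the values on \<open>S\<close> matter; the support is compact as a subset of \<open>S\<close>.\<close>

definition Cc :: "'a::topological_space set \<Rightarrow> ('a \<Rightarrow> real) set" where
  "Cc S = {\<phi>. continuous_on S \<phi> \<and> (\<exists>C. compact C \<and> C \<subseteq> S \<and> (\<forall>x\<in>S - C. \<phi> x = 0))}"

text \<open>
  The set \<open>Rstar \<times> {0<..}\<close> contains boundary points of the orthant, so the derivative is taken
  relative to \<open>S\<close> (continuous differentiability up to the boundary).
\<close>

definition Cc1 :: "'a::real_normed_vector set \<Rightarrow> ('a \<Rightarrow> real) set" where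
  "Cc1 S = {\<phi> \<in> Cc S. \<exists>D :: 'a \<Rightarrow> ('a \<Rightarrow>\<^sub>L real).
      (\<forall>z\<in>S. (\<phi> has_derivative blinfun_apply (D z)) (at z within S)) \<and> continuous_on S D}"


section \<open>Radon measures on the punctured orthant and the weak-* topology\<close>

text \<open>
  Measures live on the Borel sigma-algebra of the subspace \<open>Rstar\<close>. As \<open>Rstar\<close> is locally compact
  and Polish, a Borel measure on it that is finite on compact sets is automatically regular.
\<close>

definition Radon_measures :: "(real ^ 'n) measure set" where
  "Radon_measures = {\<mu>. sets \<mu> = sets (restrict_space borel Rstar) \<and>
      (\<forall>C. compact C \<and> C \<subseteq> Rstar \<longrightarrow> emeasure \<mu> C < \<infinity>)}"

text \<open>The initial topology for the pairings of a measure with all \<open>\<phi> \<in> Cc Rstar\<close>.\<close>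

definition weak_star_topology :: "(real ^ 'n) measure topology" where
  "weak_star_topology = pullback_topology Radon_measures
      (\<lambda>\<mu>. \<lambda>\<phi>\<in>Cc Rstar. (\<integral>x. \<phi> x \<partial>\<mu>)) (product_topology (\<lambda>_. euclideanreal) (Cc Rstar))"

lemma continuous_map_weak_star_iff:
  "continuous_map X weak_star_topology f \<longleftrightarrow>
     (\<forall>t\<in>topspace X. f t \<in> Radon_measures) \<and>
     (\<forall>\<phi>\<in>Cc Rstar. continuous_map X euclideanreal (\<lambda>t. \<integral>x. \<phi> x \<partial>f t))"
proof -
  let ?F = "\<lambda>\<mu>. \<lambda>\<phi>\<in>Cc Rstar. (\<integral>x. \<phi> x \<partial>\<mu>)"
  let ?P = "product_topology (\<lambda>_. euclideanreal) (Cc Rstar)"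
  have tf: "f t \<in> Radon_measures"
    if "continuous_map X weak_star_topology f" "t \<in> topspace X" for t
    using that unfolding continuous_map_def weak_star_topology_def topspace_pullback_topology
    by auto
  have A: "continuous_map X ?P (?F \<circ> f)" if "continuous_map X weak_star_topology f"
    by (rule continuous_map_compose[OF that[unfolded weak_star_topology_def]])
      (use continuous_map_pullback[OF continuous_map_id, of Radon_measures ?F ?P] in simp)
  have B: "continuous_map X weak_star_topology f"
    if "continuous_map X ?P (?F \<circ> f)" "\<forall>t\<in>topspace X. f t \<in> Radon_measures"
    unfolding weak_star_topology_def
    by (rule continuous_map_pullback') (use that in auto)
  have C: "continuous_map X ?P (?F \<circ> f) \<longleftrightarrow>
      (\<forall>\<phi>\<in>Cc Rstar. continuous_map X euclideanreal (\<lambda>t. \<integral>x. \<phi> x \<partial>f t))"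
    by (auto simp: continuous_map_componentwise extensional_def o_def)
  show ?thesis using tf A B C by blast
qed


section \<open>Weak solutions of the coagulation equation\<close>

text \<open>
  \<open>\<gamma>\<close> and \<open>p\<close> are the exponents of the upper bound on the continuous symmetric kernel \<open>K\<close>.
  The measure \<open>f t\<close> is only relevant for \<open>t \<ge> 0\<close>. The moment bounds are integrals with values
  in the extended nonnegative reals. Conservation of mass includes the integrability of \<open>x\<close>
  with respect to \<open>f t\<close>. For a kernel with that upper bound, the integrals in the
  weak formulation converge absolutely: for \<open>t\<close> in the support of \<open>\<phi>\<close> and \<open>l1norm x \<le> l1norm y\<close>,
  \<open>K x y * \<bar>\<phi> (x + y, t) - \<phi> (x, t) - \<phi> (y, t)\<bar> \<le> C * l1norm x powr (1 - p) * l1norm y powr (\<gamma> + p)\<close>,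
  and the left-hand side vanishes for large \<open>x\<close> and for small \<open>y\<close>.
\<close>

definition weak_solution ::
  "(real ^ 'n \<Rightarrow> real ^ 'n \<Rightarrow> real) \<Rightarrow> real \<Rightarrow> real \<Rightarrow> (real ^ 'n) measure \<Rightarrow>
   (real \<Rightarrow> (real ^ 'n) measure) \<Rightarrow> bool" where
  "weak_solution K \<gamma> p f0 f \<longleftrightarrow>
     f0 \<in> Radon_measures \<and>
     (\<integral>\<^sup>+x. ennreal (l1norm x) \<partial>f0) < \<infinity> \<and>
     continuous_map (top_of_set {0..}) weak_star_topology f \<and>
     f 0 = f0 \<and>
     (\<forall>T>1. (SUP t\<in>{1/T..T}.
         (\<integral>\<^sup>+x\<in>{x. l1norm x \<ge> 1}. ennreal (l1norm x powr (\<gamma> + p)) \<partial>f t) +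
         (\<integral>\<^sup>+x\<in>{x. l1norm x \<le> 1}. ennreal (l1norm x powr (1 - p)) \<partial>f t)) < \<infinity>) \<and>
     (\<forall>t>0. has_bochner_integral (f t) (\<lambda>x. x) (\<integral>x. x \<partial>f0)) \<and>
     (\<forall>\<phi>\<in>Cc1 (Rstar \<times> {0<..}).
        0 = (LBINT t:{0<..}. (\<integral>x. deriv (\<lambda>s. \<phi> (x, s)) t \<partial>f t)) +
            1/2 * (LBINT t:{0<..}. (\<integral>x. (\<integral>y. K x y * (\<phi> (x + y, t) - \<phi> (x, t) - \<phi> (y, t)) \<partial>f t) \<partial>f t)))"

end

theory Submission
  imports Defs "HOL-Probability.Probability"
begin

text \<open>
  With \<open>|x|\<close> the \<open>l1norm\<close> of \<open>x\<close>, the function \<open>V(x) = (x \<bullet> x) / |x|\<close> is subadditive on the orthant: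
  \<open>V(x) + V(y) - V(x + y) = |x||y| / (|x| + |y|) * |x/|x| - y/|y||\<^sup>2\<close>. Hence \<open>\<integral> V f(dx,t)\<close> is
  nonincreasing in \<open>t\<close>, and since the first moment is conserved it differs only by a constant from
  \<open>E(t) = \<integral> |x| |x/|x| - \<theta>0|\<^sup>2 f(dx,t)\<close>. In the self-similar region
  \<open>\<epsilon> s(t) \<le> |x|, |y| \<le> s(t) / \<epsilon>\<close> with \<open>s(t) = t powr (1 / (1 - \<gamma>))\<close>, the lower bound on the kernel gives
  \<open>K(x,y) / (|x| + |y|) \<ge> c(\<epsilon>) / t\<close>, whereas the moment bounds show that little mass lies outside
  of it. So \<open>E\<close> decreases on \<open>[t, 2t]\<close> by at least a fixed multiple of \<open>E(2t)\<close> minus a small error,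
  and therefore \<open>E(t) \<longlongrightarrow> 0\<close>. Chebyshev's inequality concludes. To test with \<open>V\<close> one has to
  truncate at small and large sizes: replacing \<open>V\<close> by \<open>V - |x| \<le> 0\<close> preserves the sign at
  small sizes, and at large sizes the exponents \<open>\<gamma>, \<gamma> + p < 1\<close> make the error vanish.
\<close>

section \<open>Continuously differentiable cutoffs\<close>

text \<open>Where \<open>V\<close> comes from: it is the perspective of the squared Euclidean norm
  with respect to the size, hence convex and homogeneous of degree one, and such functions are
  subadditive. The size must be linear on the orthant, as \<open>l1norm\<close> is. Two obstacles
  shape the rest. The solution is only weak-* continuous in time, so nothing is differentiated at a
  point: every estimate is tested against plateaus in time, and the collision integral has to be
  shown measurable in time. Moreover the moment of order \<open>1 - p\<close> near the origin is
  bounded only on compact time intervals, with a bound that may grow with the interval. The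
  truncation is therefore removed on a fixed time interval, before time tends to infinity, and the
  error containing that bound disappears in this limit. What survives is a dissipation constant
  depending only on \<epsilon> and on the parameters of the kernel; the rate \<open>1 / t\<close> is
  exactly compensated by the length \<open>t\<close> of a doubling interval.\<close>

definition pos2 :: "real \<Rightarrow> real" where
  "pos2 u = (max 0 u)\<^sup>2"

lemma pos2_nonneg: "0 \<le> pos2 u"
  by (simp add: pos2_def)

lemma pos2_eq_0: "u \<le> 0 \<Longrightarrow> pos2 u = 0"
  by (simp add: pos2_def)

lemma pos2_mono: "u \<le> v \<Longrightarrow> pos2 u \<le> pos2 v"
  unfolding pos2_def by (intro power_mono) auto

lemma pos2_le_1: "u \<le> 1 \<Longrightarrow> pos2 u \<le> 1"
  using pos2_mono[of u 1] by (simp add: pos2_def)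

lemma pos2_lipschitz:
  assumes "u \<le> 1" "v \<le> 1"
  shows "\<bar>pos2 u - pos2 v\<bar> \<le> 2 * \<bar>u - v\<bar>"
proof -
  have "\<bar>pos2 u - pos2 v\<bar> = \<bar>max 0 u - max 0 v\<bar> * (max 0 u + max 0 v)"
  proof -
    have "pos2 u - pos2 v = (max 0 u - max 0 v) * (max 0 u + max 0 v)"
      by (simp add: pos2_def power2_eq_square algebra_simps)
    then show ?thesis by (simp add: abs_mult)
  qed
  also have "\<dots> \<le> \<bar>u - v\<bar> * 2"
    using assms by (intro mult_mono) auto
  finally show ?thesis by simp
qed

lemma pos2_deriv: "(pos2 has_real_derivative 2 * max 0 u) (at u)"
proof -
  consider "u < 0" | "u = 0" | "u > 0" by linarith
  then show ?thesis
  proof cases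
    case 1
    have "((\<lambda>_. 0) has_real_derivative 0) (at u)" by simp
    then have "(pos2 has_real_derivative 0) (at u)"
      by (rule has_field_derivative_transform_within_open[where S = "{..<0}"])
         (use 1 in \<open>auto simp: pos2_def\<close>)
    then show ?thesis using 1 by simp
  next
    case 2
    have "((\<lambda>h. max 0 h) \<longlongrightarrow> max 0 0) (at (0::real))"
      by (intro tendsto_intros)
    moreover have "(pos2 (0 + h) - pos2 0) / h = max 0 h" for h :: real
      by (auto simp: pos2_def max_def power2_eq_square)
    ultimately show ?thesis using 2 by (simp add: DERIV_def)
  next
    case 3
    have "((\<lambda>u. u\<^sup>2) has_real_derivative 2 * u) (at u)"
      by (auto intro!: derivative_eq_intros)
    then have "(pos2 has_real_derivative 2 * u) (at u)"
      by (rule has_field_derivative_transform_within_open[where S = "{0<..}"])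
         (use 3 in \<open>auto simp: pos2_def\<close>)
    then show ?thesis using 3 by simp
  qed
qed

lemma pos2_deriv_comp [derivative_intros]:
  "(g has_real_derivative g') (at x within S) \<Longrightarrow>
     ((\<lambda>x. pos2 (g x)) has_real_derivative 2 * max 0 (g x) * g') (at x within S)"
  by (rule DERIV_chain2[OF pos2_deriv])

lemma continuous_on_pos2 [continuous_intros]:
  "continuous_on S g \<Longrightarrow> continuous_on S (\<lambda>x. pos2 (g x))"
  unfolding pos2_def by (intro continuous_intros)

text \<open>The quadratic spline interpolating between 0 on \<open>u \<le> 0\<close> and 1 on \<open>u \<ge> 1\<close>.\<close>

definition ramp :: "real \<Rightarrow> real" where
  "ramp u = 2 * pos2 u - 4 * pos2 (u - 1/2) + 2 * pos2 (u - 1)"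

text \<open>The triangular bump on \<open>[0, 1]\<close> with peak 2 and unit area; its rescalings
  serve as an approximate identity.\<close>

definition ramp' :: "real \<Rightarrow> real" where
  "ramp' u = 4 * max 0 u - 8 * max 0 (u - 1/2) + 4 * max 0 (u - 1)"

lemma ramp_deriv: "(ramp has_real_derivative ramp' u) (at u)"
  unfolding ramp_def ramp'_def by (auto intro!: derivative_eq_intros)

lemma ramp_deriv_comp [derivative_intros]:
  "(g has_real_derivative g') (at x within S) \<Longrightarrow>
     ((\<lambda>x. ramp (g x)) has_real_derivative ramp' (g x) * g') (at x within S)"
  by (rule DERIV_chain2[OF ramp_deriv])

lemma continuous_on_ramp' [continuous_intros]:
  "continuous_on S g \<Longrightarrow> continuous_on S (\<lambda>x. ramp' (g x))"
  unfolding ramp'_def by (intro continuous_intros)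

lemma ramp'_nonneg: "0 \<le> ramp' u"
  by (auto simp: ramp'_def max_def)

lemma ramp'_eq_0: "u \<le> 0 \<or> 1 \<le> u \<Longrightarrow> ramp' u = 0"
  by (auto simp: ramp'_def max_def)

lemma ramp_eq_0: "u \<le> 0 \<Longrightarrow> ramp u = 0"
  by (auto simp: ramp_def pos2_def max_def)

lemma ramp_eq_1: "1 \<le> u \<Longrightarrow> ramp u = 1"
  by (auto simp: ramp_def pos2_def max_def power2_eq_square algebra_simps)

lemma ramp_mono: "u \<le> v \<Longrightarrow> ramp u \<le> ramp v"
  by (rule DERIV_nonneg_imp_nondecreasing[of u v ramp]) (auto intro: ramp_deriv ramp'_nonneg)

lemma ramp_range: "0 \<le> ramp u" "ramp u \<le> 1"
  using ramp_mono[of "min u 0" u] ramp_mono[of u "max u 1"]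
  by (simp_all add: ramp_eq_0 ramp_eq_1)

section \<open>A distributional inequality in one variable\<close>

text \<open>It rises on \<open>[t1, t1 + e]\<close> and falls on \<open>[t2 - e, t2]\<close>. The
  shift by 1 puts the descent before \<open>t2\<close>, so that the support stays within
  \<open>[t1, t2]\<close>. The derivative is a unit bump at \<open>t1\<close> minus a unit bump at
  \<open>t2\<close>.\<close>

definition plateau :: "real \<Rightarrow> real \<Rightarrow> real \<Rightarrow> real \<Rightarrow> real" where
  "plateau t1 t2 e t = ramp ((t - t1) / e) - ramp ((t - t2) / e + 1)"

definition plateau' :: "real \<Rightarrow> real \<Rightarrow> real \<Rightarrow> real \<Rightarrow> real" where
  "plateau' t1 t2 e t = ramp' ((t - t1) / e) / e - ramp' ((t - t2) / e + 1) / e"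

lemma plateau_deriv:
  "e > 0 \<Longrightarrow> (plateau t1 t2 e has_real_derivative plateau' t1 t2 e t) (at t within S)"
  unfolding plateau_def plateau'_def
  by (auto intro!: derivative_eq_intros)

lemma continuous_on_plateau': "e > 0 \<Longrightarrow> continuous_on S (plateau' t1 t2 e)"
  unfolding plateau'_def by (intro continuous_intros) auto

lemma continuous_on_plateau: "e > 0 \<Longrightarrow> continuous_on S (plateau t1 t2 e)"
  using plateau_deriv by (meson DERIV_continuous continuous_on_eq_continuous_within)

lemma plateau_eq_0:
  assumes "e > 0" "t1 + e \<le> t2" "t \<notin> {t1..t2}"
  shows "plateau t1 t2 e t = 0" "plateau' t1 t2 e t = 0"
proof -
  consider "t < t1" | "t > t2" using assms by force
  then have "plateau t1 t2 e t = 0 \<and> plateau' t1 t2 e t = 0"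
  proof cases
    case 1
    then have "(t - t1) / e \<le> 0" "(t - t2) / e + 1 \<le> 0"
      using assms by (auto simp: field_simps)
    then show ?thesis by (auto simp: plateau_def plateau'_def ramp_eq_0 ramp'_eq_0)
  next
    case 2
    then have "(t - t1) / e \<ge> 1" "(t - t2) / e + 1 \<ge> 1"
      using assms by (auto simp: field_simps)
    then show ?thesis by (auto simp: plateau_def plateau'_def ramp_eq_1 ramp'_eq_0)
  qed
  then show "plateau t1 t2 e t = 0" "plateau' t1 t2 e t = 0" by auto
qed

lemma plateau_range:
  assumes "e > 0" "t1 + e \<le> t2"
  shows "0 \<le> plateau t1 t2 e t" "plateau t1 t2 e t \<le> 1"
proof -
  have "(t - t2) / e + 1 \<le> (t - t1) / e"
    using assms by (simp add: diff_divide_distrib pos_le_divide_eq flip: le_diff_eq) (simp add: field_simps)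
  then show "0 \<le> plateau t1 t2 e t"
    unfolding plateau_def using ramp_mono by force
  show "plateau t1 t2 e t \<le> 1"
    unfolding plateau_def using ramp_range[of "(t - t1) / e"] ramp_range[of "(t - t2) / e + 1"]
    by linarith
qed

lemma ramp'_integral:
  assumes "e > 0"
  shows "((\<lambda>t. ramp' ((t - b) / e) / e) has_integral 1) {b..b + e}"
proof -
  have "((\<lambda>t. ramp' ((t - b) / e) / e) has_integral
      (ramp ((b + e - b) / e) - ramp ((b - b) / e))) {b..b + e}"
    using assms
    by (intro fundamental_theorem_of_calculus)
       (auto intro!: derivative_eq_intros
             simp flip: has_real_derivative_iff_has_vector_derivative)
  then show ?thesis using assms by (simp add: ramp_eq_0 ramp_eq_1)
qed

text \<open>The weight is nonnegative with integral 1, so the integral is a mean value of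
  \<open>G\<close>.\<close>

lemma ramp'_weighted_integral_bounds:
  fixes G :: "real \<Rightarrow> real"
  assumes "e > 0" and cont: "continuous_on {b..b + e} G"
    and bounds: "\<And>t. t \<in> {b..b + e} \<Longrightarrow> l \<le> G t \<and> G t \<le> u"
  shows "l \<le> integral {b..b + e} (\<lambda>t. ramp' ((t - b) / e) / e * G t)"
    and "integral {b..b + e} (\<lambda>t. ramp' ((t - b) / e) / e * G t) \<le> u"
proof -
  let ?w = "\<lambda>t. ramp' ((t - b) / e) / e"
  have int: "(\<lambda>t. ?w t * G t) integrable_on {b..b + e}"
    using assms by (intro integrable_continuous_real continuous_intros) auto
  have I: "((\<lambda>t. ?w t * c) has_integral c) {b..b + e}" for c
    using has_integral_mult_left[OF ramp'_integral[OF assms(1), of b], of c] by simp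
  have w: "0 \<le> ?w t" for t
    using ramp'_nonneg assms by simp
  show "l \<le> integral {b..b + e} (\<lambda>t. ?w t * G t)"
    by (rule has_integral_le[OF I integrable_integral[OF int]])
       (use bounds w in \<open>blast intro: mult_left_mono\<close>)
  show "integral {b..b + e} (\<lambda>t. ?w t * G t) \<le> u"
    by (rule has_integral_le[OF integrable_integral[OF int] I])
       (use bounds w in \<open>blast intro: mult_left_mono\<close>)
qed

text \<open>As \<open>e\<close> tends to 0, the derivative of the plateau tends to the point mass at
  \<open>t1\<close> minus the one at \<open>t2\<close>. Continuity of \<open>F\<close> thus turns
  the tested inequality into one between the end values.\<close>

lemma distributional_derivative_bound:
  fixes F :: "real \<Rightarrow> real"
  assumes "t1 < t2" and cont: "continuous_on {t1..t2} F"
    and test: "\<And>e. e > 0 \<Longrightarrow> t1 + e \<le> t2 \<Longrightarrow>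
      0 \<le> integral {t1..t2} (\<lambda>t. plateau' t1 t2 e t * F t) + B * integral {t1..t2} (plateau t1 t2 e)"
  shows "F t2 - F t1 \<le> B * (t2 - t1)"
proof (rule field_le_epsilon)
  fix \<epsilon> :: real assume "\<epsilon> > 0"
  \<comment> \<open>Subtracting the linear part reduces to \<open>B = 0\<close>: integration by
    parts turns the \<open>B\<close> term of the hypothesis into \<open>plateau'\<close> tested
    against \<open>- B * t\<close>.\<close>
  define G where "G = (\<lambda>t. F t - B * t)"
  have contG: "continuous_on {t1..t2} G"
    unfolding G_def by (intro continuous_intros cont)
  have un: "uniformly_continuous_on {t1..t2} G"
    using contG compact_Icc compact_uniformly_continuous by blast
  obtain d where d: "d > 0" "\<And>s t. s \<in> {t1..t2} \<Longrightarrow> t \<in> {t1..t2} \<Longrightarrow> dist s t < d \<Longrightarrow> dist (G s) (G t) < \<epsilon> / 2"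
    using un \<open>\<epsilon> > 0\<close> unfolding uniformly_continuous_on_def by (metis half_gt_zero)
  \<comment> \<open>\<open>d / 2\<close> keeps both bumps within the modulus of continuity of
    \<open>G\<close>; \<open>t2 - t1\<close> keeps the plateau admissible.\<close>
  define e where "e = min (d / 2) (t2 - t1)"
  have e: "e > 0" "t1 + e \<le> t2" "e < d"
    using d \<open>t1 < t2\<close> by (auto simp: e_def)
  let ?w1 = "\<lambda>t. ramp' ((t - t1) / e) / e" and ?w2 = "\<lambda>t. ramp' ((t - (t2 - e)) / e) / e"
  have p'_eq: "plateau' t1 t2 e = (\<lambda>t. ?w1 t - ?w2 t)"
    using e by (auto simp: plateau'_def fun_eq_iff field_simps)
  have ibp: "((\<lambda>t. plateau' t1 t2 e t * t + plateau t1 t2 e t) has_integral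
      (plateau t1 t2 e t2 * t2 - plateau t1 t2 e t1 * t1)) {t1..t2}"
    using e by (intro fundamental_theorem_of_calculus)
       (auto intro!: derivative_eq_intros plateau_deriv
             simp flip: has_real_derivative_iff_has_vector_derivative)
  have ends: "plateau t1 t2 e t2 = 0" "plateau t1 t2 e t1 = 0"
    using e by (auto simp: plateau_def ramp_eq_0 ramp_eq_1 field_simps)
  have ibp': "integral {t1..t2} (\<lambda>t. plateau' t1 t2 e t * t) = - integral {t1..t2} (plateau t1 t2 e)"
    using integral_unique[OF ibp] e
    by (subst (asm) integral_add)
       (auto simp: ends intro!: integrable_continuous_real continuous_intros
          continuous_on_plateau continuous_on_plateau')
  have "integral {t1..t2} (\<lambda>t. plateau' t1 t2 e t * G t)
      = integral {t1..t2} (\<lambda>t. plateau' t1 t2 e t * F t)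
        - B * integral {t1..t2} (\<lambda>t. plateau' t1 t2 e t * t)"
  proof -
    have "integral {t1..t2} (\<lambda>t. plateau' t1 t2 e t * G t)
        = integral {t1..t2} (\<lambda>t. plateau' t1 t2 e t * F t - B * (plateau' t1 t2 e t * t))"
      by (simp add: G_def algebra_simps)
    also have "\<dots> = integral {t1..t2} (\<lambda>t. plateau' t1 t2 e t * F t)
        - integral {t1..t2} (\<lambda>t. B * (plateau' t1 t2 e t * t))"
      using e cont by (intro integral_diff integrable_continuous_real continuous_intros
          continuous_on_plateau') auto
    finally show ?thesis by simp
  qed
  then have G_nonneg: "0 \<le> integral {t1..t2} (\<lambda>t. plateau' t1 t2 e t * G t)"
    using test[OF e(1,2)] ibp' by simp
  have int1: "(\<lambda>t. ?w1 t * G t) integrable_on {t1..t2}" "(\<lambda>t. ?w2 t * G t) integrable_on {t1..t2}"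
    using e contG by (auto intro!: integrable_continuous_real continuous_intros)
  have A: "integral {t1..t2} (\<lambda>t. ?w1 t * G t) = integral {t1..t1 + e} (\<lambda>t. ?w1 t * G t)"
    using e by (intro integral_spike_set)
      (auto intro!: empty_imp_negligible simp: ramp'_eq_0 field_simps)
  have A2: "integral {t1..t2} (\<lambda>t. ?w2 t * G t) = integral {t2 - e..t2 - e + e} (\<lambda>t. ?w2 t * G t)"
    using e by (intro integral_spike_set)
      (auto intro!: empty_imp_negligible simp: ramp'_eq_0 field_simps)
  have near1: "G t1 - \<epsilon>/2 \<le> G t \<and> G t \<le> G t1 + \<epsilon>/2" if "t \<in> {t1..t1 + e}" for t
  proof -
    have "\<bar>G t - G t1\<bar> < \<epsilon> / 2"
      using d(2)[of t t1] that e \<open>t1 < t2\<close> by (simp add: dist_real_def)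
    then show ?thesis by linarith
  qed
  have near2: "G t2 - \<epsilon>/2 \<le> G t \<and> G t \<le> G t2 + \<epsilon>/2" if "t \<in> {t2 - e..t2 - e + e}" for t
  proof -
    have "\<bar>G t - G t2\<bar> < \<epsilon> / 2"
      using d(2)[of t t2] that e \<open>t1 < t2\<close> by (simp add: dist_real_def)
    then show ?thesis by linarith
  qed
  have B1: "integral {t1..t1 + e} (\<lambda>t. ?w1 t * G t) \<le> G t1 + \<epsilon>/2"
    using e by (intro ramp'_weighted_integral_bounds(2)[OF e(1) _ near1]
        continuous_on_subset[OF contG]) auto
  have B2: "G t2 - \<epsilon>/2 \<le> integral {t2 - e..t2 - e + e} (\<lambda>t. ?w2 t * G t)"
    using e by (intro ramp'_weighted_integral_bounds(1)[OF e(1) _ near2]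
        continuous_on_subset[OF contG]) auto
  have "integral {t1..t2} (\<lambda>t. plateau' t1 t2 e t * G t)
      = integral {t1..t2} (\<lambda>t. ?w1 t * G t) - integral {t1..t2} (\<lambda>t. ?w2 t * G t)"
    unfolding p'_eq left_diff_distrib by (rule integral_diff[OF int1])
  then have "G t2 - G t1 \<le> \<epsilon>"
    using G_nonneg A A2 B1 B2 by linarith
  then show "F t2 - F t1 \<le> B * (t2 - t1) + \<epsilon>"
    by (simp add: G_def algebra_simps)
qed

section \<open>The orthant\<close>

lemma Rstar_D: "x \<in> Rstar \<Longrightarrow> 0 \<le> x $ i"
  by (simp add: Rstar_def)

lemma l1norm_nonneg: "0 \<le> l1norm x"
  by (simp add: l1norm_def sum_nonneg)

lemma l1norm_Rstar: "x \<in> Rstar \<Longrightarrow> l1norm x = (\<Sum>i\<in>UNIV. x $ i)"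
  unfolding l1norm_def by (intro sum.cong) (auto simp: Rstar_D)

lemma l1norm_pos: "x \<in> Rstar \<Longrightarrow> 0 < l1norm x"
proof -
  assume x: "x \<in> Rstar"
  then obtain i where "x $ i \<noteq> 0" by (auto simp: Rstar_def vec_eq_iff)
  then have "0 < \<bar>x $ i\<bar>" by simp
  also have "\<dots> \<le> l1norm x" unfolding l1norm_def by (rule member_le_sum) auto
  finally show ?thesis .
qed

lemma Rstar_add: "x \<in> Rstar \<Longrightarrow> y \<in> Rstar \<Longrightarrow> x + y \<in> Rstar"
proof -
  assume x: "x \<in> Rstar" and y: "y \<in> Rstar"
  then obtain i where "x $ i \<noteq> 0" by (auto simp: Rstar_def vec_eq_iff)
  then have "0 < (x + y) $ i" using Rstar_D[OF x, of i] Rstar_D[OF y, of i] by simp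
  then have "x + y \<noteq> 0" by (metis less_irrefl zero_index)
  with x y show ?thesis by (auto simp: Rstar_def)
qed

lemma l1norm_add: "x \<in> Rstar \<Longrightarrow> y \<in> Rstar \<Longrightarrow> l1norm (x + y) = l1norm x + l1norm y"
  by (simp add: l1norm_Rstar Rstar_add sum.distrib)

lemma norm_le_l1norm: "norm x \<le> l1norm x"
  using norm_le_l1_cart[of x] by (simp add: l1norm_def)

lemma continuous_on_l1norm [continuous_intros]:
  "continuous_on S g \<Longrightarrow> continuous_on S (\<lambda>x. l1norm (g x))"
  unfolding l1norm_def by (intro continuous_intros)

text \<open>Cauchy-Schwarz against the constant vector. It converts the Euclidean deviation of
  directions, which the Lyapunov functional controls, into the \<open>l1norm\<close> deviation of
  the theorem.\<close>

lemma l1norm_square_le: "(l1norm x)\<^sup>2 \<le> real CARD('n) * (x \<bullet> x)" for x :: "real ^ 'n"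
proof -
  have "(\<Sum>i\<in>UNIV. \<bar>x $ i\<bar> * 1)\<^sup>2 \<le> (\<Sum>i\<in>UNIV. \<bar>x $ i\<bar>\<^sup>2) * (\<Sum>i\<in>(UNIV::'n set). 1\<^sup>2)"
    by (rule Cauchy_Schwarz_ineq_sum)
  then show ?thesis by (simp add: l1norm_def inner_vec_def power2_eq_square mult.commute)
qed

text \<open>For \<open>0 < r\<close> the lower size bound already excludes the origin, so only
  closed conditions remain.\<close>

lemma compact_annulus:
  assumes "0 < r"
  shows "compact {x \<in> Rstar. r \<le> l1norm x \<and> l1norm x \<le> (R::real)}"
proof -
  have eq: "{x \<in> Rstar. r \<le> l1norm x \<and> l1norm x \<le> R}
      = (\<Inter>i. {x. 0 \<le> x $ i}) \<inter> {x. r \<le> l1norm x} \<inter> {x. l1norm x \<le> R}"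
    using assms by (auto simp: Rstar_def l1norm_def)
  have "closed ((\<Inter>i. {x. 0 \<le> x $ i}) \<inter> {x. r \<le> l1norm x} \<inter> {x::real^'a. l1norm x \<le> R})"
    by (intro closed_Int closed_INT ballI closed_Collect_le continuous_intros)
  moreover have "bounded {x \<in> Rstar. r \<le> l1norm x \<and> l1norm x \<le> R}"
    unfolding bounded_iff using norm_le_l1norm order_trans by blast
  ultimately show ?thesis
    unfolding compact_eq_bounded_closed eq by blast
qed

lemma borel_Rstar [measurable]: "Rstar \<in> sets borel"
proof -
  have "closed (\<Inter>i. {x::real^'a. 0 \<le> x $ i})"
    by (intro closed_INT ballI closed_Collect_le continuous_intros)
  then have "(\<Inter>i. {x::real^'a. 0 \<le> x $ i}) - {0} \<in> sets borel"
    by auto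
  moreover have "(\<Inter>i. {x::real^'a. 0 \<le> x $ i}) - {0} = Rstar" by (auto simp: Rstar_def)
  ultimately show ?thesis by metis
qed

section \<open>A subadditive Lyapunov function\<close>

definition conc :: "real ^ 'n \<Rightarrow> real" where
  "conc x = (x \<bullet> x) / l1norm x"

text \<open>The squared Euclidean distance of the two directions, expanded so that it can be
  integrated term by term in \<open>x\<close> and \<open>y\<close>.\<close>

definition ang2 :: "real ^ 'n \<Rightarrow> real ^ 'n \<Rightarrow> real" where
  "ang2 x y = (x \<bullet> x) / (l1norm x)\<^sup>2 - 2 * (x \<bullet> y) / (l1norm x * l1norm y) + (y \<bullet> y) / (l1norm y)\<^sup>2"

lemma ang2_eq: "ang2 x y = (norm ((1 / l1norm x) *\<^sub>R x - (1 / l1norm y) *\<^sub>R y))\<^sup>2"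
  unfolding ang2_def power2_norm_eq_inner
  by (simp add: inner_diff_left inner_diff_right inner_commute power2_eq_square)

lemma ang2_nonneg: "0 \<le> ang2 x y"
  by (simp add: ang2_eq)

lemma inner_self_le_l1norm: "x \<bullet> x \<le> (l1norm x)\<^sup>2"
  using norm_le_l1norm[of x] by (simp add: dot_square_norm power_mono)

lemma inner_Rstar_nonneg: "x \<in> Rstar \<Longrightarrow> y \<in> Rstar \<Longrightarrow> 0 \<le> x \<bullet> y"
  by (simp add: inner_vec_def sum_nonneg Rstar_D)

text \<open>In the orthant the mixed term has the favourable sign, and directions of unit
  \<open>l1norm\<close> have Euclidean norm at most 1. The constant reappears as the penalty for
  leaving the bulk.\<close>

lemma ang2_le_2: "x \<in> Rstar \<Longrightarrow> y \<in> Rstar \<Longrightarrow> ang2 x y \<le> 2"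
proof -
  assume x: "x \<in> Rstar" and y: "y \<in> Rstar"
  have "(x \<bullet> x) / (l1norm x)\<^sup>2 \<le> 1" "(y \<bullet> y) / (l1norm y)\<^sup>2 \<le> 1"
    using inner_self_le_l1norm[of x] inner_self_le_l1norm[of y] l1norm_pos[OF x] l1norm_pos[OF y] by auto
  moreover have "0 \<le> 2 * (x \<bullet> y) / (l1norm x * l1norm y)"
    using inner_Rstar_nonneg[OF x y] by (simp add: l1norm_nonneg)
  ultimately show ?thesis unfolding ang2_def by linarith
qed

lemma conc_nonneg: "0 \<le> conc x"
  by (simp add: conc_def l1norm_nonneg)

lemma conc_le_l1norm: "x \<in> Rstar \<Longrightarrow> conc x \<le> l1norm x"
  using inner_self_le_l1norm[of x] l1norm_pos[of x]
  by (simp add: conc_def pos_divide_le_eq power2_eq_square)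

lemma conc_add:
  assumes "x \<in> Rstar" "y \<in> Rstar"
  shows "conc x + conc y - conc (x + y) = l1norm x * l1norm y / (l1norm x + l1norm y) * ang2 x y"
proof -
  have "A / s + B / u - (A + 2 * C + B) / (s + u)
      = s * u / (s + u) * (A / s\<^sup>2 - 2 * C / (s * u) + B / u\<^sup>2)"
    if "s > 0" "u > 0" for A B C s u :: real
  proof -
    have "s + u \<noteq> 0" using that by simp
    with that show ?thesis
      by (simp add: divide_simps) (simp add: algebra_simps power2_eq_square)
  qed
  from this[OF assms[THEN l1norm_pos], of "x \<bullet> x" "y \<bullet> y" "x \<bullet> y"]
  show ?thesis
    using assms by (simp add: conc_def ang2_def l1norm_add inner_add_left inner_add_right
        inner_commute algebra_simps)
qed

text \<open>The factor \<open>s * u / (s + u)\<close> is at most the smaller size. A full power of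
  the smaller size is what compensates the kernel, which behaves like the power \<open>- p\<close>
  of it.\<close>

lemma conc_add_bounds:
  assumes "x \<in> Rstar" "y \<in> Rstar"
  shows "0 \<le> conc x + conc y - conc (x + y)"
    and "conc x + conc y - conc (x + y) \<le> 2 * min (l1norm x) (l1norm y)"
proof -
  let ?s = "l1norm x" and ?u = "l1norm y"
  have pos: "?s > 0" "?u > 0" using assms by (auto intro: l1norm_pos)
  show "0 \<le> conc x + conc y - conc (x + y)"
    using pos ang2_nonneg[of x y] by (simp add: conc_add[OF assms])
  have "?s * ?u / (?s + ?u) \<le> min ?s ?u"
    using pos by (auto simp: min_def field_simps)
  then have "?s * ?u / (?s + ?u) * ang2 x y \<le> min ?s ?u * 2"
    using pos ang2_nonneg[of x y] ang2_le_2[OF assms] by (intro mult_mono) auto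
  then show "conc x + conc y - conc (x + y) \<le> 2 * min ?s ?u"
    by (simp add: conc_add[OF assms])
qed

section \<open>Truncation at small and large sizes\<close>

definition cutlow :: "real \<Rightarrow> real \<Rightarrow> real" where
  "cutlow r s = pos2 (1 - r / s)"

definition cuthigh :: "real \<Rightarrow> real \<Rightarrow> real" where
  "cuthigh R s = pos2 (1 - s / R)"

definition cutoff :: "real \<Rightarrow> real \<Rightarrow> real \<Rightarrow> real" where
  "cutoff r R s = cutlow r s * cuthigh R s"

lemma cutlow_range:
  assumes "0 < r" "0 < s"
  shows "0 \<le> cutlow r s" "cutlow r s \<le> 1"
  using assms by (auto simp: cutlow_def pos2_nonneg intro: pos2_le_1)

lemma cuthigh_range:
  assumes "0 < R" "0 < s"
  shows "0 \<le> cuthigh R s" "cuthigh R s \<le> 1"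
  using assms by (auto simp: cuthigh_def pos2_nonneg intro: pos2_le_1)

lemma cutoff_range:
  assumes "0 < r" "0 < R" "0 < s"
  shows "0 \<le> cutoff r R s" "cutoff r R s \<le> 1"
  unfolding cutoff_def using cutlow_range[of r s] cuthigh_range[of R s] assms
  by (auto intro: mult_le_one)

lemma cutlow_eq_0: "0 < s \<Longrightarrow> s \<le> r \<Longrightarrow> cutlow r s = 0"
  unfolding cutlow_def by (rule pos2_eq_0) auto

lemma cuthigh_eq_0: "0 < R \<Longrightarrow> R \<le> s \<Longrightarrow> cuthigh R s = 0"
  unfolding cuthigh_def by (rule pos2_eq_0) auto

lemma cutlow_mono: "0 < r \<Longrightarrow> 0 < s \<Longrightarrow> s \<le> s' \<Longrightarrow> cutlow r s \<le> cutlow r s'"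
  unfolding cutlow_def by (intro pos2_mono) (auto intro: divide_left_mono)

lemma cuthigh_antimono: "0 < R \<Longrightarrow> s \<le> s' \<Longrightarrow> cuthigh R s' \<le> cuthigh R s"
  unfolding cuthigh_def by (intro pos2_mono) (auto intro: divide_right_mono)

lemma cuthigh_lipschitz:
  assumes "0 < R" "0 < s" "0 < u"
  shows "\<bar>cuthigh R s - cuthigh R (s + u)\<bar> \<le> 2 * u / R"
proof -
  have "\<bar>cuthigh R s - cuthigh R (s + u)\<bar> \<le> 2 * \<bar>(1 - s / R) - (1 - (s + u) / R)\<bar>"
    unfolding cuthigh_def using assms by (intro pos2_lipschitz) auto
  also have "(1 - s / R) - (1 - (s + u) / R) = u / R"
    by (simp add: add_divide_distrib)
  finally show ?thesis using assms by simp
qed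

lemma cutlow_lipschitz:
  assumes "0 < r" "0 < s" "0 < u"
  shows "\<bar>cutlow r s - cutlow r (s + u)\<bar> \<le> 2 * u / r"
proof -
  \<comment> \<open>\<open>r / v\<close> is steep near 0, but the cutoff vanishes for
    \<open>v \<le> r\<close>. Replacing \<open>v\<close> by \<open>max r v\<close> leaves only the
    range where the slope is at most \<open>1 / r\<close>.\<close>
  have eq: "cutlow r v = pos2 (1 - r / max r v)" if "0 < v" for v
    using that assms by (auto simp: cutlow_eq_0 max_def) (auto simp: cutlow_def pos2_def)
  have "\<bar>cutlow r s - cutlow r (s + u)\<bar> \<le> 2 * \<bar>(1 - r / max r s) - (1 - r / max r (s + u))\<bar>"
    using assms by (simp only: eq add_pos_pos) (intro pos2_lipschitz, auto)
  also have "(1 - r / max r s) - (1 - r / max r (s + u))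
      = (r / (max r s * max r (s + u))) * (max r s - max r (s + u))"
    using assms by (simp add: field_simps max_def)
  also have "\<bar>\<dots>\<bar> \<le> (1 / r) * u"
    unfolding abs_mult
  proof (rule mult_mono)
    have "r * r \<le> max r s * max r (s + u)"
      using assms by (intro mult_mono) auto
    then show "\<bar>r / (max r s * max r (s + u))\<bar> \<le> 1 / r"
      using assms by (auto simp: field_simps)
  qed (use assms in auto)
  finally show ?thesis using assms by simp
qed

lemma cutoff_lipschitz:
  assumes "0 < r" "0 < R" "0 < s" "0 < u"
  shows "\<bar>cutoff r R s - cutoff r R (s + u)\<bar> \<le> (2 / r + 2 / R) * u"
proof -
  have "cutoff r R s - cutoff r R (s + u) = cutlow r s * (cuthigh R s - cuthigh R (s + u))
      + cuthigh R (s + u) * (cutlow r s - cutlow r (s + u))"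
    by (simp add: cutoff_def algebra_simps)
  also have "\<bar>\<dots>\<bar> \<le> \<bar>cutlow r s\<bar> * \<bar>cuthigh R s - cuthigh R (s + u)\<bar>
      + \<bar>cuthigh R (s + u)\<bar> * \<bar>cutlow r s - cutlow r (s + u)\<bar>"
    by (metis abs_mult abs_triangle_ineq)
  also have "\<dots> \<le> 1 * (2 * u / R) + 1 * (2 * u / r)"
    using assms cutlow_range[of r s] cuthigh_range[of R "s + u"]
    by (intro add_mono mult_mono cuthigh_lipschitz cutlow_lipschitz) auto
  finally show ?thesis using assms by (simp add: field_simps)
qed

text \<open>If the own size is the smaller one, the trivial bound suffices; otherwise the Lipschitz
  bound is used up to size \<open>R\<close>, beyond which both values vanish. The estimate serves
  integrability only, so the growth with \<open>R / r\<close> is harmless.\<close>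

lemma cutoff_increment_abs:
  assumes "0 < r" "0 < R" "0 < s" "0 < u"
  shows "s * \<bar>cutoff r R s - cutoff r R (s + u)\<bar> \<le> (3 + 2 * R / r) * min s u"
proof (cases "s \<le> u")
  case True
  have "s * \<bar>cutoff r R s - cutoff r R (s + u)\<bar> \<le> s * 1"
    using assms cutoff_range[of r R s] cutoff_range[of r R "s + u"] by (intro mult_left_mono) auto
  also have "\<dots> \<le> (3 + 2 * R / r) * s"
    using assms by (simp add: field_simps)
  finally show ?thesis using True by (simp add: min_def)
next
  case False
  show ?thesis
  proof (cases "s \<le> R")
    case True
    have "s * \<bar>cutoff r R s - cutoff r R (s + u)\<bar> \<le> R * ((2 / r + 2 / R) * u)"
      using assms True by (intro mult_mono cutoff_lipschitz) auto
    also have "\<dots> \<le> (3 + 2 * R / r) * u"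
      using assms by (simp add: field_simps)
    finally show ?thesis using False by (simp add: min_def)
  next
    case False
    then have "cutoff r R s = 0" "cutoff r R (s + u) = 0"
      using assms by (auto simp: cutoff_def cuthigh_eq_0)
    then show ?thesis using assms by simp
  qed
qed

text \<open>The power \<sigma> interpolates between the trivial bound and the Lipschitz bound. It
  yields a small factor \<open>R powr - \<sigma>\<close> at the price of \<sigma> additional powers
  of the larger size, few enough for the first moment to absorb them.\<close>

lemma cuthigh_loss:
  assumes "0 < R" "0 < s" "0 < u" "0 < \<sigma>" "\<sigma> \<le> 1"
  shows "s * (cuthigh R s - cuthigh R (s + u)) \<le> 2 * min s u * (max s u / R) powr \<sigma>"
proof -
  have le_powr: "min 1 q \<le> q powr \<sigma>" if "0 < q" for q :: real
  proof (cases "q \<le> 1")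
    case True
    then show ?thesis using that assms powr_mono'[of \<sigma> 1 q] by simp
  next
    case False
    then show ?thesis using assms by (simp add: ge_one_powr_ge_zero)
  qed
  have loss: "cuthigh R s - cuthigh R (s + u) \<le> 2 * min 1 (u / R)"
    using cuthigh_lipschitz[of R s u] cuthigh_range[of R s] cuthigh_range[of R "s + u"] assms
    by (simp add: min_def) linarith
  show ?thesis
  proof (cases "s \<le> u")
    case True
    have "s * (cuthigh R s - cuthigh R (s + u)) \<le> s * (2 * (u / R) powr \<sigma>)"
      using loss le_powr[of "u / R"] assms by (intro mult_left_mono) auto
    then show ?thesis using True by (simp add: min_def max_def)
  next
    case False
    show ?thesis
    proof (cases "s \<le> R")
      case True
      \<comment> \<open>Here the factors trade places: \<open>s * (u / R)\<close> is the smaller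
        size \<open>u\<close> times \<open>s / R\<close>, and \<open>s / R\<close> is at most
        1.\<close>
      have "s * (cuthigh R s - cuthigh R (s + u)) \<le> s * (2 * (u / R))"
        using loss assms by (intro mult_left_mono) auto
      also have "\<dots> = 2 * u * min 1 (s / R)" using True assms by (simp add: min_def field_simps)
      also have "\<dots> \<le> 2 * u * (s / R) powr \<sigma>"
        using assms le_powr[of "s / R"] by (intro mult_left_mono) auto
      finally show ?thesis using False by (simp add: min_def max_def)
    next
      case False
      then show ?thesis using assms by (simp add: cuthigh_eq_0)
    qed
  qed
qed

text \<open>
  Subtracting \<open>l1norm\<close>, whose integral is conserved, makes the factor in front of the
  increasing lower cutoff nonpositive, so that the lower cutoff does not destroy subadditivity.
\<close>

definition testfn :: "real \<Rightarrow> real \<Rightarrow> real ^ 'n \<Rightarrow> real" where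
  "testfn r R x = (conc x - l1norm x) * cutoff r R (l1norm x)"

lemma testfn_abs_le:
  assumes "0 < r" "0 < R" "x \<in> Rstar"
  shows "\<bar>testfn r R x\<bar> \<le> l1norm x"
proof -
  have "\<bar>testfn r R x\<bar> = \<bar>conc x - l1norm x\<bar> * cutoff r R (l1norm x)"
    using cutoff_range[of r R "l1norm x"] assms by (simp add: testfn_def abs_mult l1norm_pos)
  also have "\<dots> \<le> l1norm x * 1"
    using cutoff_range[of r R "l1norm x"] assms conc_nonneg[of x] conc_le_l1norm[of x] l1norm_pos[of x]
    by (intro mult_mono) auto
  finally show ?thesis by simp
qed

lemma testfn_eq_0: "0 < R \<Longrightarrow> x \<in> Rstar \<Longrightarrow> l1norm x \<le> r \<or> R \<le> l1norm x \<Longrightarrow> testfn r R x = 0"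
  by (auto simp: testfn_def cutoff_def l1norm_pos cutlow_eq_0 cuthigh_eq_0)

text \<open>Factoring out the cutoff at the merged size isolates the dissipation, because the linear
  part cancels. The cutoff differences come with the nonnegative weights
  \<open>l1norm - conc\<close>.\<close>

lemma testfn_increment_eq:
  assumes "x \<in> Rstar" "y \<in> Rstar"
  defines "s \<equiv> l1norm x" and "u \<equiv> l1norm y"
  shows "testfn r R (x + y) - testfn r R x - testfn r R y
    = - (cutoff r R (s + u) * (conc x + conc y - conc (x + y)))
      + (l1norm x - conc x) * (cutoff r R s - cutoff r R (s + u))
      + (l1norm y - conc y) * (cutoff r R u - cutoff r R (s + u))"
  using assms by (simp add: testfn_def l1norm_add algebra_simps)

lemma testfn_increment_abs:
  assumes "0 < r" "0 < R" "x \<in> Rstar" "y \<in> Rstar"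
  shows "\<bar>testfn r R (x + y) - testfn r R x - testfn r R y\<bar>
    \<le> (8 + 4 * R / r) * min (l1norm x) (l1norm y)"
proof -
  let ?s = "l1norm x" and ?u = "l1norm y" and ?d = "conc x + conc y - conc (x + y)"
  have pos: "?s > 0" "?u > 0" using assms by (auto intro: l1norm_pos)
  have "\<bar>cutoff r R (?s + ?u) * ?d\<bar> \<le> 1 * (2 * min ?s ?u)"
    unfolding abs_mult using conc_add_bounds[OF assms(3,4)] cutoff_range[of r R "?s + ?u"] assms(1,2) pos
    by (intro mult_mono) auto
  moreover have "\<bar>(?s - conc x) * (cutoff r R ?s - cutoff r R (?s + ?u))\<bar> \<le> (3 + 2 * R / r) * min ?s ?u"
  proof -
    have "\<bar>(?s - conc x) * (cutoff r R ?s - cutoff r R (?s + ?u))\<bar> \<le> ?s * \<bar>cutoff r R ?s - cutoff r R (?s + ?u)\<bar>"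
      unfolding abs_mult using conc_nonneg[of x] conc_le_l1norm[of x] assms
      by (intro mult_right_mono) auto
    then show ?thesis using cutoff_increment_abs[of r R ?s ?u] assms pos by linarith
  qed
  moreover have "\<bar>(?u - conc y) * (cutoff r R ?u - cutoff r R (?s + ?u))\<bar> \<le> (3 + 2 * R / r) * min ?s ?u"
  proof -
    have "\<bar>(?u - conc y) * (cutoff r R ?u - cutoff r R (?s + ?u))\<bar> \<le> ?u * \<bar>cutoff r R ?u - cutoff r R (?u + ?s)\<bar>"
      unfolding abs_mult using conc_nonneg[of y] conc_le_l1norm[of y] assms
      by (simp only: add.commute) (intro mult_right_mono, auto)
    then show ?thesis using cutoff_increment_abs[of r R ?u ?s] assms pos by (simp add: min.commute)
  qed
  moreover have "(8 + 4 * R / r) * min ?s ?u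
      = 2 * min ?s ?u + (3 + 2 * R / r) * min ?s ?u + (3 + 2 * R / r) * min ?s ?u"
    by (simp add: algebra_simps)
  ultimately show ?thesis
    unfolding testfn_increment_eq[OF assms(3,4)] by linarith
qed

text \<open>In contrast to the absolute bound there is no factor \<open>R / r\<close>: growth of the
  lower cutoff has the good sign and only the upper cutoff loses. The restriction
  \<open>r \<le> max s u\<close> later allows a negative power of the larger size to be bounded by
  the same power of \<open>r\<close>.\<close>

lemma testfn_increment_le:
  assumes "0 < r" "0 < R" "x \<in> Rstar" "y \<in> Rstar" "0 < \<sigma>" "\<sigma> \<le> 1"
  defines "s \<equiv> l1norm x" and "u \<equiv> l1norm y"
  shows "testfn r R (x + y) - testfn r R x - testfn r R y
    \<le> - (cutoff r R (s + u) * (conc x + conc y - conc (x + y)))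
      + (if r \<le> max s u then 4 * min s u * (max s u / R) powr \<sigma> else 0)"
proof -
  have loss: "(v - c) * (cutoff r R v - cutoff r R (v + w))
      \<le> (if r \<le> max v w then 2 * min v w * (max v w / R) powr \<sigma> else 0)"
    if "0 < v" "0 < w" "0 \<le> c" "c \<le> v" for v w c
  proof -
    have "(v - c) * (cutoff r R v - cutoff r R (v + w))
        \<le> (v - c) * (cutlow r v * (cuthigh R v - cuthigh R (v + w)))"
    proof (rule mult_left_mono)
      have "cutlow r v * cuthigh R (v + w) \<le> cutlow r (v + w) * cuthigh R (v + w)"
        using that assms(1,2) cuthigh_range[of R "v + w"]
        by (intro mult_right_mono cutlow_mono) auto
      then show "cutoff r R v - cutoff r R (v + w) \<le> cutlow r v * (cuthigh R v - cuthigh R (v + w))"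
        by (simp add: cutoff_def algebra_simps)
    qed (use that in auto)
    also have "\<dots> \<le> v * (cutlow r v * (cuthigh R v - cuthigh R (v + w)))"
      using that assms(1,2) cutlow_range[of r v] cuthigh_antimono[of R v "v + w"]
      by (intro mult_right_mono mult_nonneg_nonneg) auto
    also have "\<dots> \<le> (if r \<le> max v w then 2 * min v w * (max v w / R) powr \<sigma> else 0)"
    proof (cases "r \<le> max v w")
      case True
      have "v * (cutlow r v * (cuthigh R v - cuthigh R (v + w)))
          \<le> v * (1 * (cuthigh R v - cuthigh R (v + w)))"
        using that assms(1,2) cutlow_range[of r v] cuthigh_antimono[of R v "v + w"]
        by (intro mult_left_mono mult_right_mono) auto
      also have "\<dots> \<le> 2 * min v w * (max v w / R) powr \<sigma>"
        using cuthigh_loss[of R v w \<sigma>] that assms(1,2,5,6) by simp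
      finally show ?thesis using True by simp
    next
      case False
      then show ?thesis using that by (simp add: cutlow_eq_0)
    qed
    finally show ?thesis .
  qed
  have pos: "s > 0" "u > 0" using assms by (auto intro: l1norm_pos)
  have "(s - conc x) * (cutoff r R s - cutoff r R (s + u))
      \<le> (if r \<le> max s u then 2 * min s u * (max s u / R) powr \<sigma> else 0)"
    using assms pos conc_le_l1norm conc_nonneg by (intro loss) auto
  moreover have "(u - conc y) * (cutoff r R u - cutoff r R (u + s))
      \<le> (if r \<le> max u s then 2 * min u s * (max u s / R) powr \<sigma> else 0)"
    using assms pos conc_le_l1norm conc_nonneg by (intro loss) auto
  ultimately show ?thesis
    unfolding testfn_increment_eq[OF assms(3,4)] s_def[symmetric] u_def[symmetric]
    by (auto simp: add.commute[of u s] max.commute[of u s] min.commute[of u s] split: if_splits)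
qed

section \<open>Test functions\<close>

text \<open>The regularity clause of \<open>Cc1\<close> without the support condition. It is stable
  under sums, products and composition, so the test function can be assembled from
  coordinates.\<close>

definition C1_on :: "'a::real_normed_vector set \<Rightarrow> ('a \<Rightarrow> real) \<Rightarrow> bool" where
  "C1_on S f \<longleftrightarrow> (\<exists>D :: 'a \<Rightarrow> ('a \<Rightarrow>\<^sub>L real).
      (\<forall>z\<in>S. (f has_derivative blinfun_apply (D z)) (at z within S)) \<and> continuous_on S D)"

lemma Cc1_iff: "f \<in> Cc1 S \<longleftrightarrow> f \<in> Cc S \<and> C1_on S f"
  by (simp add: Cc1_def C1_on_def)

lemma C1_on_imp_continuous_on: "C1_on S f \<Longrightarrow> continuous_on S f"
  unfolding C1_on_def by (meson has_derivative_continuous_on)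

lemma C1_on_cong:
  assumes "C1_on S f" "\<And>z. z \<in> S \<Longrightarrow> f z = g z"
  shows "C1_on S g"
  using assms unfolding C1_on_def by (metis has_derivative_transform)

lemma C1_on_bounded_linear: "bounded_linear f \<Longrightarrow> C1_on S f"
  unfolding C1_on_def
  by (intro exI[of _ "\<lambda>_. Blinfun f"])
     (auto simp: bounded_linear_Blinfun_apply intro: bounded_linear_imp_has_derivative)

lemma C1_on_add:
  assumes "C1_on S f" "C1_on S g"
  shows "C1_on S (\<lambda>z. f z + g z)"
proof -
  obtain D E where
    "\<forall>z\<in>S. (f has_derivative blinfun_apply (D z)) (at z within S)" "continuous_on S D"
    "\<forall>z\<in>S. (g has_derivative blinfun_apply (E z)) (at z within S)" "continuous_on S E"
    using assms unfolding C1_on_def by blast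
  then show ?thesis
    unfolding C1_on_def
    by (intro exI[of _ "\<lambda>z. D z + E z"])
       (auto intro!: derivative_eq_intros continuous_intros simp: blinfun.add_left)
qed

lemma C1_on_mult:
  assumes "C1_on S f" "C1_on S g"
  shows "C1_on S (\<lambda>z. f z * g z)"
proof -
  obtain D E where D:
    "\<forall>z\<in>S. (f has_derivative blinfun_apply (D z)) (at z within S)" "continuous_on S D"
    "\<forall>z\<in>S. (g has_derivative blinfun_apply (E z)) (at z within S)" "continuous_on S E"
    using assms unfolding C1_on_def by blast
  have "((\<lambda>z. f z * g z) has_derivative blinfun_apply (f z *\<^sub>R E z + g z *\<^sub>R D z)) (at z within S)"
    if "z \<in> S" for z
    using has_derivative_mult[OF bspec[OF D(1) that] bspec[OF D(3) that]]
    by (rule has_derivative_eq_rhs) (auto simp: blinfun.add_left blinfun.scaleR_left)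
  moreover have "continuous_on S (\<lambda>z. f z *\<^sub>R E z + g z *\<^sub>R D z)"
    using D assms[THEN C1_on_imp_continuous_on] by (intro continuous_intros)
  ultimately show ?thesis
    unfolding C1_on_def by (intro exI[of _ "\<lambda>z. f z *\<^sub>R E z + g z *\<^sub>R D z"]) blast
qed

lemma C1_on_const: "C1_on S (\<lambda>_. c)"
  unfolding C1_on_def
  by (intro exI[of _ "\<lambda>_. 0"]) (auto intro!: has_derivative_eq_rhs[OF has_derivative_const])

lemma C1_on_sum:
  "finite I \<Longrightarrow> (\<And>i. i \<in> I \<Longrightarrow> C1_on S (f i)) \<Longrightarrow> C1_on S (\<lambda>z. \<Sum>i\<in>I. f i z)"
  by (induction I rule: finite_induct) (auto intro: C1_on_add C1_on_const)

lemma C1_on_compose_real: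
  assumes "C1_on S g"
    and h: "\<And>z. z \<in> S \<Longrightarrow> (h has_real_derivative h' (g z)) (at (g z))"
    and h': "continuous_on (g ` S) h'"
  shows "C1_on S (\<lambda>z. h (g z))"
proof -
  obtain D where D: "\<forall>z\<in>S. (g has_derivative blinfun_apply (D z)) (at z within S)" "continuous_on S D"
    using assms unfolding C1_on_def by blast
  have "((\<lambda>z. h (g z)) has_derivative blinfun_apply (h' (g z) *\<^sub>R D z)) (at z within S)"
    if "z \<in> S" for z
    using has_derivative_compose[OF bspec[OF D(1) that] h[OF that, unfolded has_field_derivative_def]]
    by (rule has_derivative_eq_rhs) (auto simp: blinfun.scaleR_left)
  moreover have "continuous_on S (\<lambda>z. h' (g z))"
    by (rule continuous_on_compose2[OF h' C1_on_imp_continuous_on[OF assms(1)]]) auto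
  then have "continuous_on S (\<lambda>z. h' (g z) *\<^sub>R D z)"
    using D by (intro continuous_intros)
  ultimately show ?thesis
    unfolding C1_on_def by (intro exI[of _ "\<lambda>z. h' (g z) *\<^sub>R D z"]) blast
qed

text \<open>On the orthant the absolute values disappear and \<open>l1norm\<close> is linear, hence
  smooth up to the boundary.\<close>

lemma C1_on_l1norm:
  "C1_on (Rstar \<times> T) (\<lambda>z. l1norm (fst z))"
proof (rule C1_on_cong)
  show "C1_on (Rstar \<times> T) (\<lambda>z. \<Sum>i\<in>UNIV. fst z $ i)"
    by (intro C1_on_sum C1_on_bounded_linear bounded_linear_compose[OF bounded_linear_vec_nth bounded_linear_fst]) simp
qed (auto simp: l1norm_Rstar)

lemma C1_on_inner_self: "C1_on (S :: ((real ^ 'n) \<times> 'b::real_normed_vector) set) (\<lambda>z. fst z \<bullet> fst z)"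
  unfolding inner_vec_def inner_real_def
  by (intro C1_on_sum C1_on_mult C1_on_bounded_linear
      bounded_linear_compose[OF bounded_linear_vec_nth bounded_linear_fst]) simp

lemma C1_on_testfn:
  assumes "0 < r" "0 < R"
  shows "C1_on (Rstar \<times> T) (\<lambda>z. testfn r R (fst z))"
proof -
  let ?S = "Rstar \<times> T"
  have pos: "l1norm (fst z) > 0" if "z \<in> ?S" for z
    using that l1norm_pos by auto
  have sub: "(\<lambda>z. l1norm (fst z)) ` ?S \<subseteq> {0<..}"
    using pos by auto
  have inv: "C1_on ?S (\<lambda>z. inverse (l1norm (fst z)))"
  proof (rule C1_on_compose_real[OF C1_on_l1norm])
    show "(inverse has_real_derivative - inverse ((l1norm (fst z))\<^sup>2)) (at (l1norm (fst z)))"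
      if "z \<in> ?S" for z
      using pos[OF that] by (auto intro!: derivative_eq_intros simp: power2_eq_square)
    show "continuous_on ((\<lambda>z. l1norm (fst z)) ` ?S) (\<lambda>s. - inverse (s\<^sup>2))"
      by (rule continuous_on_subset[OF _ sub]) (auto intro!: continuous_intros)
  qed
  have low: "C1_on ?S (\<lambda>z. cutlow r (l1norm (fst z)))"
  proof (rule C1_on_compose_real[OF C1_on_l1norm])
    show "(cutlow r has_real_derivative 2 * max 0 (1 - r / l1norm (fst z)) * (r / (l1norm (fst z))\<^sup>2))
        (at (l1norm (fst z)))" if "z \<in> ?S" for z
      unfolding cutlow_def using pos[OF that]
      by (auto intro!: derivative_eq_intros simp: power2_eq_square)
    show "continuous_on ((\<lambda>z. l1norm (fst z)) ` ?S) (\<lambda>s. 2 * max 0 (1 - r / s) * (r / s\<^sup>2))"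
      by (rule continuous_on_subset[OF _ sub]) (auto intro!: continuous_intros)
  qed
  have high: "C1_on ?S (\<lambda>z. cuthigh R (l1norm (fst z)))"
  proof (rule C1_on_compose_real[OF C1_on_l1norm])
    show "(cuthigh R has_real_derivative 2 * max 0 (1 - l1norm (fst z) / R) * (- 1 / R))
        (at (l1norm (fst z)))" if "z \<in> ?S" for z
      unfolding cuthigh_def using assms
      by (auto intro!: derivative_eq_intros)
    show "continuous_on ((\<lambda>z. l1norm (fst z)) ` ?S) (\<lambda>s. 2 * max 0 (1 - s / R) * (- 1 / R))"
      using assms by (intro continuous_intros) auto
  qed
  have "C1_on ?S (\<lambda>z. ((fst z \<bullet> fst z) * inverse (l1norm (fst z)) + (-1) * l1norm (fst z))
      * (cutlow r (l1norm (fst z)) * cuthigh R (l1norm (fst z))))"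
    by (intro C1_on_mult C1_on_add C1_on_const C1_on_inner_self C1_on_l1norm inv low high)
  then show ?thesis
    by (rule C1_on_cong) (simp add: testfn_def conc_def cutoff_def divide_inverse)
qed

lemma C1_on_plateau:
  assumes "e > 0"
  shows "C1_on S (\<lambda>z. plateau t1 t2 e (snd z))"
proof (rule C1_on_compose_real[where g = snd and h = "plateau t1 t2 e" and h' = "plateau' t1 t2 e"])
  show "C1_on S snd" by (intro C1_on_bounded_linear bounded_linear_snd)
qed (use assms in \<open>auto intro: plateau_deriv continuous_on_plateau'\<close>)

lemma continuous_on_testfn:
  assumes "0 < r" "0 < R"
  shows "continuous_on Rstar (testfn r R)"
proof -
  have "continuous_on (Rstar \<times> {0::real}) (\<lambda>z. testfn r R (fst z))"
    by (intro C1_on_imp_continuous_on C1_on_testfn assms)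
  then have "continuous_on Rstar (\<lambda>x. testfn r R (fst (x, 0::real)))"
    by (rule continuous_on_compose2) (auto intro!: continuous_intros)
  then show ?thesis by simp
qed

lemma testfn_Cc:
  assumes "0 < r" "0 < R"
  shows "testfn r R \<in> Cc Rstar"
  unfolding Cc_def
  by (auto simp: continuous_on_testfn[OF assms] not_le intro!: testfn_eq_0 assms
      exI[of _ "{x \<in> Rstar. r \<le> l1norm x \<and> l1norm x \<le> R}"] compact_annulus)

lemma testfn_plateau_Cc1:
  assumes "0 < r" "0 < R" "0 < t1" "0 < e" "t1 + e \<le> t2"
  shows "(\<lambda>z. testfn r R (fst z) * plateau t1 t2 e (snd z)) \<in> Cc1 (Rstar \<times> {0<..})"
proof -
  let ?C = "{x \<in> Rstar. r \<le> l1norm x \<and> l1norm x \<le> R} \<times> {t1..t2}"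
  have C1: "C1_on (Rstar \<times> {0<..}) (\<lambda>z. testfn r R (fst z) * plateau t1 t2 e (snd z))"
    using assms by (intro C1_on_mult C1_on_testfn C1_on_plateau)
  have "compact ?C"
    using assms by (intro compact_Times compact_annulus compact_Icc)
  moreover have "?C \<subseteq> Rstar \<times> {0<..}" using assms by auto
  moreover have "testfn r R (fst z) * plateau t1 t2 e (snd z) = 0" if "z \<in> Rstar \<times> {0<..} - ?C" for z
  proof (cases "snd z \<in> {t1..t2}")
    case True
    then have "testfn r R (fst z) = 0"
      using that assms by (intro testfn_eq_0) (auto simp: mem_Times_iff)
    then show ?thesis by simp
  next
    case False
    then show ?thesis using assms by (simp add: plateau_eq_0)
  qed
  ultimately show ?thesis
    unfolding Cc1_iff Cc_def using C1 C1_on_imp_continuous_on[OF C1] by blast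
qed

section \<open>Bounds for the kernel\<close>

text \<open>Combines what is integrable at a positive time: the moment of order \<open>1 - p\<close>
  near the origin, from the definition of a weak solution, and the conserved mass elsewhere.\<close>

definition weight :: "real \<Rightarrow> real \<Rightarrow> real" where
  "weight p s = (if s \<le> 1 then s powr (1 - p) else 0) + s"

lemma weight_ge: "s \<le> weight p s"
  by (simp add: weight_def)

text \<open>The right-hand side is a function of \<open>m\<close> times \<open>M\<close>, so it can
  be integrated as a product. For \<open>m \<le> 1\<close> the exponent of \<open>M\<close> exceeds
  1 by a nonpositive amount, which \<open>r \<le> M\<close> controls. For \<open>m > 1\<close> both
  exponents are at most 1 if \<open>0 \<le> p\<close>; if \<open>p < 0\<close>, the factor
  \<open>m powr (- p)\<close> is first moved to \<open>M\<close>, after which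
  \<open>\<gamma> + \<sigma> \<le> 1\<close> suffices.\<close>

lemma powr_min_max_le_weight:
  fixes \<gamma> p \<sigma> r m M :: real
  assumes "0 \<le> \<sigma>" "\<gamma> + p + \<sigma> \<le> 1" "\<gamma> + \<sigma> \<le> 1" "0 < m" "m \<le> M" "0 < r" "r \<le> 1" "r \<le> M"
  shows "m powr (1 - p) * M powr (\<gamma> + p + \<sigma>) \<le> r powr - (1 - \<gamma> - p - \<sigma>) * (weight p m * M)"
proof (cases "m \<le> 1")
  case True
  have "M powr (\<gamma> + p + \<sigma>) = M powr - (1 - \<gamma> - p - \<sigma>) * M"
    using assms powr_add[of M "- (1 - \<gamma> - p - \<sigma>)" 1] by (simp add: algebra_simps)
  also have "\<dots> \<le> r powr - (1 - \<gamma> - p - \<sigma>) * M"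
    using assms by (intro mult_right_mono powr_mono2') auto
  finally have "m powr (1 - p) * M powr (\<gamma> + p + \<sigma>) \<le> weight p m * (r powr - (1 - \<gamma> - p - \<sigma>) * M)"
    using True assms by (intro mult_mono) (auto simp: weight_def)
  then show ?thesis by (simp add: algebra_simps)
next
  case False
  have "m powr (1 - p) * M powr (\<gamma> + p + \<sigma>) \<le> m * M"
  proof (cases "0 \<le> p")
    case True
    have "m powr (1 - p) \<le> m" "M powr (\<gamma> + p + \<sigma>) \<le> M"
      using True False assms powr_mono[of "1 - p" 1 m] powr_mono[of "\<gamma> + p + \<sigma>" 1 M] by auto
    then show ?thesis using assms by (intro mult_mono) auto
  next
    case p: False
    have "m powr (1 - p) = m * m powr (- p)"
      using assms powr_add[of m 1 "- p"] by simp
    also have "\<dots> \<le> m * M powr (- p)"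
      using assms p by (intro mult_left_mono powr_mono2) auto
    finally have "m powr (1 - p) * M powr (\<gamma> + p + \<sigma>) \<le> m * M powr (- p) * M powr (\<gamma> + p + \<sigma>)"
      by (intro mult_right_mono) auto
    also have "\<dots> = m * M powr (\<gamma> + \<sigma>)"
      by (simp add: mult.assoc flip: powr_add)
    also have "\<dots> \<le> m * M powr 1"
      using assms False by (intro mult_left_mono powr_mono) auto
    finally show ?thesis using assms by simp
  qed
  also have "\<dots> \<le> 1 * (weight p m * M)"
    using assms weight_ge[of m p] by (simp add: mult_right_mono)
  also have "\<dots> \<le> r powr - (1 - \<gamma> - p - \<sigma>) * (weight p m * M)"
  proof (rule mult_right_mono)
    have "1 powr - (1 - \<gamma> - p - \<sigma>) \<le> r powr - (1 - \<gamma> - p - \<sigma>)"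
      using assms by (intro powr_mono2') auto
    then show "1 \<le> r powr - (1 - \<gamma> - p - \<sigma>)" by simp
    show "0 \<le> weight p m * M" using assms weight_ge[of m p] by simp
  qed
  finally show ?thesis .
qed

lemma Phi_ratio:
  assumes "0 < s" "0 < u"
  shows "Phi p (s / (s + u)) = (s * u) powr (- p) * (s + u) powr (2 * p)"
proof -
  have "1 - s / (s + u) = u / (s + u)" using assms by (simp add: field_simps)
  then have "Phi p (s / (s + u)) = (s / (s + u)) powr (- p) * (u / (s + u)) powr (- p)"
    by (simp add: Phi_def)
  also have "\<dots> = s powr (- p) * u powr (- p) / ((s + u) powr (- p) * (s + u) powr (- p))"
    using assms by (simp add: powr_divide)
  also have "(s + u) powr (- p) * (s + u) powr (- p) = (s + u) powr - (2 * p)"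
    by (simp flip: powr_add)
  finally show ?thesis using assms
    by (simp add: powr_mult powr_minus divide_inverse)
qed

text \<open>The left side equals
  \<open>(s * u) powr (- p) * (s + u) powr (\<gamma> + 2 * p)\<close>. Since the last exponent is
  nonnegative, \<open>s + u\<close> may be replaced by twice the larger size.\<close>

lemma kernel_bound_min_max:
  assumes "0 < s" "0 < u" "\<gamma> + 2 * p \<ge> 0"
  shows "(s + u) powr \<gamma> * Phi p (s / (s + u))
    \<le> 2 powr (\<gamma> + 2 * p) * ((min s u) powr (- p) * (max s u) powr (\<gamma> + p))"
proof -
  have "(s + u) powr \<gamma> * Phi p (s / (s + u)) = (s * u) powr (- p) * (s + u) powr (\<gamma> + 2 * p)"
    using assms by (simp add: Phi_ratio powr_add)
  also have "(s * u) powr (- p) = (min s u) powr (- p) * (max s u) powr (- p)"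
    using assms by (auto simp: min_def max_def powr_mult)
  also have "(s + u) powr (\<gamma> + 2 * p) \<le> (2 * max s u) powr (\<gamma> + 2 * p)"
    using assms by (intro powr_mono2) auto
  also have "(2 * max s u) powr (\<gamma> + 2 * p) = 2 powr (\<gamma> + 2 * p) * (max s u) powr (\<gamma> + 2 * p)"
    using assms by (intro powr_mult)
  finally have "(s + u) powr \<gamma> * Phi p (s / (s + u))
      \<le> (min s u) powr (- p) * (max s u) powr (- p) * (2 powr (\<gamma> + 2 * p) * (max s u) powr (\<gamma> + 2 * p))"
    by (simp add: mult_left_mono)
  also have "\<dots> = 2 powr (\<gamma> + 2 * p) * ((min s u) powr (- p) * ((max s u) powr (- p) * (max s u) powr (\<gamma> + 2 * p)))"
    by (simp only: mult_ac)
  also have "(max s u) powr (- p) * (max s u) powr (\<gamma> + 2 * p) = (max s u) powr (\<gamma> + p)"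
    by (simp add: algebra_simps flip: powr_add)
  finally show ?thesis .
qed

section \<open>Measures on the punctured orthant\<close>

abbreviation orthant :: "(real ^ 'n) measure" where
  "orthant \<equiv> restrict_space borel Rstar"

lemma space_orthant: "sets M = sets orthant \<Longrightarrow> space M = Rstar"
  using sets_eq_imp_space_eq[of M orthant] by (simp add: space_restrict_space)

lemma borel_measurable_orthant:
  assumes "sets M = sets orthant" "continuous_on Rstar g"
  shows "g \<in> borel_measurable M"
  using borel_measurable_continuous_on_restrict[OF assms(2)] measurable_cong_sets[OF assms(1) refl]
  by blast

lemma borel_measurable_orthant_pair:
  fixes g :: "(real ^ 'n) \<times> (real ^ 'm) \<Rightarrow> real"
  assumes "sets M = sets orthant" "sets N = sets orthant" "continuous_on (Rstar \<times> Rstar) g"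
  shows "g \<in> borel_measurable (M \<Otimes>\<^sub>M N)"
proof -
  have M: "(\<lambda>x. x) \<in> measurable M borel" "(\<lambda>x. x) \<in> measurable N borel"
    using assms(1,2) by (auto intro!: borel_measurable_orthant continuous_intros)
  have "(\<lambda>z. z) \<in> measurable (M \<Otimes>\<^sub>M N) (restrict_space borel (Rstar \<times> Rstar))"
  proof (rule measurable_restrict_space2)
    show "(\<lambda>z. z) \<in> space (M \<Otimes>\<^sub>M N) \<rightarrow> Rstar \<times> Rstar"
      using assms(1,2) by (auto simp: space_pair_measure space_orthant)
    have "(\<lambda>z. (fst z, snd z)) \<in> measurable (M \<Otimes>\<^sub>M N) borel"
      using measurable_compose[OF measurable_fst M(1)] measurable_compose[OF measurable_snd M(2)]
      by (rule borel_measurable_Pair)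
    then show "(\<lambda>z. z) \<in> measurable (M \<Otimes>\<^sub>M N) borel" by simp
  qed
  from measurable_compose[OF this borel_measurable_continuous_on_restrict[OF assms(3)]]
  show ?thesis .
qed

lemma Radon_measures_sets: "M \<in> Radon_measures \<Longrightarrow> sets M = sets orthant"
  by (simp add: Radon_measures_def)

lemma Radon_measures_sigma_finite:
  fixes M :: "(real ^ 'n) measure"
  assumes "M \<in> Radon_measures"
  shows "sigma_finite_measure M"
proof
  define A where "A n = {x :: real ^ 'n. x \<in> Rstar \<and> 1 / real (Suc n) \<le> l1norm x \<and> l1norm x \<le> real (Suc n)}" for n
  have compact: "compact (A n)" for n
    unfolding A_def by (intro compact_annulus) simp
  have sets: "A n \<in> sets M" for n
  proof -
    have "A n \<in> sets borel" using compact by (simp add: borel_compact)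
    then have "A n \<in> sets orthant"
      by (subst sets_restrict_space_iff) (auto simp: A_def)
    then show ?thesis using Radon_measures_sets[OF assms] by simp
  qed
  have "(\<Union>n. A n) = Rstar"
  proof (rule antisym)
    show "Rstar \<subseteq> (\<Union>n. A n)"
    proof
      fix x :: "real ^ 'n" assume x: "x \<in> Rstar"
      obtain n where n: "max (l1norm x) (1 / l1norm x) < real n" using reals_Archimedean2 by blast
      have pos: "0 < l1norm x" by (rule l1norm_pos[OF x])
      have "1 < real n * l1norm x" using n pos by (simp add: pos_divide_less_eq)
      then have "1 / real (Suc n) \<le> l1norm x"
        using pos by (simp add: divide_le_eq algebra_simps)
      then show "x \<in> (\<Union>n. A n)" using n x by (auto simp: A_def intro!: exI[of _ n])
    qed
  qed (auto simp: A_def)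
  then show "\<exists>B. countable B \<and> B \<subseteq> sets M \<and> \<Union>B = space M \<and> (\<forall>b\<in>B. emeasure M b \<noteq> \<infinity>)"
    using sets compact assms space_orthant[OF Radon_measures_sets[OF assms]]
    by (intro exI[of _ "range A"]) (auto simp: Radon_measures_def A_def less_top)
qed

text \<open>The total mass of \<open>M\<close> may be infinite, so Fubini relies on a majorant built
  from products of integrable functions. Each of its two products contributes \<open>C\<close> times
  the product of the integrals.\<close>

lemma double_integral_dominated:
  fixes k :: "'a \<Rightarrow> 'a \<Rightarrow> real"
  assumes "sigma_finite_measure M" and k [measurable]: "case_prod k \<in> borel_measurable (M \<Otimes>\<^sub>M M)"
    and w: "integrable M w" and l: "integrable M l" and "0 \<le> C"
    and bound: "\<And>x y. x \<in> space M \<Longrightarrow> y \<in> space M \<Longrightarrow> \<bar>k x y\<bar> \<le> C * (w x * l y + l x * w y)"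
  shows "integrable (M \<Otimes>\<^sub>M M) (case_prod k)"
    and "\<And>x. x \<in> space M \<Longrightarrow> integrable M (k x)"
    and "integrable M (\<lambda>x. \<integral>y. k x y \<partial>M)"
    and "(\<integral>x. (\<integral>y. k x y \<partial>M) \<partial>M) = (\<integral>z. case_prod k z \<partial>(M \<Otimes>\<^sub>M M))"
    and "\<bar>\<integral>x. (\<integral>y. k x y \<partial>M) \<partial>M\<bar> \<le> 2 * C * ((\<integral>x. w x \<partial>M) * (\<integral>x. l x \<partial>M))"
proof -
  interpret sigma_finite_measure M by fact
  interpret P: pair_sigma_finite M M ..
  let ?W = "\<integral>x. w x \<partial>M" and ?L = "\<integral>x. l x \<partial>M"
  have G: "integrable M (\<lambda>y. C * (w x * l y + l x * w y))" for x
    using w l by auto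
  have G2: "integrable M (\<lambda>x. C * (w x * ?L + l x * ?W))"
    using w l by auto
  have Gint: "(\<integral>y. C * (w x * l y + l x * w y) \<partial>M) = C * (w x * ?L + l x * ?W)" for x
    using w l by simp
  have kx [measurable]: "k x \<in> borel_measurable M" if "x \<in> space M" for x
    using measurable_compose[OF measurable_Pair1'[OF that] k] by simp
  show ikx: "integrable M (k x)" if "x \<in> space M" for x
    by (rule Bochner_Integration.integrable_bound[OF G[of x]])
       (use that bound in \<open>auto intro!: AE_I2 intro: order_trans[OF _ abs_ge_self]\<close>)
  have inorm: "(\<integral>y. \<bar>k x y\<bar> \<partial>M) \<le> C * (w x * ?L + l x * ?W)" if "x \<in> space M" for x
    unfolding Gint[symmetric]
    using that bound ikx[OF that] by (intro integral_mono G) auto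
  have meas: "(\<lambda>x. \<integral>y. norm (case_prod k (x, y)) \<partial>M) \<in> borel_measurable M"
    by measurable
  have inorm': "integrable M (\<lambda>x. \<integral>y. norm (case_prod k (x, y)) \<partial>M)"
    by (rule Bochner_Integration.integrable_bound[OF G2 meas])
       (use inorm in \<open>auto intro!: AE_I2 intro: order_trans[OF _ abs_ge_self]\<close>)
  show prod: "integrable (M \<Otimes>\<^sub>M M) (case_prod k)"
    by (rule P.Fubini_integrable) (use inorm' ikx in auto)
  show "integrable M (\<lambda>x. \<integral>y. k x y \<partial>M)"
    using P.integrable_fst'[OF prod] by simp
  show eq: "(\<integral>x. (\<integral>y. k x y \<partial>M) \<partial>M) = (\<integral>z. case_prod k z \<partial>(M \<Otimes>\<^sub>M M))"
    using P.integral_fst'[OF prod] by simp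
  have "\<bar>\<integral>x. (\<integral>y. k x y \<partial>M) \<partial>M\<bar> \<le> (\<integral>x. \<bar>\<integral>y. k x y \<partial>M\<bar> \<partial>M)"
    by (rule integral_abs_bound)
  also have "\<dots> \<le> (\<integral>x. C * (w x * ?L + l x * ?W) \<partial>M)"
  proof (rule integral_mono)
    show "integrable M (\<lambda>x. \<bar>\<integral>y. k x y \<partial>M\<bar>)"
      using P.integrable_fst'[OF prod] by simp
    show "\<bar>\<integral>y. k x y \<partial>M\<bar> \<le> C * (w x * ?L + l x * ?W)" if "x \<in> space M" for x
      using integral_abs_bound[of M "k x"] inorm[OF that] by linarith
  qed (rule G2)
  also have "\<dots> = 2 * C * (?W * ?L)"
    using w l by (simp add: algebra_simps)
  finally show "\<bar>\<integral>x. (\<integral>y. k x y \<partial>M) \<partial>M\<bar> \<le> 2 * C * (?W * ?L)" .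
qed

text \<open>
  Weak-* continuity alone does not make the double integrals continuous in time. Their
  measurability comes from viewing the normalised mass distributions as a Markov kernel.
\<close>

lemma measurable_mass_distribution:
  fixes f :: "real \<Rightarrow> (real ^ 'n) measure"
  assumes cont: "continuous_map (top_of_set {0..}) weak_star_topology f"
    and "0 < m0" and mass: "\<And>t. t \<ge> 0 \<Longrightarrow> has_bochner_integral (f t) l1norm m0"
  shows "(\<lambda>t. density (f t) (\<lambda>x. ennreal (l1norm x / m0)))
    \<in> measurable (restrict_space borel {0..}) (subprob_algebra orthant)"
proof -
  let ?nu = "\<lambda>t. density (f t) (\<lambda>x. ennreal (l1norm x / m0))"
  have rad: "f t \<in> Radon_measures" if "t \<ge> 0" for t
    using cont that by (simp add: continuous_map_weak_star_iff)
  note sets = Radon_measures_sets[OF rad]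
  note space = space_orthant[OF sets]
  have pairing: "continuous_on {0..} (\<lambda>t. \<integral>x. \<phi> x \<partial>f t)" if "\<phi> \<in> Cc Rstar" for \<phi>
    using cont that by (simp add: continuous_map_weak_star_iff)
  have l1 [measurable]: "l1norm \<in> borel_measurable (f t)" if "t \<ge> 0" for t
    by (intro borel_measurable_orthant sets continuous_intros that)
  have prob: "prob_space (?nu t)" if "t \<ge> 0" for t
  proof
    have "emeasure (?nu t) (space (?nu t)) = (\<integral>\<^sup>+x. ennreal (l1norm x / m0) \<partial>f t)"
      using that by (simp add: emeasure_density cong: nn_integral_cong)
    also have "\<dots> = ennreal (\<integral>x. l1norm x / m0 \<partial>f t)"
      using mass[OF that] \<open>0 < m0\<close>
      by (intro nn_integral_eq_integral) (auto simp: has_bochner_integral_iff l1norm_nonneg)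
    also have "(\<integral>x. l1norm x / m0 \<partial>f t) = 1"
      using mass[OF that] \<open>0 < m0\<close> by (simp add: has_bochner_integral_iff)
    finally show "emeasure (?nu t) (space (?nu t)) = 1" by simp
  qed
  have measurable_closed: "(\<lambda>t. emeasure (?nu t) (C \<inter> Rstar)) \<in> borel_measurable (restrict_space borel {0..})"
    if C: "closed C" for C :: "(real ^ 'n) set"
  \<comment> \<open>By convention \<open>infdist x {} = 0\<close>, for which the approximation below
    would tend to 1 instead of the indicator.\<close>
  proof (cases "C = {}")
    case False
    \<comment> \<open>A tent shrinking to the indicator of \<open>C\<close>, a size cutoff for
      compact support, and the density of the mass distribution. Each pairing is continuous in time,
      so the limit is measurable in time.\<close>
    define \<phi> where "\<phi> n x = max 0 (1 - real n * infdist x C) * (cutoff (1 / real (Suc n)) (real (Suc n)) (l1norm x) * (l1norm x / m0))"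
      for n and x :: "real ^ 'n"
    have cutoff_cont: "continuous_on Rstar (\<lambda>x::real^'n. cutoff (1 / real (Suc n)) (real (Suc n)) (l1norm x))" for n
      unfolding cutoff_def cutlow_def cuthigh_def
      by (intro continuous_intros) (auto dest: l1norm_pos)
    have \<phi>_cont: "continuous_on Rstar (\<phi> n)" for n
      unfolding \<phi>_def using \<open>0 < m0\<close> by (intro continuous_intros cutoff_cont) auto
    have \<phi>: "\<phi> n \<in> Cc Rstar" for n
    proof -
      have "\<phi> n x = 0" if "x \<in> Rstar" "\<not> (1 / real (Suc n) \<le> l1norm x \<and> l1norm x \<le> real (Suc n))" for x
        using that l1norm_pos[OF that(1)] by (auto simp: \<phi>_def cutoff_def not_le cutlow_eq_0 cuthigh_eq_0)
      then show ?thesis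
        unfolding Cc_def using \<phi>_cont
        by (intro CollectI conjI exI[of _ "{x \<in> Rstar. 1 / real (Suc n) \<le> l1norm x \<and> l1norm x \<le> real (Suc n)}"]
            compact_annulus) auto
    qed
    have bound: "\<bar>\<phi> n x\<bar> \<le> l1norm x / m0" if "x \<in> Rstar" for n x
    proof -
      have "max 0 (1 - real n * infdist x C) * (cutoff (1 / real (Suc n)) (real (Suc n)) (l1norm x) * (l1norm x / m0))
          \<le> 1 * (1 * (l1norm x / m0))"
        using cutoff_range[of "1 / real (Suc n)" "real (Suc n)" "l1norm x"] l1norm_pos[OF that] \<open>0 < m0\<close>
        by (intro mult_mono) (auto simp: infdist_nonneg)
      moreover have "0 \<le> \<phi> n x"
        using cutoff_range[of "1 / real (Suc n)" "real (Suc n)" "l1norm x"] l1norm_pos[OF that] \<open>0 < m0\<close>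
        by (auto simp: \<phi>_def)
      ultimately show ?thesis by (simp add: \<phi>_def)
    qed
    have lim: "(\<lambda>n. \<phi> n x) \<longlonglongrightarrow> indicator C x * (l1norm x / m0)" if "x \<in> Rstar" for x
    proof -
      have L: "l1norm x > 0" by (rule l1norm_pos[OF that])
      have "(\<lambda>n. cutoff (1 / real (Suc n)) (real (Suc n)) (l1norm x)) \<longlonglongrightarrow> (max 0 (1 - 0 / l1norm x))\<^sup>2 * (max 0 (1 - 0))\<^sup>2"
        unfolding cutoff_def cutlow_def cuthigh_def pos2_def
        by (intro tendsto_intros LIMSEQ_Suc[OF lim_inverse_n'] LIMSEQ_Suc[OF lim_const_over_n]) (use L in auto)
      then have cutoff_lim: "(\<lambda>n. cutoff (1 / real (Suc n)) (real (Suc n)) (l1norm x)) \<longlonglongrightarrow> 1" by simp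
      have "(\<lambda>n. max 0 (1 - real n * infdist x C)) \<longlonglongrightarrow> indicator C x"
      proof (cases "x \<in> C")
        case True then show ?thesis using C by simp
      next
        case out: False
        then have d: "0 < infdist x C"
          using C False by (metis in_closed_iff_infdist_zero infdist_nonneg less_eq_real_def)
        obtain N where N: "1 / infdist x C < real N" using reals_Archimedean2 by blast
        have "max 0 (1 - real n * infdist x C) = 0" if "n \<ge> N" for n
        proof -
          have "1 < real n * infdist x C"
            using N d that by (simp add: divide_less_eq) (meson less_le_trans mult_right_mono infdist_nonneg of_nat_le_iff)
          then show ?thesis by simp
        qed
        then show ?thesis using out
          by (intro tendsto_eventually) (auto simp: eventually_sequentially)
      qed
      then have "(\<lambda>n. \<phi> n x) \<longlonglongrightarrow> indicator C x * (1 * (l1norm x / m0))"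
        unfolding \<phi>_def by (intro tendsto_mult cutoff_lim tendsto_const)
      then show ?thesis by simp
    qed
    have conv: "(\<lambda>n. \<integral>x. \<phi> n x \<partial>f t) \<longlonglongrightarrow> (\<integral>x. indicator C x * (l1norm x / m0) \<partial>f t)" if t: "t \<ge> 0" for t
    proof (rule integral_dominated_convergence[where w = "\<lambda>x. l1norm x / m0"])
      have [measurable]: "(\<lambda>x. x) \<in> measurable (f t) borel" and [measurable]: "C \<in> sets borel"
        using C by (auto intro!: borel_measurable_orthant sets t continuous_intros)
      show "(\<lambda>x. indicator C x * (l1norm x / m0)) \<in> borel_measurable (f t)"
        using t by measurable
      show "integrable (f t) (\<lambda>x. l1norm x / m0)"
        using mass[OF t] by (auto simp: has_bochner_integral_iff)
    qed (use lim bound space[OF t] \<phi>_cont sets[OF t] in \<open>auto intro!: AE_I2 borel_measurable_orthant\<close>)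
    have meas: "(\<lambda>t. \<integral>x. indicator C x * (l1norm x / m0) \<partial>f t) \<in> borel_measurable (restrict_space borel {0..})"
    proof (rule borel_measurable_LIMSEQ_real)
      show "(\<lambda>n. \<integral>x. \<phi> n x \<partial>f t) \<longlonglongrightarrow> (\<integral>x. indicator C x * (l1norm x / m0) \<partial>f t)"
        if "t \<in> space (restrict_space borel {0..})" for t
        using that by (intro conv) (simp add: space_restrict_space)
    qed (intro borel_measurable_continuous_on_restrict pairing \<phi>)
    have "emeasure (?nu t) (C \<inter> Rstar) = ennreal (\<integral>x. indicator C x * (l1norm x / m0) \<partial>f t)" if t: "t \<ge> 0" for t
    proof -
      have [measurable]: "(\<lambda>x. x) \<in> measurable (f t) borel" and [measurable]: "C \<in> sets borel"
        using C by (auto intro!: borel_measurable_orthant sets t continuous_intros)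
      have "C \<inter> Rstar \<in> sets (f t)"
        using C sets[OF t] by (auto simp: sets_restrict_space)
      then have "emeasure (?nu t) (C \<inter> Rstar)
          = (\<integral>\<^sup>+x. ennreal (l1norm x / m0) * indicator (C \<inter> Rstar) x \<partial>f t)"
        using t by (intro emeasure_density) auto
      also have "\<dots> = (\<integral>\<^sup>+x. ennreal (indicator C x * (l1norm x / m0)) \<partial>f t)"
        by (intro nn_integral_cong) (auto simp: space[OF t] indicator_def)
      also have "\<dots> = ennreal (\<integral>x. indicator C x * (l1norm x / m0) \<partial>f t)"
      proof (rule nn_integral_eq_integral)
        have "integrable (f t) (\<lambda>x. l1norm x / m0)"
          using mass[OF t] by (auto simp: has_bochner_integral_iff)
        then show "integrable (f t) (\<lambda>x. indicator C x * (l1norm x / m0))"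
          by (rule Bochner_Integration.integrable_bound) (use t in \<open>auto simp: indicator_def\<close>)
      qed (use \<open>0 < m0\<close> in \<open>auto simp: l1norm_nonneg\<close>)
      finally show ?thesis .
    qed
    then show ?thesis
      using meas by (subst measurable_cong[where g = "\<lambda>t. ennreal (\<integral>x. indicator C x * (l1norm x / m0) \<partial>f t)"])
        (auto simp: space_restrict_space)
  qed simp
  show ?thesis
  \<comment> \<open>Traces of closed sets are stable under intersection and generate the Borel sets
    of \<open>Rstar\<close>, so the measurability of their masses suffices.\<close>
  proof (rule measurable_subprob_algebra_generated[where \<Omega> = Rstar and G = "(\<lambda>C. C \<inter> Rstar) ` Collect closed"])
    have "(Rstar :: (real ^ 'n) set) \<in> sigma_sets UNIV (Collect closed)"
      using borel_Rstar by (simp add: borel_eq_closed)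
    then have "(\<inter>) (Rstar :: (real ^ 'n) set) ` sigma_sets UNIV (Collect closed)
        = sigma_sets Rstar ((\<inter>) Rstar ` Collect closed)"
      by (rule sigma_sets_Int) simp
    then show "sets orthant = sigma_sets (Rstar :: (real ^ 'n) set) ((\<lambda>C. C \<inter> Rstar) ` Collect closed)"
      by (simp add: sets_restrict_space borel_eq_closed Int_commute)
    show "Int_stable ((\<lambda>C. C \<inter> (Rstar :: (real ^ 'n) set)) ` Collect closed)"
    proof (rule Int_stableI, clarsimp)
      fix C D :: "(real ^ 'n) set" assume "closed C" "closed D"
      then show "C \<inter> Rstar \<inter> (D \<inter> Rstar) \<in> (\<lambda>C. C \<inter> Rstar) ` Collect closed"
        by (intro image_eqI[of _ _ "C \<inter> D"]) auto
    qed
    show "(\<lambda>t. emeasure (?nu t) Rstar) \<in> borel_measurable (restrict_space borel {0..})"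
      using measurable_closed[of UNIV] by simp
  qed (use prob sets measurable_closed in \<open>auto simp: space_restrict_space prob_space_imp_subprob_space\<close>)
qed

section \<open>The differential inequality\<close>

locale coagulation =
  fixes K :: "real ^ 'n \<Rightarrow> real ^ 'n \<Rightarrow> real"
    and f :: "real \<Rightarrow> (real ^ 'n) measure"
    and f0 :: "(real ^ 'n) measure"
    and c1 c2 \<gamma> p m0 a C0 :: real
  assumes K_cont: "continuous_on (Rstar \<times> Rstar) (\<lambda>(x, y). K x y)"
    and K_nonneg: "\<And>x y. x \<in> Rstar \<Longrightarrow> y \<in> Rstar \<Longrightarrow> 0 \<le> K x y"
    and c: "0 < c1" "c1 \<le> c2"
    and exponents: "\<gamma> + 2 * p \<ge> 0" "\<gamma> < 1" "\<gamma> + p < 1"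
    and K_lower: "\<And>x y. x \<in> Rstar \<Longrightarrow> y \<in> Rstar \<Longrightarrow>
      c1 * (l1norm x + l1norm y) powr \<gamma> * Phi p (l1norm x / (l1norm x + l1norm y)) \<le> K x y"
    and K_upper: "\<And>x y. x \<in> Rstar \<Longrightarrow> y \<in> Rstar \<Longrightarrow>
      K x y \<le> c2 * (l1norm x + l1norm y) powr \<gamma> * Phi p (l1norm x / (l1norm x + l1norm y))"
    and solution: "weak_solution K \<gamma> p f0 f"
    and m0_pos: "0 < m0"
    and mass: "\<And>t. t \<ge> 0 \<Longrightarrow> has_bochner_integral (f t) l1norm m0"
    and a: "a > 1"
    and C0: "C0 > 0"
    and moments: "\<And>k t. k \<in> {1/a..a} \<Longrightarrow> t \<ge> 1 \<Longrightarrow>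
      (\<integral>\<^sup>+x. ennreal (l1norm x powr k) \<partial>f t) \<le> ennreal (C0 * t powr ((k - 1) / (1 - \<gamma>)))"
begin

lemma continuous_weak_star: "continuous_map (top_of_set {0..}) weak_star_topology f"
  using solution by (simp add: weak_solution_def)

lemma f_Radon: "t \<ge> 0 \<Longrightarrow> f t \<in> Radon_measures"
  using continuous_weak_star by (simp add: continuous_map_weak_star_iff)

lemmas f_sets = Radon_measures_sets[OF f_Radon]
lemmas f_space = space_orthant[OF f_sets]
lemmas f_sigma_finite = Radon_measures_sigma_finite[OF f_Radon]
lemmas f_measurable = borel_measurable_orthant[OF f_sets]

lemma continuous_pairing: "\<phi> \<in> Cc Rstar \<Longrightarrow> continuous_on {0..} (\<lambda>t. \<integral>x. \<phi> x \<partial>f t)"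
  using continuous_weak_star by (simp add: continuous_map_weak_star_iff)

lemma integrable_l1norm: "t \<ge> 0 \<Longrightarrow> integrable (f t) l1norm"
  and integral_l1norm: "t \<ge> 0 \<Longrightarrow> (\<integral>x. l1norm x \<partial>f t) = m0"
  using mass by (auto simp: has_bochner_integral_iff)

text \<open>The exponent to spare, positive because \<open>\<gamma> < 1\<close> and
  \<open>\<gamma> + p < 1\<close> are strict, and at most 1 as \<open>cuthigh_loss\<close> demands.
  With \<sigma> further powers the larger size has total exponent
  \<open>\<gamma> + p + \<sigma> \<le> 1\<close>; \<open>q\<close> is the remaining gap, and becomes
  the power of \<open>1 / r\<close> lost at small sizes.\<close>

definition "\<sigma> = min 1 (min (1 - \<gamma> - p) (1 - \<gamma>))"

definition "q = 1 - \<gamma> - p - \<sigma>"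

lemma \<sigma>: "0 < \<sigma>" "\<sigma> \<le> 1" "\<gamma> + p + \<sigma> \<le> 1" "\<gamma> + \<sigma> \<le> 1" and q: "0 \<le> q"
  using exponents by (auto simp: \<sigma>_def q_def)

definition "A = c2 * 2 powr (\<gamma> + 2 * p)"

lemma A_pos: "0 < A"
  using c by (simp add: A_def)

lemma K_le_min_max:
  assumes "x \<in> Rstar" "y \<in> Rstar"
  shows "K x y \<le> A * (min (l1norm x) (l1norm y) powr (- p) * max (l1norm x) (l1norm y) powr (\<gamma> + p))"
proof -
  have "K x y \<le> c2 * ((l1norm x + l1norm y) powr \<gamma> * Phi p (l1norm x / (l1norm x + l1norm y)))"
    using K_upper[OF assms] by (simp add: mult.assoc)
  also have "\<dots> \<le> c2 * (2 powr (\<gamma> + 2 * p) *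
      (min (l1norm x) (l1norm y) powr (- p) * max (l1norm x) (l1norm y) powr (\<gamma> + p)))"
    using c exponents assms[THEN l1norm_pos] by (intro mult_left_mono kernel_bound_min_max) auto
  finally show ?thesis by (simp add: A_def mult.assoc)
qed

abbreviation wt :: "real ^ 'n \<Rightarrow> real" where
  "wt x \<equiv> weight p (l1norm x)"

lemma wt_nonneg: "0 \<le> wt x"
  using l1norm_nonneg[of x] weight_ge[of "l1norm x" p] by linarith

text \<open>Used with \<open>s = 0\<close> for absolute integrability and with
  \<open>s = \<sigma>\<close> for the loss at the upper cutoff. Summing both assignments of the
  smaller and the larger size makes the bound symmetric in \<open>x\<close> and
  \<open>y\<close>.\<close>

lemma K_min_max_le:
  assumes "x \<in> Rstar" "y \<in> Rstar" "0 < r" "r \<le> 1" "r \<le> max (l1norm x) (l1norm y)"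
    and "0 \<le> s" "\<gamma> + p + s \<le> 1" "\<gamma> + s \<le> 1"
  shows "K x y * (min (l1norm x) (l1norm y) * max (l1norm x) (l1norm y) powr s)
    \<le> A * r powr - (1 - \<gamma> - p - s) * (wt x * l1norm y + l1norm x * wt y)"
proof -
  let ?m = "min (l1norm x) (l1norm y)" and ?M = "max (l1norm x) (l1norm y)"
  have pos: "0 < ?m" "?m \<le> ?M" "0 < ?M" using assms(1,2)[THEN l1norm_pos] by auto
  have "K x y * (?m * ?M powr s) \<le> A * (?m powr (- p) * ?M powr (\<gamma> + p)) * (?m * ?M powr s)"
    using pos by (intro mult_right_mono K_le_min_max assms) auto
  also have "\<dots> = A * ((?m * ?m powr (- p)) * (?M powr (\<gamma> + p) * ?M powr s))"
    by (simp only: mult_ac)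
  also have "?m * ?m powr (- p) = ?m powr (1 - p)"
    using pos powr_add[of ?m 1 "- p"] by simp
  also have "?M powr (\<gamma> + p) * ?M powr s = ?M powr (\<gamma> + p + s)"
    by (simp add: powr_add)
  also have "A * (?m powr (1 - p) * ?M powr (\<gamma> + p + s))
      \<le> A * (r powr - (1 - \<gamma> - p - s) * (weight p ?m * ?M))"
    using A_pos pos assms by (intro mult_left_mono powr_min_max_le_weight) auto
  also have "\<dots> \<le> A * (r powr - (1 - \<gamma> - p - s) * (wt x * l1norm y + l1norm x * wt y))"
  proof -
    have "0 \<le> wt x * l1norm y" "0 \<le> l1norm x * wt y"
      using wt_nonneg l1norm_nonneg by (auto intro: mult_nonneg_nonneg)
    then have "weight p ?m * ?M \<le> wt x * l1norm y + l1norm x * wt y"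
      by (auto simp: min_def max_def mult.commute)
    then show ?thesis using A_pos by (intro mult_left_mono) auto
  qed
  finally show ?thesis by (simp add: mult.assoc)
qed

abbreviation incr :: "real \<Rightarrow> real \<Rightarrow> real ^ 'n \<Rightarrow> real ^ 'n \<Rightarrow> real" where
  "incr r R x y \<equiv> testfn r R (x + y) - testfn r R x - testfn r R y"

lemma K_incr_abs:
  assumes "0 < r" "r \<le> 1" "0 < R" "x \<in> Rstar" "y \<in> Rstar"
  shows "\<bar>K x y * incr r R x y\<bar> \<le> (8 + 4 * R / r) * (A * (r / 2) powr - (1 - \<gamma> - p))
    * (wt x * l1norm y + l1norm x * wt y)"
\<comment> \<open>If both sizes are below \<open>r / 2\<close>, even the merged size lies below the
  lower cutoff and the increment vanishes; this is why \<open>r / 2\<close> appears instead of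
  \<open>r\<close>.\<close>
proof (cases "r / 2 \<le> max (l1norm x) (l1norm y)")
  case True
  have pos: "0 < l1norm x" "0 < l1norm y" using assms by (auto intro: l1norm_pos)
  have "\<bar>K x y * incr r R x y\<bar> \<le> K x y * ((8 + 4 * R / r) * min (l1norm x) (l1norm y))"
    unfolding abs_mult abs_of_nonneg[OF K_nonneg[OF assms(4,5)]]
    by (intro mult_left_mono testfn_increment_abs K_nonneg assms)
  also have "\<dots> = (8 + 4 * R / r) * (K x y * (min (l1norm x) (l1norm y) * max (l1norm x) (l1norm y) powr 0))"
    using pos by (simp add: mult_ac max_def)
  also have "\<dots> \<le> (8 + 4 * R / r) * (A * (r / 2) powr - (1 - \<gamma> - p - 0)
      * (wt x * l1norm y + l1norm x * wt y))"
    using assms True exponents by (intro mult_left_mono K_min_max_le) auto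
  finally show ?thesis by (simp add: mult.assoc)
next
  case False
  then have "l1norm x \<le> r" "l1norm y \<le> r" "l1norm (x + y) \<le> r"
    using assms l1norm_pos[of x] l1norm_pos[of y] by (auto simp: l1norm_add)
  then have "incr r R x y = 0"
    using assms by (simp add: testfn_eq_0 Rstar_add)
  moreover have "0 \<le> wt x * l1norm y + l1norm x * wt y"
    using wt_nonneg l1norm_nonneg by (auto intro!: add_nonneg_nonneg mult_nonneg_nonneg)
  then have "0 \<le> (8 + 4 * R / r) * (A * (r / 2) powr - (1 - \<gamma> - p)) * (wt x * l1norm y + l1norm x * wt y)"
    using assms A_pos by (intro mult_nonneg_nonneg) auto
  ultimately show ?thesis by simp
qed

text \<open>
  The upper cutoff \<open>Rn n\<close> grows so much faster than \<open>1 / rn n\<close> that the loss at large sizes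
  vanishes although its bound deteriorates with the lower cutoff.
\<close>

definition "rn n = 1 / real (Suc n)"

definition "Rn n = real (Suc n) powr ((q + 1) / \<sigma>)"

lemma rn: "0 < rn n" "rn n \<le> 1" and Rn: "0 < Rn n"
  by (auto simp: rn_def Rn_def)

text \<open>The exponent in \<open>Rn\<close> is made for this identity:
  \<open>Rn n powr - \<sigma>\<close> gains \<open>q + 1\<close> powers of \<open>Suc n\<close>, one
  more than \<open>rn n powr - q\<close> costs.\<close>

lemma rn_Rn: "Rn n powr - \<sigma> * rn n powr - q = 1 / real (Suc n)"
proof -
  have "Rn n powr - \<sigma> = real (Suc n) powr - (q + 1)"
    using \<sigma> by (simp add: Rn_def powr_powr)
  moreover have "rn n powr - q = real (Suc n) powr q"
    by (simp add: rn_def powr_divide powr_minus_divide)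
  ultimately have "Rn n powr - \<sigma> * rn n powr - q = real (Suc n) powr (- (q + 1) + q)"
    by (simp only: powr_add)
  also have "\<dots> = real (Suc n) powr (- 1)" by simp
  finally show ?thesis by (simp add: powr_minus_divide)
qed

lemma rn_lim: "rn \<longlonglongrightarrow> 0"
  unfolding rn_def by (rule LIMSEQ_Suc[OF lim_const_over_n])

lemma Rn_lim: "filterlim Rn at_top sequentially"
proof (rule filterlim_at_top_mono[OF filterlim_real_sequentially], intro always_eventually allI)
  fix n
  have "real n \<le> real (Suc n) powr 1" by simp
  also have "\<dots> \<le> Rn n"
    unfolding Rn_def using \<sigma> q by (intro powr_mono) (auto simp: le_divide_eq)
  finally show "real n \<le> Rn n" .
qed

text \<open>While the bound in \<open>K_incr_abs\<close> diverges as \<open>n\<close> grows, this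
  one-sided estimate passes to the limit: its error carries the factor
  \<open>1 / real (Suc n)\<close> and the dissipation is retained.\<close>

lemma K_incr_le:
  assumes "x \<in> Rstar" "y \<in> Rstar"
  shows "K x y * incr (rn n) (Rn n) x y
    \<le> 4 * A / real (Suc n) * (wt x * l1norm y + l1norm x * wt y)
      - cutoff (rn n) (Rn n) (l1norm x + l1norm y) * (K x y * (conc x + conc y - conc (x + y)))"
proof -
  let ?m = "min (l1norm x) (l1norm y)" and ?M = "max (l1norm x) (l1norm y)"
  let ?G = "wt x * l1norm y + l1norm x * wt y"
  have G: "0 \<le> ?G"
    using wt_nonneg l1norm_nonneg by (auto intro!: add_nonneg_nonneg mult_nonneg_nonneg)
  have pos: "0 < ?M" using assms[THEN l1norm_pos] by auto
  have err: "K x y * (if rn n \<le> ?M then 4 * ?m * (?M / Rn n) powr \<sigma> else 0) \<le> 4 * A / real (Suc n) * ?G"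
  proof (cases "rn n \<le> ?M")
    case True
    have "K x y * (4 * ?m * (?M / Rn n) powr \<sigma>) = 4 * Rn n powr - \<sigma> * (K x y * (?m * ?M powr \<sigma>))"
      using pos Rn[of n] by (simp add: powr_divide powr_minus_divide)
    also have "\<dots> \<le> 4 * Rn n powr - \<sigma> * (A * rn n powr - (1 - \<gamma> - p - \<sigma>) * ?G)"
      using True assms rn[of n] \<sigma> by (intro mult_left_mono K_min_max_le) auto
    also have "\<dots> = 4 * A * (Rn n powr - \<sigma> * rn n powr - q) * ?G"
      by (simp only: q_def[symmetric] mult_ac)
    finally show ?thesis using True by (simp add: rn_Rn)
  next
    case False
    then show ?thesis using G A_pos by simp
  qed
  have "K x y * incr (rn n) (Rn n) x y
      \<le> K x y * (- (cutoff (rn n) (Rn n) (l1norm x + l1norm y) * (conc x + conc y - conc (x + y)))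
        + (if rn n \<le> ?M then 4 * ?m * (?M / Rn n) powr \<sigma> else 0))"
    using assms rn[of n] Rn[of n] \<sigma> K_nonneg by (intro mult_left_mono testfn_increment_le) auto
  also have "\<dots> = K x y * (if rn n \<le> ?M then 4 * ?m * (?M / Rn n) powr \<sigma> else 0)
      - cutoff (rn n) (Rn n) (l1norm x + l1norm y) * (K x y * (conc x + conc y - conc (x + y)))"
    by (simp only: ring_distribs mult_minus_right) (simp only: mult_ac)
  finally show ?thesis using err by linarith
qed

section \<open>Weighted moments and the truncated collision integral\<close>

lemma wt_measurable: "t \<ge> 0 \<Longrightarrow> wt \<in> borel_measurable (f t)"
proof -
  assume "t \<ge> 0"
  then have [measurable]: "l1norm \<in> borel_measurable (f t)"
    using integrable_l1norm by auto
  show ?thesis unfolding weight_def by measurable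
qed

lemma wt_moment:
  assumes "T > 1"
  obtains W where "0 \<le> W" "\<And>t. t \<in> {1..T} \<Longrightarrow> integrable (f t) wt"
    "\<And>t. t \<in> {1..T} \<Longrightarrow> (\<integral>x. wt x \<partial>f t) \<le> W"
proof -
  define S where "S = (SUP t\<in>{1/T..T}.
         (\<integral>\<^sup>+x\<in>{x. l1norm x \<ge> 1}. ennreal (l1norm x powr (\<gamma> + p)) \<partial>f t) +
         (\<integral>\<^sup>+x\<in>{x. l1norm x \<le> 1}. ennreal (l1norm x powr (1 - p)) \<partial>f t))"
  have S: "S < \<infinity>"
    using solution assms unfolding weak_solution_def S_def by blast
  have bound: "(\<integral>\<^sup>+x. ennreal (wt x) \<partial>f t) \<le> S + ennreal m0" if t: "t \<in> {1..T}" for t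
  proof -
    have t0: "t \<ge> 0" using t by simp
    have [measurable]: "l1norm \<in> borel_measurable (f t)"
      using integrable_l1norm[OF t0] by auto
    have "(\<integral>\<^sup>+x. ennreal (wt x) \<partial>f t)
        = (\<integral>\<^sup>+x. ennreal (l1norm x powr (1 - p)) * indicator {x. l1norm x \<le> 1} x + ennreal (l1norm x) \<partial>f t)"
      by (intro nn_integral_cong) (auto simp: weight_def indicator_def l1norm_nonneg)
    also have "\<dots> = (\<integral>\<^sup>+x\<in>{x. l1norm x \<le> 1}. ennreal (l1norm x powr (1 - p)) \<partial>f t) + (\<integral>\<^sup>+x. ennreal (l1norm x) \<partial>f t)"
    proof (rule nn_integral_add)
      have "(\<lambda>x. ennreal (if l1norm x \<le> 1 then l1norm x powr (1 - p) else 0)) \<in> borel_measurable (f t)"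
        by measurable
      then show "(\<lambda>x. ennreal (l1norm x powr (1 - p)) * indicator {x. l1norm x \<le> 1} x) \<in> borel_measurable (f t)"
        by (rule measurable_cong[THEN iffD1, rotated]) (auto simp: indicator_def)
    qed simp
    also have "(\<integral>\<^sup>+x. ennreal (l1norm x) \<partial>f t) = ennreal m0"
      using nn_integral_eq_integral[OF integrable_l1norm[OF t0]] integral_l1norm[OF t0]
      by (simp add: l1norm_nonneg)
    also have "(\<integral>\<^sup>+x\<in>{x. l1norm x \<le> 1}. ennreal (l1norm x powr (1 - p)) \<partial>f t) \<le> S"
    proof -
      have "t \<in> {1/T..T}" using t assms by (auto intro: order_trans[of _ 1])
      then have "(\<integral>\<^sup>+x\<in>{x. l1norm x \<ge> 1}. ennreal (l1norm x powr (\<gamma> + p)) \<partial>f t) +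
         (\<integral>\<^sup>+x\<in>{x. l1norm x \<le> 1}. ennreal (l1norm x powr (1 - p)) \<partial>f t) \<le> S"
        unfolding S_def by (rule SUP_upper)
      then show ?thesis by (rule order_trans[rotated]) simp
    qed
    finally show ?thesis by (simp add: add_right_mono)
  qed
  have fin: "S + ennreal m0 < \<infinity>" using S by simp
  show thesis
  proof
    show "0 \<le> enn2real (S + ennreal m0)" by simp
    fix t assume t: "t \<in> {1..T}"
    then have t0: "t \<ge> 0" by simp
    show int: "integrable (f t) wt"
      using wt_measurable[OF t0] order_le_less_trans[OF bound[OF t] fin]
      by (intro integrableI_nonneg) (auto simp: wt_nonneg)
    have "ennreal (\<integral>x. wt x \<partial>f t) \<le> S + ennreal m0"
      using bound[OF t] nn_integral_eq_integral[OF int] by (simp add: wt_nonneg)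
    then show "(\<integral>x. wt x \<partial>f t) \<le> enn2real (S + ennreal m0)"
      using enn2real_mono[of "ennreal (\<integral>x. wt x \<partial>f t)" "S + ennreal m0"] fin
      by (simp add: wt_nonneg)
  qed
qed

lemma integrable_wt: "t \<ge> 1 \<Longrightarrow> integrable (f t) wt"
  by (rule wt_moment[of "t + 1"]) auto

text \<open>Twice the formal time derivative of the integral of \<open>testfn r R\<close>: the
  factor 1/2 of the weak formulation is left out.\<close>

definition rate :: "real \<Rightarrow> real \<Rightarrow> real \<Rightarrow> real" where
  "rate r R t = (\<integral>x. (\<integral>y. K x y * incr r R x y \<partial>f t) \<partial>f t)"

lemma continuous_on_incr:
  assumes "0 < r" "0 < R"
  shows "continuous_on (Rstar \<times> Rstar) (\<lambda>z. K (fst z) (snd z) * incr r R (fst z) (snd z))"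
proof -
  have tf: "continuous_on (Rstar \<times> Rstar) (\<lambda>z. testfn r R (h z))"
    if "continuous_on (Rstar \<times> Rstar) h" "h ` (Rstar \<times> Rstar) \<subseteq> Rstar" for h :: "(real ^ 'n) \<times> (real ^ 'n) \<Rightarrow> real ^ 'n"
    using continuous_on_compose2[OF continuous_on_testfn[OF assms] that] .
  have "continuous_on (Rstar \<times> Rstar) (\<lambda>z. K (fst z) (snd z))"
    using K_cont by (simp add: case_prod_unfold)
  then show ?thesis
    by (intro continuous_intros tf) (auto intro: Rstar_add)
qed

context
  fixes r R :: real
  assumes r: "0 < r" "r \<le> 1" and R: "0 < R"
begin

abbreviation (input) "Cinc \<equiv> (8 + 4 * R / r) * (A * (r / 2) powr - (1 - \<gamma> - p))"

lemma incr_measurable: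
  "sets M = sets orthant \<Longrightarrow> (\<lambda>(x, y). K x y * incr r R x y) \<in> borel_measurable (M \<Otimes>\<^sub>M M)"
  using borel_measurable_orthant_pair[OF _ _ continuous_on_incr[OF r(1) R]]
  by (simp add: case_prod_unfold)

lemma incr_integrable:
  assumes "t \<ge> 1"
  shows "x \<in> Rstar \<Longrightarrow> integrable (f t) (\<lambda>y. K x y * incr r R x y)"
    and "integrable (f t) (\<lambda>x. \<integral>y. K x y * incr r R x y \<partial>f t)"
    and "\<bar>rate r R t\<bar> \<le> 2 * Cinc * ((\<integral>x. wt x \<partial>f t) * m0)"
proof -
  have t0: "t \<ge> 0" using assms by simp
  have C: "0 \<le> Cinc" using r R A_pos by simp
  note D = double_integral_dominated[OF f_sigma_finite[OF t0] incr_measurable[OF f_sets[OF t0]]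
      integrable_wt[OF assms] integrable_l1norm[OF t0] C]
  have bound: "\<bar>K x y * incr r R x y\<bar> \<le> Cinc * (wt x * l1norm y + l1norm x * wt y)"
    if "x \<in> space (f t)" "y \<in> space (f t)" for x y
    using that K_incr_abs[OF r R] by (simp add: f_space[OF t0])
  show "x \<in> Rstar \<Longrightarrow> integrable (f t) (\<lambda>y. K x y * incr r R x y)"
    using D(2)[OF bound] by (simp add: f_space[OF t0])
  show "integrable (f t) (\<lambda>x. \<integral>y. K x y * incr r R x y \<partial>f t)"
    using D(3)[OF bound] .
  show "\<bar>rate r R t\<bar> \<le> 2 * Cinc * ((\<integral>x. wt x \<partial>f t) * m0)"
    using D(5)[OF bound] by (simp add: rate_def integral_l1norm[OF t0])
qed

text \<open>The measures \<open>f t\<close> may be infinite, so the integral is rewritten against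
  \<open>?nu t\<close>, a Markov kernel in time. The product of this kernel with itself is again a
  kernel, and integrals against a kernel are measurable. The factors \<open>m0 / l1norm\<close> in
  \<open>k\<close> undo the densities.\<close>

lemma rate_measurable: "rate r R \<in> borel_measurable (restrict_space borel {1..})"
proof -
  let ?nu = "\<lambda>t. density (f t) (\<lambda>x. ennreal (l1norm x / m0))"
  define k where "k x y = K x y * incr r R x y * (m0 / l1norm x) * (m0 / l1norm y)" for x y
  have nu: "?nu \<in> measurable (restrict_space borel {1..}) (subprob_algebra orthant)"
    by (rule measurable_restrict_mono[OF measurable_mass_distribution[OF continuous_weak_star m0_pos mass]]) auto
  have "continuous_on (Rstar \<times> Rstar) (\<lambda>z. K (fst z) (snd z) * incr r R (fst z) (snd z)
      * (m0 / l1norm (fst z)) * (m0 / l1norm (snd z)))"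
    by (intro continuous_intros continuous_on_incr r R) (auto dest: l1norm_pos)
  then have kmeas: "case_prod k \<in> borel_measurable (M \<Otimes>\<^sub>M M)" if "sets M = sets orthant" for M
    using borel_measurable_orthant_pair[OF that that] by (simp add: k_def case_prod_unfold)
  have "(\<lambda>t. ?nu t \<Otimes>\<^sub>M ?nu t) \<in> measurable (restrict_space borel {1..}) (subprob_algebra (orthant \<Otimes>\<^sub>M orthant))"
    by (rule measurable_pair_measure[OF nu nu])
  then have meas: "(\<lambda>t. \<integral>z. case_prod k z \<partial>(?nu t \<Otimes>\<^sub>M ?nu t)) \<in> borel_measurable (restrict_space borel {1..})"
    by (rule measurable_compose[OF _ integral_measurable_subprob_algebra]) (simp add: kmeas)
  have "rate r R t = (\<integral>z. case_prod k z \<partial>(?nu t \<Otimes>\<^sub>M ?nu t))" if "t \<ge> 1" for t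
  proof -
    have t0: "t \<ge> 0" using that by simp
    note sp = f_space[OF t0]
    have l1 [measurable]: "l1norm \<in> borel_measurable (f t)" and wt [measurable]: "wt \<in> borel_measurable (f t)"
      using integrable_l1norm[OF t0] wt_measurable[OF t0] by auto
    have snu: "sets (?nu t) = sets orthant" using f_sets[OF t0] by simp
    have pos: "AE x in f t. 0 \<le> l1norm x / m0" using m0_pos by (simp add: l1norm_nonneg)
    have sub: "subprob_space (?nu t)"
      using measurable_space[OF nu, of t] that by (simp add: space_restrict_space space_subprob_algebra)
    interpret nu: subprob_space "?nu t" by fact
    have sf: "sigma_finite_measure (?nu t)" by unfold_locales
    \<comment> \<open>After the change of measure the dominating pair \<open>wt\<close>,
      \<open>l1norm\<close> turns into \<open>wt / l1norm\<close> and the constant 1.\<close>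
    have i1: "integrable (?nu t) (\<lambda>x. wt x / l1norm x)"
    proof (subst integrable_density[OF _ _ pos])
      have "integrable (f t) (\<lambda>x. wt x / m0)" using integrable_wt[OF that] by simp
      then show "integrable (f t) (\<lambda>x. (l1norm x / m0) *\<^sub>R (wt x / l1norm x))"
        by (rule Bochner_Integration.integrable_cong[THEN iffD1, OF refl, rotated])
           (use l1norm_pos in \<open>auto simp: sp less_imp_neq dest!: l1norm_pos\<close>)
    qed measurable
    have i2: "integrable (?nu t) (\<lambda>x. 1)" by simp
    have "Cinc * m0\<^sup>2 \<ge> 0" using r R A_pos by simp
    have bound: "\<bar>k x y\<bar> \<le> Cinc * m0\<^sup>2 * (wt x / l1norm x * 1 + 1 * (wt y / l1norm y))"
      if "x \<in> space (?nu t)" "y \<in> space (?nu t)" for x y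
    proof -
      have xy: "x \<in> Rstar" "y \<in> Rstar" using that by (auto simp: sp)
      have L: "0 < l1norm x" "0 < l1norm y" using xy by (auto intro: l1norm_pos)
      have "\<bar>k x y\<bar> = \<bar>K x y * incr r R x y\<bar> * ((m0 / l1norm x) * (m0 / l1norm y))"
        using L m0_pos by (simp add: k_def abs_mult)
      also have "\<dots> \<le> Cinc * (wt x * l1norm y + l1norm x * wt y) * ((m0 / l1norm x) * (m0 / l1norm y))"
        using L m0_pos by (intro mult_right_mono K_incr_abs[OF r R xy]) auto
      also have "(wt x * l1norm y + l1norm x * wt y) * ((m0 / l1norm x) * (m0 / l1norm y))
          = m0\<^sup>2 * (wt x / l1norm x * 1 + 1 * (wt y / l1norm y))"
        using L by (simp add: field_simps power2_eq_square)
      then have "Cinc * (wt x * l1norm y + l1norm x * wt y) * ((m0 / l1norm x) * (m0 / l1norm y))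
          = Cinc * m0\<^sup>2 * (wt x / l1norm x * 1 + 1 * (wt y / l1norm y))"
        by (simp only: mult.assoc)
      finally show ?thesis .
    qed
    note D = double_integral_dominated[OF sf kmeas[OF snu] i1 i2 \<open>Cinc * m0\<^sup>2 \<ge> 0\<close> bound]
    have inner: "(\<integral>y. k x y \<partial>?nu t) = (m0 / l1norm x) * (\<integral>y. K x y * incr r R x y \<partial>f t)"
      if "x \<in> space (f t)" for x
    proof -
      have kx: "k x \<in> borel_measurable (f t)"
        using measurable_compose[OF measurable_Pair1' kmeas[OF f_sets[OF t0]]] that by auto
      have "(\<integral>y. k x y \<partial>?nu t) = (\<integral>y. (l1norm y / m0) *\<^sub>R k x y \<partial>f t)"
        by (rule integral_density[OF kx _ pos]) measurable
      also have "\<dots> = (\<integral>y. (m0 / l1norm x) * (K x y * incr r R x y) \<partial>f t)"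
        using m0_pos by (intro Bochner_Integration.integral_cong)
          (auto simp: k_def sp less_imp_neq dest!: l1norm_pos)
      finally show ?thesis by simp
    qed
    have "(\<integral>z. case_prod k z \<partial>(?nu t \<Otimes>\<^sub>M ?nu t)) = (\<integral>x. (\<integral>y. k x y \<partial>?nu t) \<partial>?nu t)"
      using D(4) by simp
    also have "\<dots> = (\<integral>x. (l1norm x / m0) *\<^sub>R (\<integral>y. k x y \<partial>?nu t) \<partial>f t)"
    proof (rule integral_density[OF _ _ pos])
      show "(\<lambda>x. \<integral>y. k x y \<partial>?nu t) \<in> borel_measurable (f t)"
        using borel_measurable_integrable[OF D(3)] by simp
    qed measurable
    also have "\<dots> = (\<integral>x. (l1norm x / m0) *\<^sub>R ((m0 / l1norm x) * (\<integral>y. K x y * incr r R x y \<partial>f t)) \<partial>f t)"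
      by (intro Bochner_Integration.integral_cong refl) (simp add: inner)
    also have "\<dots> = rate r R t"
      unfolding rate_def using m0_pos
      by (intro Bochner_Integration.integral_cong) (auto simp: sp less_imp_neq dest!: l1norm_pos)
    finally show ?thesis by simp
  qed
  then show ?thesis
    using meas by (subst measurable_cong[where g = "\<lambda>t. \<integral>z. case_prod k z \<partial>(?nu t \<Otimes>\<^sub>M ?nu t)"])
      (auto simp: space_restrict_space)
qed

text \<open>Since \<open>rate\<close> is only known to be measurable in time, the derivative is
  taken in the distributional sense: the weak formulation is tested with \<open>testfn\<close> times
  a plateau, and \<open>distributional_derivative_bound\<close> recovers the end values.\<close>

lemma testfn_integral_growth:
  assumes t: "1 \<le> t1" "t1 < t2" and B: "\<And>t. t \<in> {t1..t2} \<Longrightarrow> rate r R t \<le> B"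
  shows "(\<integral>x. testfn r R x \<partial>f t2) - (\<integral>x. testfn r R x \<partial>f t1) \<le> B / 2 * (t2 - t1)"
proof (rule distributional_derivative_bound[OF t(2)])
  let ?F = "\<lambda>t. \<integral>x. testfn r R x \<partial>f t"
  have contF: "continuous_on {0..} ?F"
    by (intro continuous_pairing testfn_Cc r R)
  then show "continuous_on {t1..t2} ?F"
    by (rule continuous_on_subset) (use t in auto)
  fix e :: real assume e: "e > 0" "t1 + e \<le> t2"
  let ?\<phi> = "\<lambda>z :: (real ^ 'n) \<times> real. testfn r R (fst z) * plateau t1 t2 e (snd z)"
  have "?\<phi> \<in> Cc1 (Rstar \<times> {0<..})"
    using r R t e by (intro testfn_plateau_Cc1) auto
  then have weak: "0 = (LBINT t:{0<..}. (\<integral>x. deriv (\<lambda>s. ?\<phi> (x, s)) t \<partial>f t)) +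
      1/2 * (LBINT t:{0<..}. (\<integral>x. (\<integral>y. K x y * (?\<phi> (x + y, t) - ?\<phi> (x, t) - ?\<phi> (y, t)) \<partial>f t) \<partial>f t))"
    by (rule solution[unfolded weak_solution_def, THEN conjunct2, THEN conjunct2, THEN conjunct2,
          THEN conjunct2, THEN conjunct2, THEN conjunct2, THEN bspec])
  have d: "(\<integral>x. deriv (\<lambda>s. ?\<phi> (x, s)) t \<partial>f t) = plateau' t1 t2 e t * ?F t" for t
  proof -
    have "deriv (\<lambda>s. ?\<phi> (x, s)) t = plateau' t1 t2 e t * testfn r R x" for x
      by (rule DERIV_imp_deriv) (use e in \<open>auto intro!: derivative_eq_intros plateau_deriv\<close>)
    then show ?thesis by simp
  qed
  have k: "(\<integral>x. (\<integral>y. K x y * (?\<phi> (x + y, t) - ?\<phi> (x, t) - ?\<phi> (y, t)) \<partial>f t) \<partial>f t)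
      = plateau t1 t2 e t * rate r R t" for t
  proof -
    have "K x y * (?\<phi> (x + y, t) - ?\<phi> (x, t) - ?\<phi> (y, t)) = plateau t1 t2 e t * (K x y * incr r R x y)" for x y
      by (simp add: algebra_simps)
    then show ?thesis by (simp only: rate_def integral_mult_right_zero)
  qed
  have supp: "(LBINT t:{0<..}. g t) = (LBINT t:{t1..t2}. g t)"
    if "\<And>t. t \<notin> {t1..t2} \<Longrightarrow> g t = 0" for g :: "real \<Rightarrow> real"
    unfolding set_lebesgue_integral_def using that t
    by (intro Bochner_Integration.integral_cong) (auto simp: indicator_def)
  have i1: "set_integrable lborel {t1..t2} (\<lambda>t. plateau' t1 t2 e t * ?F t)"
    using e t by (intro borel_integrable_atLeastAtMost' continuous_intros continuous_on_plateau'
        continuous_on_subset[OF contF]) auto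
  obtain W where W: "\<And>t. t \<in> {1..t2} \<Longrightarrow> (\<integral>x. wt x \<partial>f t) \<le> W"
    by (rule wt_moment[of t2]) (use t in auto)
  \<comment> \<open>The integral of a function that is not integrable is 0 by convention, so the
    comparison with \<open>B\<close> requires integrability. It follows from measurability and the
    bound through \<open>W\<close>.\<close>
  have i2: "set_integrable lborel {t1..t2} (\<lambda>t. plateau t1 t2 e t * rate r R t)"
    unfolding set_integrable_def
  proof (rule integrableI_bounded_set[where A = "{t1..t2}"])
    have "rate r R \<in> borel_measurable (restrict_space borel {t1..t2})"
      by (rule measurable_restrict_mono[OF rate_measurable]) (use t in auto)
    moreover have "plateau t1 t2 e \<in> borel_measurable (restrict_space borel {t1..t2})"
      by (intro borel_measurable_continuous_on_restrict continuous_on_plateau e)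
    ultimately have "(\<lambda>t. plateau t1 t2 e t * rate r R t) \<in> borel_measurable (restrict_space borel {t1..t2})"
      by (rule borel_measurable_times[rotated])
    then show "(\<lambda>t. indicator {t1..t2} t *\<^sub>R (plateau t1 t2 e t * rate r R t)) \<in> borel_measurable lborel"
      by (simp add: borel_measurable_restrict_space_iff)
    have "norm (plateau t1 t2 e t * rate r R t) \<le> 2 * Cinc * (W * m0)" if tt: "t \<in> {t1..t2}" for t
    proof -
      have "\<bar>rate r R t\<bar> \<le> 2 * Cinc * ((\<integral>x. wt x \<partial>f t) * m0)"
        using tt t by (intro incr_integrable(3)) auto
      also have "\<dots> \<le> 2 * Cinc * (W * m0)"
        using W[of t] tt t m0_pos r R A_pos by (intro mult_left_mono mult_right_mono) auto
      finally have "\<bar>plateau t1 t2 e t\<bar> * \<bar>rate r R t\<bar> \<le> 1 * (2 * Cinc * (W * m0))"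
        using plateau_range[OF e] by (intro mult_mono) auto
      then show ?thesis by (simp add: abs_mult)
    qed
    then show "AE t\<in>{t1..t2} in lborel. norm (indicator {t1..t2} t *\<^sub>R (plateau t1 t2 e t * rate r R t)) \<le> 2 * Cinc * (W * m0)"
      by auto
  qed (use t in auto)
  have i3: "set_integrable lborel {t1..t2} (\<lambda>t. B * plateau t1 t2 e t)"
    using e by (intro borel_integrable_atLeastAtMost' continuous_intros continuous_on_plateau) auto
  have le: "(LBINT t:{t1..t2}. plateau t1 t2 e t * rate r R t) \<le> (LBINT t:{t1..t2}. B * plateau t1 t2 e t)"
    using plateau_range[OF e] B
    by (intro set_integral_mono i2 i3) (simp add: mult.commute[of B] mult_left_mono)
  have "0 = (LBINT t:{t1..t2}. plateau' t1 t2 e t * ?F t) + 1/2 * (LBINT t:{t1..t2}. plateau t1 t2 e t * rate r R t)"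
  proof -
    have "(LBINT t:{0<..}. plateau' t1 t2 e t * ?F t) = (LBINT t:{t1..t2}. plateau' t1 t2 e t * ?F t)"
      by (rule supp) (simp add: plateau_eq_0[OF e])
    moreover have "(LBINT t:{0<..}. plateau t1 t2 e t * rate r R t) = (LBINT t:{t1..t2}. plateau t1 t2 e t * rate r R t)"
      by (rule supp) (simp add: plateau_eq_0[OF e])
    ultimately show ?thesis using weak unfolding d k by (simp only:)
  qed
  also have "\<dots> \<le> (LBINT t:{t1..t2}. plateau' t1 t2 e t * ?F t) + 1/2 * (LBINT t:{t1..t2}. B * plateau t1 t2 e t)"
    using le by simp
  also have "\<dots> = integral {t1..t2} (\<lambda>t. plateau' t1 t2 e t * ?F t) + 1/2 * integral {t1..t2} (\<lambda>t. B * plateau t1 t2 e t)"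
    using set_borel_integral_eq_integral(2)[OF i1] set_borel_integral_eq_integral(2)[OF i3] by simp
  finally show "0 \<le> integral {t1..t2} (\<lambda>t. plateau' t1 t2 e t * ?F t) + B / 2 * integral {t1..t2} (plateau t1 t2 e)"
    by simp
qed

end

end

section \<open>Decay of the Lyapunov functional\<close>

lemma continuous_on_conc: "continuous_on Rstar (conc :: real ^ 'n \<Rightarrow> real)"
  unfolding conc_def by (intro continuous_intros) (auto dest: l1norm_pos)

text \<open>Each term is a function of \<open>x\<close> times a function of \<open>y\<close>, or an
  inner product, so the double integral is explicit in the mass, the first moment and the integral
  of \<open>conc\<close>.\<close>

lemma l1norm_mult_ang2:
  assumes "x \<in> Rstar" "y \<in> Rstar"
  shows "l1norm x * l1norm y * ang2 x y = conc x * l1norm y + l1norm x * conc y - 2 * (x \<bullet> y)"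
  using assms[THEN l1norm_pos] by (simp add: ang2_def conc_def field_simps power2_eq_square)

lemma cutoff_tendsto_1:
  assumes "r \<longlonglongrightarrow> 0" "filterlim R at_top sequentially" "0 < s"
  shows "(\<lambda>n. cutoff (r n) (R n) s) \<longlonglongrightarrow> 1"
proof -
  have "(\<lambda>n. s / R n) \<longlonglongrightarrow> 0"
    by (rule real_tendsto_divide_at_top[OF tendsto_const assms(2)])
  then have "(\<lambda>n. cutoff (r n) (R n) s) \<longlonglongrightarrow> (max 0 (1 - 0 / s))\<^sup>2 * (max 0 (1 - 0))\<^sup>2"
    unfolding cutoff_def cutlow_def cuthigh_def pos2_def
    by (intro tendsto_intros assms) (use assms in auto)
  then show ?thesis by simp
qed

text \<open>A factor 2 inside its threshold, each cutoff is at least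
  \<open>pos2 (1 / 2) = 1 / 4\<close>.\<close>

lemma cutoff_ge:
  assumes "0 < r" "2 * r \<le> s" "0 < R" "2 * s \<le> R"
  shows "1 / 16 \<le> cutoff r R s"
proof -
  have "pos2 (1 / 2) \<le> cutlow r s" "pos2 (1 / 2) \<le> cuthigh R s"
    unfolding cutlow_def cuthigh_def using assms by (auto intro!: pos2_mono simp: field_simps)
  then have "pos2 (1 / 2) * pos2 (1 / 2) \<le> cutoff r R s"
    unfolding cutoff_def by (intro mult_mono) (auto simp: pos2_nonneg intro: order_trans[OF pos2_nonneg])
  then show ?thesis by (simp add: pos2_def power2_eq_square)
qed

text \<open>\<open>Phi p z\<close> is the power \<open>- p\<close> of \<open>z * (1 - z)\<close>,
  which lies between \<open>b\<close> and 1. The minimum covers both signs of \<open>p\<close>: the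
  value at 1 is the lower bound for \<open>0 \<le> p\<close>, the value at \<open>b\<close> for
  \<open>p < 0\<close>.\<close>

lemma Phi_lower:
  assumes "0 < z" "z < 1" "0 < b" "b \<le> z * (1 - z)"
  shows "min 1 (b powr - p) \<le> Phi p z"
proof -
  have eq: "Phi p z = (z * (1 - z)) powr - p"
    using assms by (simp add: Phi_def powr_mult)
  have le1: "z * (1 - z) \<le> 1" using assms by (intro mult_le_one) auto
  show ?thesis
  proof (cases "0 \<le> p")
    case True
    have "1 powr - p \<le> (z * (1 - z)) powr - p"
      using assms le1 True by (intro powr_mono2') auto
    then show ?thesis by (simp add: eq)
  next
    case False
    then have "b powr - p \<le> (z * (1 - z)) powr - p"
      using assms by (intro powr_mono2) auto
    then show ?thesis by (simp add: eq)
  qed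
qed

context coagulation
begin

definition mom :: "real ^ 'n" where
  "mom = (\<integral>x. x \<partial>f0)"

lemma first_moment: "t > 0 \<Longrightarrow> has_bochner_integral (f t) (\<lambda>x. x) mom"
  using solution by (simp add: weak_solution_def mom_def)

lemma integrable_inner: "t > 0 \<Longrightarrow> integrable (f t) (\<lambda>x. x \<bullet> v)"
  and integral_inner: "t > 0 \<Longrightarrow> (\<integral>x. x \<bullet> v \<partial>f t) = mom \<bullet> v"
  using first_moment[of t] by (auto simp: has_bochner_integral_iff)

lemma integrable_conc: "t \<ge> 0 \<Longrightarrow> integrable (f t) conc"
  by (rule Bochner_Integration.integrable_bound[OF integrable_l1norm])
     (auto intro!: AE_I2 f_measurable continuous_on_conc simp: f_space conc_nonneg l1norm_nonneg conc_le_l1norm)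

text \<open>The functional \<open>E\<close> in the form of a variance formula. The conserved
  quantities are split off, so that time enters only through the integral of
  \<open>conc\<close>.\<close>

definition spread :: "real \<Rightarrow> real" where
  "spread t = (\<integral>x. conc x \<partial>f t) - (mom \<bullet> mom) / m0"

lemma spread_integrand:
  assumes "x \<in> Rstar"
  shows "l1norm x * (norm ((1 / l1norm x) *\<^sub>R x - v))\<^sup>2 = conc x - 2 * (x \<bullet> v) + l1norm x * (v \<bullet> v)"
  using l1norm_pos[OF assms] unfolding power2_norm_eq_inner
  by (simp add: inner_diff_left inner_diff_right inner_commute conc_def field_simps)

lemma spread_eq:
  assumes "t > 0"
  shows "integrable (f t) (\<lambda>x. l1norm x * (norm ((1 / l1norm x) *\<^sub>R x - (1 / m0) *\<^sub>R mom))\<^sup>2)" (is ?int)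
    and "(\<integral>x. l1norm x * (norm ((1 / l1norm x) *\<^sub>R x - (1 / m0) *\<^sub>R mom))\<^sup>2 \<partial>f t) = spread t" (is ?eq)
proof -
  let ?v = "(1 / m0) *\<^sub>R mom"
  have t0: "t \<ge> 0" using assms by simp
  have ints: "integrable (f t) (\<lambda>x. x \<bullet> ?v)" "integrable (f t) conc" "integrable (f t) l1norm"
    using integrable_inner[OF assms] integrable_conc[OF t0] integrable_l1norm[OF t0] by blast+
  then have "has_bochner_integral (f t) (\<lambda>x. conc x - 2 * (x \<bullet> ?v) + l1norm x * (?v \<bullet> ?v))
      ((\<integral>x. conc x \<partial>f t) - 2 * (\<integral>x. x \<bullet> ?v \<partial>f t) + (\<integral>x. l1norm x \<partial>f t) * (?v \<bullet> ?v))"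
    by (intro has_bochner_integral_add has_bochner_integral_diff has_bochner_integral_mult_right
        has_bochner_integral_mult_left has_bochner_integral_integrable)
  moreover have "(\<integral>x. conc x \<partial>f t) - 2 * (\<integral>x. x \<bullet> ?v \<partial>f t) + (\<integral>x. l1norm x \<partial>f t) * (?v \<bullet> ?v) = spread t"
    using m0_pos unfolding integral_inner[OF assms] integral_l1norm[OF t0] by (simp add: spread_def field_simps)
  ultimately have "has_bochner_integral (f t)
      (\<lambda>x. l1norm x * (norm ((1 / l1norm x) *\<^sub>R x - ?v))\<^sup>2) (spread t)"
    by (subst has_bochner_integral_cong[OF refl _ refl]) (auto simp only: f_space[OF t0] spread_integrand)
  then show ?int ?eq by (simp_all only: has_bochner_integral_iff)
qed

lemma spread_nonneg: "t > 0 \<Longrightarrow> 0 \<le> spread t"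
  by (subst spread_eq(2)[symmetric]) (auto simp: l1norm_nonneg intro!: integral_nonneg_AE)

text \<open>Dominated convergence with majorant \<open>l1norm\<close>. The constant after
  \<open>spread t\<close> does not depend on \<open>t\<close> and drops out of differences between
  two times.\<close>

lemma testfn_integral_tendsto:
  assumes "t \<ge> 0"
  shows "(\<lambda>n. \<integral>x. testfn (rn n) (Rn n) x \<partial>f t) \<longlonglongrightarrow> spread t + (mom \<bullet> mom) / m0 - m0"
proof -
  have "(\<lambda>n. \<integral>x. testfn (rn n) (Rn n) x \<partial>f t) \<longlonglongrightarrow> (\<integral>x. conc x - l1norm x \<partial>f t)"
  proof (rule integral_dominated_convergence[where w = l1norm])
    show "(\<lambda>x. conc x - l1norm x) \<in> borel_measurable (f t)"
      by (intro f_measurable assms continuous_intros continuous_on_conc)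
    show "testfn (rn n) (Rn n) \<in> borel_measurable (f t)" for n
      by (intro f_measurable assms continuous_on_testfn rn Rn)
    show "AE x in f t. (\<lambda>n. testfn (rn n) (Rn n) x) \<longlonglongrightarrow> conc x - l1norm x"
    proof (rule AE_I2)
      fix x assume "x \<in> space (f t)"
      then have "0 < l1norm x" using f_space[OF assms] by (simp add: l1norm_pos)
      then have "(\<lambda>n. testfn (rn n) (Rn n) x) \<longlonglongrightarrow> (conc x - l1norm x) * 1"
        unfolding testfn_def by (intro tendsto_intros cutoff_tendsto_1 rn_lim Rn_lim)
      then show "(\<lambda>n. testfn (rn n) (Rn n) x) \<longlonglongrightarrow> conc x - l1norm x" by simp
    qed
    show "AE x in f t. norm (testfn (rn n) (Rn n) x) \<le> l1norm x" for n
      using testfn_abs_le[OF rn(1) Rn] by (auto intro!: AE_I2 simp: f_space[OF assms])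
  qed (rule integrable_l1norm[OF assms])
  moreover have "(\<integral>x. conc x - l1norm x \<partial>f t) = spread t + (mom \<bullet> mom) / m0 - m0"
    using integrable_l1norm[OF assms] integrable_conc[OF assms] integral_l1norm[OF assms]
    by (simp add: spread_def)
  ultimately show ?thesis by simp
qed

section \<open>Typical size and the mass outside the bulk\<close>

definition msize :: "real \<Rightarrow> real" where
  "msize t = t powr (1 / (1 - \<gamma>))"

lemma msize_ge_1: "t \<ge> 1 \<Longrightarrow> 1 \<le> msize t"
  unfolding msize_def using exponents by (intro ge_one_powr_ge_zero) auto

lemma msize_mono: "1 \<le> t \<Longrightarrow> t \<le> t' \<Longrightarrow> msize t \<le> msize t'"
  unfolding msize_def using exponents by (intro powr_mono2) auto

definition bulk :: "real \<Rightarrow> real \<Rightarrow> (real ^ 'n) set" where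
  "bulk \<epsilon> t = {x. \<epsilon> * msize t \<le> l1norm x \<and> l1norm x \<le> inverse \<epsilon> * msize t}"

definition tail_bound :: "real \<Rightarrow> real" where
  "tail_bound \<epsilon> = C0 * (\<epsilon> powr (1 - 1 / a) + \<epsilon> powr (a - 1))"

lemma moment_k:
  assumes "k \<in> {1/a..a}" "t \<ge> 1"
  shows "integrable (f t) (\<lambda>x. l1norm x powr k)"
    and "(\<integral>x. l1norm x powr k \<partial>f t) \<le> C0 * msize t powr (k - 1)"
proof -
  have t0: "t \<ge> 0" using assms by simp
  have [measurable]: "l1norm \<in> borel_measurable (f t)" using integrable_l1norm[OF t0] by auto
  show int: "integrable (f t) (\<lambda>x. l1norm x powr k)"
    using order_le_less_trans[OF moments[OF assms] ennreal_less_top]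
    by (intro integrableI_nonneg) auto
  have "ennreal (\<integral>x. l1norm x powr k \<partial>f t) \<le> ennreal (C0 * t powr ((k - 1) / (1 - \<gamma>)))"
    using moments[OF assms] nn_integral_eq_integral[OF int] by simp
  then show "(\<integral>x. l1norm x powr k \<partial>f t) \<le> C0 * msize t powr (k - 1)"
    using C0 by (simp add: msize_def powr_powr)
qed

text \<open>Below the bulk the moment of order \<open>1 / a\<close> is used, above it the moment of
  order \<open>a\<close>. The moment bounds scale like powers of \<open>msize t\<close>, which
  cancel exactly, so the estimate is uniform in time.\<close>

lemma tail:
  assumes "0 < \<epsilon>" "t \<ge> 1"
  shows "integrable (f t) (\<lambda>x. l1norm x * indicator (- bulk \<epsilon> t) x)" (is ?int)
    and "(\<integral>x. l1norm x * indicator (- bulk \<epsilon> t) x \<partial>f t) \<le> tail_bound \<epsilon>" (is ?le)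
proof -
  have t0: "t \<ge> 0" using assms by simp
  let ?s = "msize t"
  have s: "0 < ?s" using msize_ge_1[OF assms(2)] by linarith
  have [measurable]: "l1norm \<in> borel_measurable (f t)" using integrable_l1norm[OF t0] by auto
  have meas: "(\<lambda>x. l1norm x * indicator (- bulk \<epsilon> t) x) \<in> borel_measurable (f t)"
  proof -
    have "(\<lambda>x. if \<epsilon> * ?s \<le> l1norm x \<and> l1norm x \<le> inverse \<epsilon> * ?s then 0 else l1norm x) \<in> borel_measurable (f t)"
      by measurable
    then show ?thesis
      by (rule measurable_cong[THEN iffD1, rotated]) (auto simp: bulk_def indicator_def)
  qed
  show ?int
    by (rule Bochner_Integration.integrable_bound[OF integrable_l1norm[OF t0] meas])
       (auto simp: indicator_def)
  have k: "1 / a \<in> {1/a..a}" "a \<in> {1/a..a}"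
    using a by (auto simp: divide_le_eq intro: order_trans[of _ 1] less_1_mult less_imp_le)
  let ?A = "(\<epsilon> * ?s) powr (1 - 1 / a)" and ?B = "(?s / \<epsilon>) powr (1 - a)"
  have pw: "l1norm x * indicator (- bulk \<epsilon> t) x \<le> ?A * l1norm x powr (1 / a) + ?B * l1norm x powr a"
    if "x \<in> Rstar" for x
  proof -
    have L: "0 < l1norm x" by (rule l1norm_pos[OF that])
    consider "x \<in> bulk \<epsilon> t" | "l1norm x < \<epsilon> * ?s" | "l1norm x > ?s / \<epsilon>"
      by (force simp: bulk_def divide_inverse mult.commute)
    then show ?thesis
    proof cases
      case 1
      then show ?thesis by simp
    next
      case 2
      have "l1norm x = l1norm x powr (1 - 1 / a) * l1norm x powr (1 / a)"
        using L by (simp flip: powr_add)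
      also have "\<dots> \<le> ?A * l1norm x powr (1 / a)"
        using 2 L a by (intro mult_right_mono powr_mono2) auto
      finally show ?thesis by (auto simp: indicator_def l1norm_nonneg intro: add_increasing2)
    next
      case 3
      have "l1norm x = l1norm x powr (1 - a) * l1norm x powr a"
        using L by (simp flip: powr_add)
      also have "\<dots> \<le> ?B * l1norm x powr a"
        using 3 L a s assms by (intro mult_right_mono powr_mono2') auto
      finally show ?thesis by (auto simp: indicator_def l1norm_nonneg intro: add_increasing)
    qed
  qed
  have "(\<integral>x. l1norm x * indicator (- bulk \<epsilon> t) x \<partial>f t)
      \<le> (\<integral>x. ?A * l1norm x powr (1 / a) + ?B * l1norm x powr a \<partial>f t)"
    using pw moment_k(1)[OF k(1) assms(2)] moment_k(1)[OF k(2) assms(2)]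
    by (intro integral_mono \<open>?int\<close>) (auto simp: f_space[OF t0])
  also have "\<dots> = ?A * (\<integral>x. l1norm x powr (1 / a) \<partial>f t) + ?B * (\<integral>x. l1norm x powr a \<partial>f t)"
    using moment_k(1)[OF k(1) assms(2)] moment_k(1)[OF k(2) assms(2)] by simp
  also have "\<dots> \<le> ?A * (C0 * ?s powr (1 / a - 1)) + ?B * (C0 * ?s powr (a - 1))"
    using moment_k(2)[OF k(1) assms(2)] moment_k(2)[OF k(2) assms(2)]
    by (intro add_mono mult_left_mono) auto
  also have "\<dots> = C0 * (\<epsilon> powr (1 - 1 / a) * (?s powr (1 - 1 / a) * ?s powr (1 / a - 1))
      + \<epsilon> powr (a - 1) * (?s powr (1 - a) * ?s powr (a - 1)))"
  proof -
    have "?A = \<epsilon> powr (1 - 1 / a) * ?s powr (1 - 1 / a)" using s assms by (intro powr_mult)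
    moreover have "?B = \<epsilon> powr (a - 1) * ?s powr (1 - a)"
      using s assms powr_minus_divide[of \<epsilon> "1 - a"] by (simp add: powr_divide)
    ultimately show ?thesis by (simp add: algebra_simps)
  qed
  also have "\<dots> = tail_bound \<epsilon>"
    using s by (simp add: tail_bound_def flip: powr_add)
  finally show ?le .
qed

text \<open>\<open>1 / 16\<close> is the bound of \<open>cutoff_ge\<close>. In the bulk the sum of
  the sizes is at most \<open>2 / \<epsilon> * msize t\<close>, and the product of the two size
  fractions is at least \<open>\<epsilon>^2 / (2 / \<epsilon>)^2 = \<epsilon>^4 / 4\<close>.\<close>

definition diss :: "real \<Rightarrow> real" where
  "diss \<epsilon> = c1 / 16 * (2 / \<epsilon>) powr (\<gamma> - 1) * min 1 ((\<epsilon> ^ 4 / 4) powr - p)"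

lemma diss_pos: "0 < \<epsilon> \<Longrightarrow> 0 < diss \<epsilon>"
  using c by (simp add: diss_def)

text \<open>As soon as one point leaves the bulk, the penalty outweighs \<open>ang2 \<le> 2\<close>
  and the left side is nonpositive. The inequality therefore holds on all of \<open>Rstar\<close>,
  and the left side still splits into products when integrated. The conditions on \<open>n\<close>
  put the merged size of two bulk particles a factor 2 inside both cutoffs.\<close>

lemma dissipation_lower:
  assumes \<epsilon>: "0 < \<epsilon>" and t: "t \<ge> 1" and xy: "x \<in> Rstar" "y \<in> Rstar"
    and n: "rn n \<le> \<epsilon>" "4 * msize t / \<epsilon> \<le> Rn n"
  shows "diss \<epsilon> / t * (l1norm x * l1norm y * (ang2 x y - 2 * indicator (- bulk \<epsilon> t) x - 2 * indicator (- bulk \<epsilon> t) y))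
    \<le> cutoff (rn n) (Rn n) (l1norm x + l1norm y) * (K x y * (conc x + conc y - conc (x + y)))"
proof -
  let ?u = "l1norm x" and ?v = "l1norm y" and ?s = "msize t"
  let ?S = "?u + ?v"
  have pos: "0 < ?u" "0 < ?v" using xy by (auto intro: l1norm_pos)
  have s: "1 \<le> ?s" by (rule msize_ge_1[OF t])
  have rhs: "0 \<le> cutoff (rn n) (Rn n) ?S * (K x y * (conc x + conc y - conc (x + y)))"
    using cutoff_range(1)[OF rn(1) Rn] pos K_nonneg[OF xy] conc_add_bounds(1)[OF xy]
    by (intro mult_nonneg_nonneg) auto
  show ?thesis
  proof (cases "x \<in> bulk \<epsilon> t \<and> y \<in> bulk \<epsilon> t")
    case False
    then have "ang2 x y - 2 * indicator (- bulk \<epsilon> t) x - 2 * indicator (- bulk \<epsilon> t) y \<le> 0"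
      using ang2_le_2[OF xy] by (auto simp: indicator_def)
    then have "?u * ?v * (ang2 x y - 2 * indicator (- bulk \<epsilon> t) x - 2 * indicator (- bulk \<epsilon> t) y) \<le> 0"
      using pos by (intro mult_nonneg_nonpos) auto
    then have "diss \<epsilon> / t * (?u * ?v * (ang2 x y - 2 * indicator (- bulk \<epsilon> t) x - 2 * indicator (- bulk \<epsilon> t) y)) \<le> 0"
      using diss_pos[OF \<epsilon>] t
      by (intro mult_nonneg_nonpos[of "diss \<epsilon> / t"] divide_nonneg_nonneg) auto
    then show ?thesis using rhs by linarith
  next
    case True
    then have b: "\<epsilon> * ?s \<le> ?u" "?u \<le> ?s / \<epsilon>" "\<epsilon> * ?s \<le> ?v" "?v \<le> ?s / \<epsilon>"
      by (auto simp: bulk_def divide_inverse mult.commute)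
    have S: "2 * (\<epsilon> * ?s) \<le> ?S" "?S \<le> 2 / \<epsilon> * ?s" using b by auto
    have "\<epsilon> * 1 \<le> \<epsilon> * ?s" using \<epsilon> s by (intro mult_left_mono) auto
    then have cutoff: "1 / 16 \<le> cutoff (rn n) (Rn n) ?S"
      using S n by (intro cutoff_ge rn Rn) auto
    have "(2 / \<epsilon>) powr (\<gamma> - 1) * (1 / t) = (2 / \<epsilon> * ?s) powr (\<gamma> - 1)"
    proof -
      \<comment> \<open>The typical size is chosen for this exponent: its power
        \<open>\<gamma> - 1\<close> is exactly \<open>1 / t\<close>.\<close>
      have "(\<gamma> - 1) / (1 - \<gamma>) = - 1" using exponents by (simp add: field_simps)
      then have "?s powr (\<gamma> - 1) = t powr (- 1)" by (simp add: msize_def powr_powr)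
      also have "\<dots> = 1 / t" using t by (simp add: powr_minus_divide)
      finally show ?thesis using \<epsilon> s by (subst powr_mult) auto
    qed
    also have "\<dots> \<le> ?S powr (\<gamma> - 1)"
      using S pos exponents by (intro powr_mono2') auto
    finally have pw: "(2 / \<epsilon>) powr (\<gamma> - 1) * (1 / t) \<le> ?S powr (\<gamma> - 1)" .
    have Phi: "min 1 ((\<epsilon> ^ 4 / 4) powr - p) \<le> Phi p (?u / ?S)"
    proof (rule Phi_lower)
      show "0 < ?u / ?S" "?u / ?S < 1" "0 < \<epsilon> ^ 4 / 4" using pos \<epsilon> by auto
      have "\<epsilon> ^ 4 / 4 * ?S\<^sup>2 \<le> \<epsilon> ^ 4 / 4 * (2 / \<epsilon> * ?s)\<^sup>2"
        using S pos \<epsilon> by (intro mult_left_mono power_mono) auto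
      also have "\<dots> = (\<epsilon> * ?s) * (\<epsilon> * ?s)"
        using \<epsilon> by (simp add: field_simps power2_eq_square eval_nat_numeral)
      also have "\<dots> \<le> ?u * ?v" using b \<epsilon> s pos by (intro mult_mono) auto
      finally have "\<epsilon> ^ 4 / 4 \<le> ?u * ?v / ?S\<^sup>2" using pos by (simp add: pos_le_divide_eq)
      also have "\<dots> = ?u / ?S * (1 - ?u / ?S)"
      proof -
        have "1 - ?u / ?S = ?v / ?S" using pos by (simp add: field_simps)
        then show ?thesis by (simp add: power2_eq_square)
      qed
      finally show "\<epsilon> ^ 4 / 4 \<le> ?u / ?S * (1 - ?u / ?S)" .
    qed
    have "16 * diss \<epsilon> / t = c1 * ((2 / \<epsilon>) powr (\<gamma> - 1) * (1 / t)) * min 1 ((\<epsilon> ^ 4 / 4) powr - p)"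
      by (simp add: diss_def)
    also have "\<dots> \<le> c1 * ?S powr (\<gamma> - 1) * Phi p (?u / ?S)"
      using pw Phi c t by (intro mult_mono) (auto simp: Phi_def)
    also have "\<dots> = c1 * ?S powr \<gamma> * Phi p (?u / ?S) / ?S"
      using pos powr_diff[of ?S \<gamma> 1] by simp
    also have "\<dots> \<le> K x y / ?S" using pos by (intro divide_right_mono K_lower xy) auto
    finally have KS: "16 * diss \<epsilon> / t \<le> K x y / ?S" .
    have "diss \<epsilon> / t * (?u * ?v * ang2 x y) = 1 / 16 * ((16 * diss \<epsilon> / t) * (?u * ?v * ang2 x y))"
      by simp
    also have "\<dots> \<le> cutoff (rn n) (Rn n) ?S * (K x y / ?S * (?u * ?v * ang2 x y))"
      using cutoff KS pos ang2_nonneg[of x y] diss_pos[OF \<epsilon>] t K_nonneg[OF xy]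
      by (intro mult_mono[OF cutoff] mult_right_mono) (auto intro!: mult_nonneg_nonneg divide_nonneg_nonneg)
    finally show ?thesis using True by (simp add: conc_add[OF xy])
  qed
qed

text \<open>The majorant is a sum of products, so its double integral is exact: the
  \<open>ang2\<close> part gives \<open>2 * m0 * spread t\<close>, the two penalties together
  \<open>4 * m0\<close> times the mass outside the bulk. The choice \<open>\<beta> = 0\<close>
  yields monotonicity, \<open>\<beta> = diss \<epsilon> / t\<close> the decay.\<close>

lemma rate_le:
  assumes t: "t \<ge> 1" and "0 < \<epsilon>" "0 \<le> \<beta>"
    and bound: "\<And>x y. x \<in> Rstar \<Longrightarrow> y \<in> Rstar \<Longrightarrow>
      K x y * incr (rn n) (Rn n) x y \<le> \<alpha> * (wt x * l1norm y + l1norm x * wt y)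
        - \<beta> * (l1norm x * l1norm y * (ang2 x y - 2 * indicator (- bulk \<epsilon> t) x - 2 * indicator (- bulk \<epsilon> t) y))"
  shows "rate (rn n) (Rn n) t
    \<le> 2 * \<alpha> * m0 * (\<integral>x. wt x \<partial>f t) - 2 * \<beta> * m0 * (spread t - 2 * tail_bound \<epsilon>)"
proof -
  have t0: "t \<ge> 0" "t > 0" using t by auto
  let ?b = "\<lambda>x. l1norm x * indicator (- bulk \<epsilon> t) x"
  let ?W = "\<integral>x. wt x \<partial>f t" and ?U = "\<integral>x. conc x \<partial>f t" and ?T = "\<integral>x. ?b x \<partial>f t"
  define G where "G x y = \<alpha> * (wt x * l1norm y + l1norm x * wt y)
      - \<beta> * (conc x * l1norm y + l1norm x * conc y - 2 * (y \<bullet> x) - 2 * (?b x * l1norm y) - 2 * (l1norm x * ?b y))" for x y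
  define H where "H x = \<alpha> * (wt x * m0 + l1norm x * ?W)
      - \<beta> * (conc x * m0 + l1norm x * ?U - 2 * (x \<bullet> mom) - 2 * (?b x * m0) - 2 * (l1norm x * ?T))" for x
  have L: "has_bochner_integral (f t) l1norm m0" by (rule mass[OF t0(1)])
  have Wt: "has_bochner_integral (f t) wt ?W"
    using integrable_wt[OF t] by (simp add: has_bochner_integral_iff)
  have U: "has_bochner_integral (f t) conc ?U"
    using integrable_conc[OF t0(1)] by (simp add: has_bochner_integral_iff)
  have Tl: "has_bochner_integral (f t) ?b ?T"
    using tail(1)[OF \<open>0 < \<epsilon>\<close> t] by (simp add: has_bochner_integral_iff)
  have I: "has_bochner_integral (f t) (\<lambda>x. x \<bullet> v) (mom \<bullet> v)" for v
    using integrable_inner[OF t0(2)] integral_inner[OF t0(2)] by (simp add: has_bochner_integral_iff)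
  have G: "has_bochner_integral (f t) (G x) (H x)" for x
    unfolding G_def H_def inner_commute[of x mom]
    by (intro has_bochner_integral_diff has_bochner_integral_add has_bochner_integral_mult_right L Wt U Tl I)
  have HI: "has_bochner_integral (f t) H (\<alpha> * (?W * m0 + m0 * ?W)
      - \<beta> * (?U * m0 + m0 * ?U - 2 * (mom \<bullet> mom) - 2 * (?T * m0) - 2 * (m0 * ?T)))"
    unfolding H_def
    by (intro has_bochner_integral_diff has_bochner_integral_add has_bochner_integral_mult_right
        has_bochner_integral_mult_left L Wt U Tl I)
  have le: "K x y * incr (rn n) (Rn n) x y \<le> G x y" if "x \<in> Rstar" "y \<in> Rstar" for x y
  proof -
    have "l1norm x * l1norm y * (ang2 x y - 2 * indicator (- bulk \<epsilon> t) x - 2 * indicator (- bulk \<epsilon> t) y)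
        = conc x * l1norm y + l1norm x * conc y - 2 * (y \<bullet> x) - 2 * (?b x * l1norm y) - 2 * (l1norm x * ?b y)"
      using l1norm_mult_ang2[OF that] by (simp add: algebra_simps inner_commute)
    then show ?thesis using bound[OF that] by (simp only: G_def)
  qed
  note inc = incr_integrable[OF rn Rn t]
  have "rate (rn n) (Rn n) t \<le> (\<integral>x. H x \<partial>f t)"
    unfolding rate_def
  proof (rule integral_mono)
    show "integrable (f t) H" using HI by (simp add: has_bochner_integral_iff)
    fix x assume x: "x \<in> space (f t)"
    have "(\<integral>y. K x y * incr (rn n) (Rn n) x y \<partial>f t) \<le> (\<integral>y. G x y \<partial>f t)"
      using x le G by (intro integral_mono inc) (auto simp: f_space[OF t0(1)] has_bochner_integral_iff)
    also have "\<dots> = H x" using G by (simp add: has_bochner_integral_iff)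
    finally show "(\<integral>y. K x y * incr (rn n) (Rn n) x y \<partial>f t) \<le> H x" .
  qed (rule inc)
  also have "\<dots> = 2 * \<alpha> * m0 * ?W - 2 * \<beta> * m0 * (spread t - 2 * ?T)"
    using HI m0_pos by (simp add: has_bochner_integral_iff spread_def algebra_simps)
  also have "\<dots> \<le> 2 * \<alpha> * m0 * ?W - 2 * \<beta> * m0 * (spread t - 2 * tail_bound \<epsilon>)"
    using tail(2)[OF \<open>0 < \<epsilon>\<close> t] \<open>0 \<le> \<beta>\<close> m0_pos
    by (intro diff_left_mono mult_left_mono) auto
  finally show ?thesis .
qed

text \<open>The time interval is fixed while \<open>n\<close> tends to infinity, which removes the
  term with \<open>W\<close>. The hypothesis quantifies over \<open>W\<close> since that bound is
  only obtained inside the argument, and it holds only eventually in \<open>n\<close> because the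
  cutoffs must first enclose the bulk for all times of the interval.\<close>

lemma spread_growth:
  assumes t: "1 \<le> t1" "t1 < t2"
    and B: "\<And>W. 0 \<le> W \<Longrightarrow> (\<And>t. t \<in> {t1..t2} \<Longrightarrow> (\<integral>x. wt x \<partial>f t) \<le> W) \<Longrightarrow>
      \<forall>\<^sub>F n in sequentially. \<forall>t\<in>{t1..t2}. rate (rn n) (Rn n) t \<le> 8 * A * m0 * W / real (Suc n) + B"
  shows "spread t2 - spread t1 \<le> B / 2 * (t2 - t1)"
proof -
  obtain W where W: "0 \<le> W" "\<And>t. t \<in> {1..t2} \<Longrightarrow> (\<integral>x. wt x \<partial>f t) \<le> W"
    by (rule wt_moment[of t2]) (use t in auto)
  let ?F = "\<lambda>n t. \<integral>x. testfn (rn n) (Rn n) x \<partial>f t"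
  have "(\<lambda>n. ?F n t2 - ?F n t1) \<longlonglongrightarrow> (spread t2 + (mom \<bullet> mom) / m0 - m0) - (spread t1 + (mom \<bullet> mom) / m0 - m0)"
    using t by (intro tendsto_diff testfn_integral_tendsto) auto
  then have lim1: "(\<lambda>n. ?F n t2 - ?F n t1) \<longlonglongrightarrow> spread t2 - spread t1" by simp
  have "(\<lambda>n. 8 * A * m0 * W / real (Suc n)) \<longlonglongrightarrow> 0"
    by (rule LIMSEQ_Suc[OF lim_const_over_n])
  then have "(\<lambda>n. (8 * A * m0 * W / real (Suc n) + B) / 2 * (t2 - t1)) \<longlonglongrightarrow> (0 + B) / 2 * (t2 - t1)"
    by (intro tendsto_intros) auto
  then have lim2: "(\<lambda>n. (8 * A * m0 * W / real (Suc n) + B) / 2 * (t2 - t1)) \<longlonglongrightarrow> B / 2 * (t2 - t1)"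
    by simp
  have "\<forall>\<^sub>F n in sequentially. \<forall>t\<in>{t1..t2}. rate (rn n) (Rn n) t \<le> 8 * A * m0 * W / real (Suc n) + B"
    using W t by (intro B) auto
  then have "\<forall>\<^sub>F n in sequentially. ?F n t2 - ?F n t1 \<le> (8 * A * m0 * W / real (Suc n) + B) / 2 * (t2 - t1)"
    by eventually_elim (rule testfn_integral_growth[OF rn Rn t], blast)
  then show ?thesis
    using tendsto_le[OF trivial_limit_sequentially lim2 lim1] by blast
qed

lemma spread_antimono:
  assumes "1 \<le> t1" "t1 \<le> t2"
  shows "spread t2 \<le> spread t1"
proof (cases "t1 = t2")
  case False
  have "spread t2 - spread t1 \<le> 0 / 2 * (t2 - t1)"
  proof (rule spread_growth)
    fix W assume W: "0 \<le> W" "\<And>t. t \<in> {t1..t2} \<Longrightarrow> (\<integral>x. wt x \<partial>f t) \<le> W"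
    have "rate (rn n) (Rn n) t \<le> 8 * A * m0 * W / real (Suc n) + 0" if t: "t \<in> {t1..t2}" for n t
    proof -
      \<comment> \<open>The dissipation is discarded by \<open>\<beta> = 0\<close>, so the bulk
        parameter 1 is an arbitrary choice.\<close>
      have "rate (rn n) (Rn n) t \<le> 2 * (4 * A / real (Suc n)) * m0 * (\<integral>x. wt x \<partial>f t) - 2 * 0 * m0 * (spread t - 2 * tail_bound 1)"
      proof (rule rate_le)
        fix x y :: "real ^ 'n" assume xy: "x \<in> Rstar" "y \<in> Rstar"
        have "0 \<le> cutoff (rn n) (Rn n) (l1norm x + l1norm y) * (K x y * (conc x + conc y - conc (x + y)))"
          using cutoff_range(1)[OF rn(1) Rn] l1norm_pos[OF xy(1)] l1norm_pos[OF xy(2)] K_nonneg[OF xy] conc_add_bounds(1)[OF xy]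
          by (intro mult_nonneg_nonneg) auto
        then show "K x y * incr (rn n) (Rn n) x y \<le> 4 * A / real (Suc n) * (wt x * l1norm y + l1norm x * wt y)
          - 0 * (l1norm x * l1norm y * (ang2 x y - 2 * indicator (- bulk 1 t) x - 2 * indicator (- bulk 1 t) y))"
          using K_incr_le[OF xy, of n] by simp
      qed (use t assms in auto)
      also have "\<dots> \<le> 2 * (4 * A / real (Suc n)) * m0 * W"
        using W(2)[OF t] A_pos m0_pos by (simp add: divide_right_mono mult_left_mono)
      finally show ?thesis by simp
    qed
    then show "\<forall>\<^sub>F n in sequentially. \<forall>t\<in>{t1..t2}. rate (rn n) (Rn n) t \<le> 8 * A * m0 * W / real (Suc n) + 0"
      by (intro always_eventually) blast
  qed (use False assms in auto)
  then show ?thesis by simp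
qed simp

text \<open>By monotonicity, \<open>spread t'\<close> and \<open>1 / t'\<close> are on
  \<open>[t, 2t]\<close> at least their values at \<open>2 * t\<close>. The length \<open>t\<close>
  cancels the factor \<open>1 / t\<close>, which makes the gain independent of \<open>t\<close>. The
  hypothesis \<open>large\<close> provides the sign for multiplying these two bounds.\<close>

lemma spread_doubling:
  assumes \<epsilon>: "0 < \<epsilon>" and t: "1 \<le> t" and large: "2 * tail_bound \<epsilon> \<le> spread (2 * t)"
  shows "spread (2 * t) - spread t \<le> - (diss \<epsilon> * m0 / 2 * (spread (2 * t) - 2 * tail_bound \<epsilon>))"
proof -
  let ?v = "spread (2 * t) - 2 * tail_bound \<epsilon>"
  let ?B = "- (2 * (diss \<epsilon> / (2 * t)) * m0 * ?v)"
  have "spread (2 * t) - spread t \<le> ?B / 2 * (2 * t - t)"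
  proof (rule spread_growth)
    fix W assume W: "0 \<le> W" "\<And>t'. t' \<in> {t..2 * t} \<Longrightarrow> (\<integral>x. wt x \<partial>f t') \<le> W"
    have ev: "\<forall>\<^sub>F n in sequentially. rn n < \<epsilon> \<and> 4 * msize (2 * t) / \<epsilon> \<le> Rn n"
      using order_tendstoD(2)[OF rn_lim \<epsilon>] Rn_lim
      by (auto simp: filterlim_at_top intro: eventually_conj)
    show "\<forall>\<^sub>F n in sequentially. \<forall>t'\<in>{t..2 * t}. rate (rn n) (Rn n) t' \<le> 8 * A * m0 * W / real (Suc n) + ?B"
      using ev
    proof (eventually_elim, intro ballI)
      fix n t' assume n: "rn n < \<epsilon> \<and> 4 * msize (2 * t) / \<epsilon> \<le> Rn n" and t': "t' \<in> {t..2 * t}"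
      have t1: "t' \<ge> 1" using t t' by auto
      have "4 * msize t' / \<epsilon> \<le> 4 * msize (2 * t) / \<epsilon>"
        using \<epsilon> t t' by (intro divide_right_mono mult_left_mono msize_mono) auto
      then have nn: "rn n \<le> \<epsilon>" "4 * msize t' / \<epsilon> \<le> Rn n" using n by auto
      have "rate (rn n) (Rn n) t' \<le> 2 * (4 * A / real (Suc n)) * m0 * (\<integral>x. wt x \<partial>f t')
          - 2 * (diss \<epsilon> / t') * m0 * (spread t' - 2 * tail_bound \<epsilon>)"
      proof (rule rate_le[OF t1 \<epsilon>])
        fix x y :: "real ^ 'n" assume xy: "x \<in> Rstar" "y \<in> Rstar"
        show "K x y * incr (rn n) (Rn n) x y \<le> 4 * A / real (Suc n) * (wt x * l1norm y + l1norm x * wt y)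
          - diss \<epsilon> / t' * (l1norm x * l1norm y * (ang2 x y - 2 * indicator (- bulk \<epsilon> t') x - 2 * indicator (- bulk \<epsilon> t') y))"
          using K_incr_le[OF xy, of n] dissipation_lower[OF \<epsilon> t1 xy nn] by linarith
      qed (use diss_pos[OF \<epsilon>] t1 in auto)
      moreover have "2 * (4 * A / real (Suc n)) * m0 * (\<integral>x. wt x \<partial>f t') \<le> 2 * (4 * A / real (Suc n)) * m0 * W"
        using W(2)[OF t'] A_pos m0_pos by (intro mult_left_mono) auto
      moreover have "2 * (diss \<epsilon> / (2 * t)) * m0 * ?v \<le> 2 * (diss \<epsilon> / t') * m0 * (spread t' - 2 * tail_bound \<epsilon>)"
        using diss_pos[OF \<epsilon>] t t' t1 m0_pos large spread_antimono[OF t1, of "2 * t"]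
        by (intro mult_mono divide_left_mono) auto
      moreover have "8 * A * m0 * W / real (Suc n) = 2 * (4 * A / real (Suc n)) * m0 * W" by simp
      ultimately show "rate (rn n) (Rn n) t' \<le> 8 * A * m0 * W / real (Suc n) + ?B" by linarith
    qed
  qed (use t in auto)
  also have "\<dots> = - (diss \<epsilon> * m0 / 2 * ?v)" using t by (simp add: field_simps)
  finally show ?thesis .
qed

lemma tail_bound_tendsto: "(tail_bound \<longlongrightarrow> 0) (at_right 0)"
proof -
  have pw: "((\<lambda>\<epsilon>::real. \<epsilon> powr b) \<longlongrightarrow> 0) (at_right 0)" if "b > 0" for b :: real
  proof -
    have "((\<lambda>\<epsilon>::real. \<epsilon> powr b) \<longlongrightarrow> 0 powr b) (at_right 0)"
      using that by (intro tendsto_powr') (auto intro!: tendsto_intros simp: eventually_at_filter)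
    then show ?thesis using that by simp
  qed
  have "(tail_bound \<longlongrightarrow> C0 * (0 + 0)) (at_right 0)"
    unfolding tail_bound_def using a by (intro tendsto_intros pw) auto
  then show ?thesis by simp
qed

text \<open>Along powers of 2 the values decrease to a limit. A positive limit would force the same
  loss at every doubling, which contradicts convergence. Monotonicity fills in the remaining
  times.\<close>

lemma spread_tendsto: "(spread \<longlongrightarrow> 0) at_top"
proof -
  let ?h = "\<lambda>k. spread (2 ^ k)"
  have dec: "decseq ?h"
    by (rule decseq_SucI, rule spread_antimono) auto
  have nonneg: "0 \<le> ?h k" for k by (intro spread_nonneg) simp
  obtain l where l: "?h \<longlonglongrightarrow> l" "\<And>k. l \<le> ?h k"
    by (rule decseq_convergent[OF dec, of 0]) (use nonneg in auto)
  have "l \<le> 0"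
  proof (rule ccontr)
    assume "\<not> l \<le> 0"
    then have "\<forall>\<^sub>F \<epsilon> in at_right 0. tail_bound \<epsilon> < l / 4"
      using order_tendstoD(2)[OF tail_bound_tendsto, of "l / 4"] by simp
    then obtain b where b: "0 < b" "\<And>\<epsilon>. 0 < \<epsilon> \<Longrightarrow> \<epsilon> < b \<Longrightarrow> tail_bound \<epsilon> < l / 4"
      unfolding eventually_at_right_field by auto
    \<comment> \<open>Any point of \<open>(0, b)\<close> would do: the tail then takes less than
      half of \<open>l\<close> and leaves a dissipation proportional to
      \<open>l / 2\<close>.\<close>
    define \<epsilon> where "\<epsilon> = b / 2"
    have \<epsilon>: "0 < \<epsilon>" "2 * tail_bound \<epsilon> < l / 2" using b(1) b(2)[of \<epsilon>] by (auto simp: \<epsilon>_def)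
    have step: "?h (Suc k) - ?h k \<le> - (diss \<epsilon> * m0 / 2 * (l / 2))" for k
    proof -
      have "?h (Suc k) - ?h k \<le> - (diss \<epsilon> * m0 / 2 * (?h (Suc k) - 2 * tail_bound \<epsilon>))"
        using spread_doubling[OF \<epsilon>(1), of "2 ^ k"] l(2)[of "Suc k"] \<epsilon>(2) \<open>\<not> l \<le> 0\<close> by simp
      also have "\<dots> \<le> - (diss \<epsilon> * m0 / 2 * (l / 2))"
        using l(2)[of "Suc k"] \<epsilon>(2) diss_pos[OF \<epsilon>(1)] m0_pos
        by (intro le_imp_neg_le mult_left_mono) auto
      finally show ?thesis .
    qed
    have "(\<lambda>k. ?h (Suc k) - ?h k) \<longlonglongrightarrow> l - l"
      by (intro tendsto_diff LIMSEQ_Suc l)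
    then have "l - l \<le> - (diss \<epsilon> * m0 / 2 * (l / 2))"
      by (rule LIMSEQ_le_const2) (use step in auto)
    moreover have "0 < diss \<epsilon> * m0 / 2 * (l / 2)"
      using diss_pos[OF \<epsilon>(1)] m0_pos \<open>\<not> l \<le> 0\<close> by simp
    ultimately show False by simp
  qed
  have "\<forall>\<^sub>F t in at_top. \<bar>spread t\<bar> < e" if "0 < e" for e
  proof -
    have "\<forall>\<^sub>F k in sequentially. ?h k < e"
      using order_tendstoD(2)[OF l(1), of e] that \<open>l \<le> 0\<close> by simp
    then obtain k where k: "?h k < e" by (auto simp: eventually_sequentially)
    have "\<bar>spread t\<bar> < e" if "2 ^ k \<le> t" for t
    proof -
      have "(1::real) \<le> 2 ^ k" by simp
      with that have "1 \<le> t" by linarith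
      then have "0 \<le> spread t" "spread t \<le> ?h k"
        using that by (auto intro!: spread_nonneg spread_antimono)
      then show ?thesis using k by simp
    qed
    then show ?thesis unfolding eventually_at_top_linorder by blast
  qed
  then show ?thesis by (simp add: tendsto_iff)
qed

end

section \<open>Localization\<close>

text \<open>Supplies the width \<delta>: it has to be continuous and positive, whereas
  \<open>spread\<close> is only known to be monotone and may vanish. The bound \<open>M\<close>
  keeps the supremum below finite.\<close>

lemma continuous_majorant:
  fixes h :: "real \<Rightarrow> real"
  assumes h: "\<And>t. t \<ge> 1 \<Longrightarrow> 0 \<le> h t" "\<And>t. t \<ge> 1 \<Longrightarrow> h t \<le> M" and lim: "(h \<longlongrightarrow> 0) at_top"
  obtains \<delta> where "continuous_on {0..} \<delta>" "\<And>t. t \<ge> 1 \<Longrightarrow> 0 < \<delta> t" "\<And>t. t \<ge> 1 \<Longrightarrow> h t \<le> \<delta> t"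
    "(\<delta> \<longlongrightarrow> 0) at_top"
proof -
  \<comment> \<open>The sup-convolution of \<open>h\<close> with \<open>-|t|\<close> is the least 1-Lipschitz majorant.\<close>
  define S where "S t = (SUP s\<in>{1..}. h s - \<bar>t - s\<bar>)" for t
  have bdd: "bdd_above ((\<lambda>s. h s - \<bar>t - s\<bar>) ` {1..})" for t
    by (rule bdd_aboveI2[of _ _ M]) (use h(2) in force)
  have S_ge: "h s - \<bar>t - s\<bar> \<le> S t" if "s \<ge> 1" for s t
    unfolding S_def using that by (intro cSUP_upper bdd) auto
  have h_le: "h t \<le> S t" if "t \<ge> 1" for t
    using S_ge[OF that, of t] by simp
  have lip: "S t \<le> S t' + \<bar>t - t'\<bar>" for t t'
    unfolding S_def[of t]
  proof (rule cSUP_least)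
    fix s :: real assume "s \<in> {1..}"
    then show "h s - \<bar>t - s\<bar> \<le> S t' + \<bar>t - t'\<bar>" using S_ge[of s t'] by simp
  qed auto
  have cont: "continuous_on {0..} S"
    unfolding continuous_on_iff
  proof (intro ballI allI impI)
    fix x e :: real assume "0 < e"
    then show "\<exists>d>0. \<forall>x'\<in>{0..}. dist x' x < d \<longrightarrow> dist (S x') (S x) < e"
    proof (intro exI[of _ e] conjI ballI impI)
      fix x' assume "dist x' x < e"
      then show "dist (S x') (S x) < e"
        using lip[of x x'] lip[of x' x] by (auto simp: dist_real_def)
    qed
  qed
  have S_lim: "(S \<longlongrightarrow> 0) at_top"
  proof (rule tendstoI)
    fix e :: real assume "0 < e"
    have "\<forall>\<^sub>F t in at_top. h t < e / 2"
      using order_tendstoD(2)[OF lim, of "e / 2"] \<open>0 < e\<close> by simp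
    then obtain N where N: "\<And>t. t \<ge> N \<Longrightarrow> h t < e / 2"
      by (auto simp: eventually_at_top_linorder)
    \<comment> \<open>Beyond \<open>N + M\<close>, every \<open>s < N\<close> has distance more than
      \<open>M\<close> from \<open>t\<close>, so the bounded values of \<open>h\<close> before
      \<open>N\<close> contribute nothing positive.\<close>
    have "dist (S t) 0 < e" if t: "t \<ge> max 1 (N + M)" for t
    proof -
      have "S t \<le> e / 2"
        unfolding S_def
      proof (rule cSUP_least)
        fix s :: real assume s: "s \<in> {1..}"
        show "h s - \<bar>t - s\<bar> \<le> e / 2"
        proof (cases "s \<ge> N")
          case True
          then show ?thesis using N[of s] abs_ge_zero[of "t - s"] by linarith
        next
          case False
          moreover have "h s \<le> M" using h(2) s by simp
          ultimately show ?thesis using t \<open>0 < e\<close> abs_ge_self[of "t - s"] by auto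
        qed
      qed auto
      moreover have "0 \<le> S t" using h_le[of t] h(1)[of t] t by simp
      ultimately show ?thesis using \<open>0 < e\<close> by (simp add: dist_real_def)
    qed
    then show "\<forall>\<^sub>F t in at_top. dist (S t) 0 < e"
      unfolding eventually_at_top_linorder by blast
  qed
  show thesis
  proof
    \<comment> \<open>The summand \<open>1 / (1 + t)\<close> makes the majorant strictly positive
      without changing the limit.\<close>
    show "continuous_on {0..} (\<lambda>t. S t + 1 / (1 + t))"
      by (intro continuous_intros cont) auto
    show "0 < S t + 1 / (1 + t)" "h t \<le> S t + 1 / (1 + t)" if "t \<ge> 1" for t
      using that h_le[of t] h(1)[of t] by (auto intro!: add_nonneg_pos simp: add_increasing2)
    have "((\<lambda>t::real. 1 / (1 + t)) \<longlongrightarrow> 0) at_top"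
      by (intro real_tendsto_divide_at_top[OF tendsto_const]
          filterlim_tendsto_add_at_top[OF tendsto_const filterlim_ident])
    from tendsto_add[OF S_lim this] show "((\<lambda>t. S t + 1 / (1 + t)) \<longlongrightarrow> 0) at_top" by simp
  qed
qed

context coagulation
begin

definition core :: "real \<Rightarrow> real \<Rightarrow> (real ^ 'n) set" where
  "core d t = bulk d t \<inter> {x. l1norm ((1 / l1norm x) *\<^sub>R x - (1 / m0) *\<^sub>R mom) \<le> d}"

text \<open>Chebyshev's inequality costs \<open>1 / d^2\<close>, so a spread of at most
  \<open>d^3\<close> leaves an angular defect of order \<open>d\<close>. The dimension comes from
  \<open>l1norm_square_le\<close>.\<close>

lemma core_mass:
  assumes t: "t \<ge> 1" and d: "0 < d" and spread: "spread t \<le> d ^ 3"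
  shows "\<bar>(LINT x:core d t | f t. l1norm x) - m0\<bar> \<le> tail_bound d + real CARD('n) * d"
proof -
  have t0: "t \<ge> 0" "t > 0" using t by auto
  let ?z = "\<lambda>x. (1 / l1norm x) *\<^sub>R x - (1 / m0) *\<^sub>R mom"
  have [measurable]: "l1norm \<in> borel_measurable (f t)" using integrable_l1norm[OF t0(1)] by auto
  have "continuous_on Rstar (\<lambda>x. l1norm (?z x))"
    by (intro continuous_intros) (auto dest: l1norm_pos)
  then have [measurable]: "(\<lambda>x. l1norm (?z x)) \<in> borel_measurable (f t)"
    by (rule f_measurable[OF t0(1)])
  have int: "integrable (f t) (\<lambda>x. indicator (core d t) x * l1norm x)"
  proof (rule Bochner_Integration.integrable_bound[OF integrable_l1norm[OF t0(1)]])
    have "(\<lambda>x. if (d * msize t \<le> l1norm x \<and> l1norm x \<le> inverse d * msize t) \<and> l1norm (?z x) \<le> d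
        then l1norm x else 0) \<in> borel_measurable (f t)"
      by measurable
    then show "(\<lambda>x. indicator (core d t) x * l1norm x) \<in> borel_measurable (f t)"
      by (rule measurable_cong[THEN iffD1, rotated]) (auto simp: core_def bulk_def indicator_def)
  qed (auto simp: indicator_def)
  have eq: "m0 - (LINT x:core d t | f t. l1norm x) = (\<integral>x. l1norm x - indicator (core d t) x * l1norm x \<partial>f t)"
    using int integrable_l1norm[OF t0(1)] integral_l1norm[OF t0(1)]
    by (simp add: set_lebesgue_integral_def)
  have "0 \<le> (\<integral>x. l1norm x - indicator (core d t) x * l1norm x \<partial>f t)"
    by (intro integral_nonneg_AE AE_I2) (auto simp: indicator_def l1norm_nonneg)
  moreover have "(\<integral>x. l1norm x - indicator (core d t) x * l1norm x \<partial>f t)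
      \<le> (\<integral>x. l1norm x * indicator (- bulk d t) x + real CARD('n) / d\<^sup>2 * (l1norm x * (norm (?z x))\<^sup>2) \<partial>f t)"
  proof (rule integral_mono)
    fix x assume "x \<in> space (f t)"
    have sq: "1 \<le> real CARD('n) / d\<^sup>2 * (norm (?z x))\<^sup>2" if "\<not> l1norm (?z x) \<le> d"
    proof -
      have "d\<^sup>2 \<le> (l1norm (?z x))\<^sup>2" using that d by (intro power_mono) auto
      also have "\<dots> \<le> real CARD('n) * (norm (?z x))\<^sup>2"
        using l1norm_square_le[of "?z x"] by (simp add: power2_norm_eq_inner)
      finally show ?thesis using d by (simp add: field_simps)
    qed
    consider "x \<in> core d t" | "x \<notin> bulk d t" | "x \<in> bulk d t" "\<not> l1norm (?z x) \<le> d"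
      by (auto simp: core_def)
    then show "l1norm x - indicator (core d t) x * l1norm x
        \<le> l1norm x * indicator (- bulk d t) x + real CARD('n) / d\<^sup>2 * (l1norm x * (norm (?z x))\<^sup>2)"
    proof cases
      case 3
      have "l1norm x * 1 \<le> l1norm x * (real CARD('n) / d\<^sup>2 * (norm (?z x))\<^sup>2)"
        by (intro mult_left_mono sq 3 l1norm_nonneg)
      then show ?thesis using 3 by (simp add: core_def mult_ac)
    qed (auto simp: core_def l1norm_nonneg)
  next
    show "integrable (f t) (\<lambda>x. l1norm x - indicator (core d t) x * l1norm x)"
      by (intro Bochner_Integration.integrable_diff int integrable_l1norm t0)
    show "integrable (f t) (\<lambda>x. l1norm x * indicator (- bulk d t) x + real CARD('n) / d\<^sup>2 * (l1norm x * (norm (?z x))\<^sup>2))"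
      by (intro Bochner_Integration.integrable_add integrable_mult_right tail(1) spread_eq(1) d t t0)
  qed
  moreover have "(\<integral>x. l1norm x * indicator (- bulk d t) x + real CARD('n) / d\<^sup>2 * (l1norm x * (norm (?z x))\<^sup>2) \<partial>f t)
      = (\<integral>x. l1norm x * indicator (- bulk d t) x \<partial>f t) + real CARD('n) / d\<^sup>2 * spread t"
    unfolding spread_eq(2)[OF t0(2), symmetric] integral_mult_right_zero[symmetric]
    by (intro Bochner_Integration.integral_add integrable_mult_right tail(1) spread_eq(1) d t t0)
  moreover have "real CARD('n) / d\<^sup>2 * spread t \<le> real CARD('n) / d\<^sup>2 * d ^ 3"
    by (intro mult_left_mono spread) auto
  moreover have "real CARD('n) / d\<^sup>2 * d ^ 3 = real CARD('n) * d"
    using d by (simp add: power2_eq_square power3_eq_cube)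
  ultimately show ?thesis
    using tail(2)[OF d t] eq by linarith
qed

lemma mean_in_Simplex: "(1 / m0) *\<^sub>R mom \<in> Simplex"
proof -
  \<comment> \<open>Time 1 stands for any positive time, as the first moment is conserved.\<close>
  have comp: "has_bochner_integral (f 1) (\<lambda>x. x $ i) (mom $ i)" for i
    by (rule has_bochner_integral_bounded_linear[OF bounded_linear_vec_nth first_moment]) simp
  have sp: "space (f 1) = Rstar" by (rule f_space) simp
  have nonneg: "0 \<le> mom $ i" for i
  proof -
    have "0 \<le> (\<integral>x. x $ i \<partial>f 1)"
      by (intro integral_nonneg_AE AE_I2) (simp add: sp Rstar_D)
    then show ?thesis using comp[of i] by (simp add: has_bochner_integral_iff)
  qed
  have "has_bochner_integral (f 1) (\<lambda>x. \<Sum>i\<in>UNIV. x $ i) (\<Sum>i\<in>UNIV. mom $ i)"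
    by (intro has_bochner_integral_sum comp)
  then have "has_bochner_integral (f 1) l1norm (\<Sum>i\<in>UNIV. mom $ i)"
    by (subst has_bochner_integral_cong[OF refl _ refl]) (auto simp: sp l1norm_Rstar)
  then have "(\<Sum>i\<in>UNIV. mom $ i) = m0"
    using mass[of 1] by (auto dest: has_bochner_integral_eq)
  then have l1: "l1norm ((1 / m0) *\<^sub>R mom) = 1"
    using m0_pos nonneg by (simp add: l1norm_def abs_mult flip: sum_divide_distrib)
  then have "(1 / m0) *\<^sub>R mom \<noteq> 0" by (metis l1norm_nonneg l1norm_def abs_zero sum.neutral zero_index zero_neq_one)
  with l1 nonneg m0_pos show ?thesis by (simp add: Simplex_def Rstar_def)
qed

lemma localization:
  obtains \<delta> where "continuous_on {0..} \<delta>" "\<And>t. t \<ge> 1 \<Longrightarrow> 0 < \<delta> t" "(\<delta> \<longlongrightarrow> 0) at_top"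
    "((\<lambda>t. (LINT x:core (\<delta> t) t | f t. l1norm x) - m0) \<longlongrightarrow> 0) at_top"
proof -
  \<comment> \<open>Positive widths above the cube root are those to which \<open>core_mass\<close>
    applies.\<close>
  have "((\<lambda>t. root 3 (spread t)) \<longlongrightarrow> root 3 0) at_top"
    by (intro tendsto_real_root spread_tendsto)
  then have lim: "((\<lambda>t. root 3 (spread t)) \<longlongrightarrow> 0) at_top" by simp
  obtain \<delta> where \<delta>: "continuous_on {0..} \<delta>" "\<And>t. t \<ge> 1 \<Longrightarrow> 0 < \<delta> t"
    "\<And>t. t \<ge> 1 \<Longrightarrow> root 3 (spread t) \<le> \<delta> t" "(\<delta> \<longlongrightarrow> 0) at_top"
  proof (rule continuous_majorant[OF _ _ lim])
    show "0 \<le> root 3 (spread t)" if "t \<ge> 1" for t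
      using that spread_nonneg[of t] by simp
    show "root 3 (spread t) \<le> root 3 (spread 1)" if "t \<ge> 1" for t
      using that spread_antimono[of 1 t] by simp
  qed blast
  have ev1: "\<forall>\<^sub>F t::real in at_top. 1 \<le> t" by (rule eventually_ge_at_top)
  have "filterlim \<delta> (at_right 0) at_top"
    unfolding filterlim_at
    using \<delta>(4) by (intro conjI eventually_mono[OF ev1]) (auto dest: \<delta>(2))
  then have "((\<lambda>t. tail_bound (\<delta> t)) \<longlongrightarrow> 0) at_top"
    by (rule filterlim_compose[OF tail_bound_tendsto])
  then have "((\<lambda>t. tail_bound (\<delta> t) + real CARD('n) * \<delta> t) \<longlongrightarrow> 0 + real CARD('n) * 0) at_top"
    by (intro tendsto_intros \<delta>(4))
  then have bound_lim: "((\<lambda>t. tail_bound (\<delta> t) + real CARD('n) * \<delta> t) \<longlongrightarrow> 0) at_top" by simp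
  have "spread t \<le> \<delta> t ^ 3" if "t \<ge> 1" for t
  proof -
    have "root 3 (spread t) ^ 3 \<le> \<delta> t ^ 3"
      using that \<delta>(3)[OF that] spread_nonneg[of t] by (intro power_mono) auto
    then show ?thesis using that spread_nonneg[of t] by simp
  qed
  then have "\<forall>\<^sub>F t in at_top. norm ((LINT x:core (\<delta> t) t | f t. l1norm x) - m0) \<le> tail_bound (\<delta> t) + real CARD('n) * \<delta> t"
    using eventually_mono[OF ev1] core_mass \<delta>(2) by (simp add: eventually_mono[OF ev1])
  then have "((\<lambda>t. (LINT x:core (\<delta> t) t | f t. l1norm x) - m0) \<longlongrightarrow> 0) at_top"
    by (rule Lim_null_comparison) (rule bound_lim)
  with \<delta> show thesis by (intro that)
qed

end

text \<open>The whole window \<open>[T, 2T]\<close> moves to infinity with \<open>T\<close>, so a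
  pointwise limit at infinity is uniform on it. In \<open>ennreal\<close> the supremum is meaningful
  for every \<open>T\<close>, also where the function is unbounded on the window.\<close>

lemma tendsto_SUP_window:
  fixes g :: "real \<Rightarrow> real"
  assumes "(g \<longlongrightarrow> 0) at_top"
  shows "((\<lambda>T. SUP t\<in>{T..2 * T}. ennreal \<bar>g t\<bar>) \<longlongrightarrow> 0) at_top"
proof (rule order_tendstoI)
  fix x :: ennreal assume "0 < x"
  then obtain y where y: "0 < y" "y < x" using dense by blast
  then obtain e where e: "y = ennreal e" "0 < e"
    by (cases y) (auto simp: ennreal_less_zero_iff)
  have "\<forall>\<^sub>F t in at_top. \<bar>g t\<bar> < e"
    using tendstoD[OF assms e(2)] by (simp add: dist_real_def)
  then obtain N where N: "\<And>t. t \<ge> N \<Longrightarrow> \<bar>g t\<bar> < e"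
    by (auto simp: eventually_at_top_linorder)
  have "(SUP t\<in>{T..2 * T}. ennreal \<bar>g t\<bar>) < x" if "T \<ge> N" for T
  proof -
    have "(SUP t\<in>{T..2 * T}. ennreal \<bar>g t\<bar>) \<le> ennreal e"
      using N that by (intro SUP_least ennreal_leI less_imp_le) auto
    then show ?thesis using y e by simp
  qed
  then show "\<forall>\<^sub>F T in at_top. (SUP t\<in>{T..2 * T}. ennreal \<bar>g t\<bar>) < x"
    unfolding eventually_at_top_linorder by blast
qed simp

theorem theorem1p3:
  fixes K :: "real ^ 'n \<Rightarrow> real ^ 'n \<Rightarrow> real"
    and f :: "real \<Rightarrow> (real ^ 'n) measure"
    and f0 :: "(real ^ 'n) measure"
    and c1 c2 \<gamma> p m0 a C0 :: real
    and \<theta>0 :: "real ^ 'n"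
  assumes K_cont: "continuous_on (Rstar \<times> Rstar) (\<lambda>(x, y). K x y)"
    and K_sym: "\<And>x y. x \<in> Rstar \<Longrightarrow> y \<in> Rstar \<Longrightarrow> K x y = K y x"
    and K_nonneg: "\<And>x y. x \<in> Rstar \<Longrightarrow> y \<in> Rstar \<Longrightarrow> 0 \<le> K x y"
    and c: "0 < c1" "c1 \<le> c2"
    and exponents: "\<gamma> + 2 * p \<ge> 0" "\<gamma> < 1" "\<gamma> + p < 1"
    and K_lower: "\<And>x y. x \<in> Rstar \<Longrightarrow> y \<in> Rstar \<Longrightarrow>
      c1 * (l1norm x + l1norm y) powr \<gamma> * Phi p (l1norm x / (l1norm x + l1norm y)) \<le> K x y"
    and K_upper: "\<And>x y. x \<in> Rstar \<Longrightarrow> y \<in> Rstar \<Longrightarrow>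
      K x y \<le> c2 * (l1norm x + l1norm y) powr \<gamma> * Phi p (l1norm x / (l1norm x + l1norm y))"
    and solution: "weak_solution K \<gamma> p f0 f"
    and m0_pos: "0 < m0"
    and mass: "\<And>t. t \<ge> 0 \<Longrightarrow> has_bochner_integral (f t) l1norm m0"
    and a: "a > 1"
    and C0: "C0 > 0"
    and moments: "\<And>k t. k \<in> {1/a..a} \<Longrightarrow> t \<ge> 1 \<Longrightarrow>
      (\<integral>\<^sup>+x. ennreal (l1norm x powr k) \<partial>f t) \<le> ennreal (C0 * t powr ((k - 1) / (1 - \<gamma>)))"
    and theta0: "\<theta>0 = (1 / m0) *\<^sub>R (\<integral>x. x \<partial>f0)"
  shows "\<theta>0 \<in> Simplex \<and>
    (\<exists>(\<delta> :: real \<Rightarrow> real) (I :: real set).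
      continuous_on {0..} \<delta> \<and> (\<forall>t\<ge>1. \<delta> t > 0) \<and> (\<delta> \<longlongrightarrow> 0) at_top \<and>
      I \<in> sets borel \<and> I \<subseteq> {0..} \<and>
      ((\<lambda>T. measure lborel (I \<inter> {T..2 * T}) / T) \<longlongrightarrow> 0) at_top \<and>
      ((\<lambda>T. SUP t\<in>{T..2 * T} - I. ennreal \<bar>
          (LINT x:{x. \<delta> t * t powr (1 / (1 - \<gamma>)) \<le> l1norm x \<and>
                       l1norm x \<le> inverse (\<delta> t) * t powr (1 / (1 - \<gamma>))} \<inter>
                  {x. l1norm ((1 / l1norm x) *\<^sub>R x - \<theta>0) \<le> \<delta> t} | f t. l1norm x) - m0\<bar>)
        \<longlongrightarrow> 0) at_top)"
proof -
  interpret coagulation K f f0 c1 c2 \<gamma> p m0 a C0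
    by unfold_locales fact+
  obtain \<delta> where \<delta>: "continuous_on {0..} \<delta>" "\<And>t. t \<ge> 1 \<Longrightarrow> 0 < \<delta> t" "(\<delta> \<longlongrightarrow> 0) at_top"
    "((\<lambda>t. (LINT x:core (\<delta> t) t | f t. l1norm x) - m0) \<longlongrightarrow> 0) at_top"
    by (rule localization, rule that, assumption+)
  have \<theta>0: "\<theta>0 = (1 / m0) *\<^sub>R mom" by (simp add: theta0 mom_def)
  have core_eq: "core d t = {x. d * t powr (1 / (1 - \<gamma>)) \<le> l1norm x \<and>
      l1norm x \<le> inverse d * t powr (1 / (1 - \<gamma>))} \<inter> {x. l1norm ((1 / l1norm x) *\<^sub>R x - \<theta>0) \<le> d}" for d t
    by (simp add: core_def bulk_def msize_def \<theta>0)
  \<comment> \<open>As the Lyapunov functional is monotone, no exceptional times have to be removed.\<close>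
  show ?thesis
    using mean_in_Simplex \<delta>(1-3) tendsto_SUP_window[OF \<delta>(4)]
    unfolding \<theta>0[symmetric] core_eq
    by (intro conjI exI[of _ \<delta>] exI[of _ "{}"]) auto
qed

end
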